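(* Let $H_0\in(0,1)$. For every $D>0$ and $T>0$, the family $\{L^H\}_{H\in(0,1)}$ of local times of the fractional Brownian motions $B^H$ converges in law to the local time $L^{H_0}$ of $B^{H_0}$ in the space $\mathcal{C}([-D,D]\times[0,T])$ as $H$ tends to $H_0$; that is, the laws of $(L_x^{H,t})_{(x,t)\in[-D,D]\times[0,T]}$ on $\mathcal{C}([-D,D]\times[0,T])$ converge weakly, as $H\to H_0$, to the law of $(L_x^{H_0,t})_{(x,t)\in[-D,D]\times[0,T]}$.
   Context: For $H\in(0,1)$, the fractional Brownian motion $B^H=\{B^H_t,\ t\ge 0\}$ with Hurst parameter $H$ is a centered Gaussian process with continuous paths and covariance $E[B^H_sB^H_t]=\frac12\left(t^{2H}+s^{2H}-|t-s|^{2H}\right)$. The occupation measure up to time $t$ of a measurable process $X$ is $\mu^t(A)=\int_0^t 1_{\{X_s\in A\}}\,ds$ for Borel sets $A\subset\mathbb{R}$. A local time of $X$ is a two-parameter process $L=\{L_x^t\}$ such that, for each $t$, almost surely $x\mapsto L_x^t$ is a version of the density of $\mu^t$ with respect to Lebesgue measure. $L^H=\{L_x^{H,t},\ x\in\mathbb{R},\ t\ge 0\}$ denotes the local time of $B^H$, taken in its version that is jointly continuous in $(x,t)$ (such a version exists). $\mathcal{C}([-D,D]\times[0,T])$ is the space of real continuous functions with the uniform topology. *)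

theory Defs
  imports "HOL-Probability.Probability"
begin

text \<open>Point masses are allowed as (degenerate) Gaussian laws.\<close>

definition gaussian_variable :: "'w measure \<Rightarrow> ('w \<Rightarrow> real) \<Rightarrow> bool" where
  "gaussian_variable M X \<longleftrightarrow>
     X \<in> borel_measurable M \<and>
     (\<exists>m. (AE \<omega> in M. X \<omega> = m) \<or>
          (\<exists>\<sigma>>0. distributed M lborel X (\<lambda>x. ennreal (normal_density m \<sigma> x))))"

definition gaussian_process :: "'w measure \<Rightarrow> 'i set \<Rightarrow> ('i \<Rightarrow> 'w \<Rightarrow> real) \<Rightarrow> bool" where
  "gaussian_process M I X \<longleftrightarrow>
     (\<forall>J c. finite J \<and> J \<subseteq> I \<longrightarrow> gaussian_variable M (\<lambda>\<omega>. \<Sum>i\<in>J. c i * X i \<omega>))"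

text \<open>Only the values of a process at times \<open>t \<ge> 0\<close> matter; time is typed as
  \<^typ>\<open>real\<close> throughout.\<close>

definition fractional_brownian_motion :: "real \<Rightarrow> 'w measure \<Rightarrow> (real \<Rightarrow> 'w \<Rightarrow> real) \<Rightarrow> bool" where
  "fractional_brownian_motion H M B \<longleftrightarrow>
     prob_space M \<and>
     gaussian_process M {0..} B \<and>
     (\<forall>t\<ge>0. integral\<^sup>L M (B t) = 0) \<and>
     (\<forall>s\<ge>0. \<forall>t\<ge>0. integral\<^sup>L M (\<lambda>\<omega>. B s \<omega> * B t \<omega>) =
        (t powr (2 * H) + s powr (2 * H) - \<bar>t - s\<bar> powr (2 * H)) / 2) \<and>
     (\<forall>\<omega>\<in>space M. continuous_on {0..} (\<lambda>t. B t \<omega>))"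

text \<open>The push-forward of Lebesgue measure on \<open>[0,t]\<close> under the path \<open>x\<close>, that is,
  \<open>A \<mapsto> \<integral>\<^sub>0\<^sup>t 1(x s \<in> A) ds\<close>.\<close>

definition occupation_measure :: "(real \<Rightarrow> real) \<Rightarrow> real \<Rightarrow> real measure" where
  "occupation_measure x t = distr (restrict_space lborel {0..t}) borel x"

text \<open>The nonnegativity condition is needed because \<^const>\<open>ennreal\<close> truncates negative
  values to 0.\<close>

definition is_lebesgue_density :: "real measure \<Rightarrow> (real \<Rightarrow> real) \<Rightarrow> bool" where
  "is_lebesgue_density \<mu> g \<longleftrightarrow>
     g \<in> borel_measurable borel \<and> (AE x in lborel. 0 \<le> g x) \<and>
     \<mu> = density lborel (\<lambda>x. ennreal (g x))"

text \<open>\<open>L x t \<omega>\<close> is the value at level \<open>x\<close> and time \<open>t\<close>. The exceptional null set may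
  depend on \<open>t\<close>.\<close>

definition local_time :: "'w measure \<Rightarrow> (real \<Rightarrow> 'w \<Rightarrow> real) \<Rightarrow> (real \<Rightarrow> real \<Rightarrow> 'w \<Rightarrow> real) \<Rightarrow> bool" where
  "local_time M X L \<longleftrightarrow>
     (\<forall>x. \<forall>t\<ge>0. L x t \<in> borel_measurable M) \<and>
     (\<forall>t\<ge>0. AE \<omega> in M.
        is_lebesgue_density (occupation_measure (\<lambda>s. X s \<omega>) t) (\<lambda>x. L x t \<omega>))"

definition jointly_continuous :: "'w measure \<Rightarrow> (real \<Rightarrow> real \<Rightarrow> 'w \<Rightarrow> real) \<Rightarrow> bool" where
  "jointly_continuous M L \<longleftrightarrow>
     (\<forall>\<omega>\<in>space M. continuous_on (UNIV \<times> {0..}) (\<lambda>(x, t). L x t \<omega>))"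

text \<open>The continuous real functions on \<open>K\<close> (extended by \<^const>\<open>undefined\<close> outside \<open>K\<close>)
  with the topology of the supremum distance. The space \<^const>\<open>cfunspace\<close> consists of
  bounded continuous functions; for compact \<open>K\<close> boundedness is automatic.\<close>

definition C_topology :: "'a::topological_space set \<Rightarrow> ('a \<Rightarrow> real) topology" where
  "C_topology K = mtopology_of (cfunspace (top_of_set K) euclidean_metric)"

definition borel_of :: "'a topology \<Rightarrow> 'a measure" where
  "borel_of X = sigma (topspace X) {U. openin X U}"

definition borel_prob_on :: "'a topology \<Rightarrow> 'a measure \<Rightarrow> bool" where
  "borel_prob_on X \<mu> \<longleftrightarrow> prob_space \<mu> \<and> sets \<mu> = sets (borel_of X)"

definition weakly_converges ::
  "'a topology \<Rightarrow> ('i \<Rightarrow> 'a measure) \<Rightarrow> 'a measure \<Rightarrow> 'i filter \<Rightarrow> bool" where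
  "weakly_converges X \<mu> \<nu> F \<longleftrightarrow>
     borel_prob_on X \<nu> \<and> (\<forall>\<^sub>F i in F. borel_prob_on X (\<mu> i)) \<and>
     (\<forall>f. continuous_map X euclideanreal f \<and> bounded (f ` topspace X) \<longrightarrow>
        ((\<lambda>i. integral\<^sup>L (\<mu> i) f) \<longlongrightarrow> integral\<^sup>L \<nu> f) F)"

definition law_on :: "(real \<times> real) set \<Rightarrow> 'w measure \<Rightarrow> (real \<Rightarrow> real \<Rightarrow> 'w \<Rightarrow> real) \<Rightarrow>
    (real \<times> real \<Rightarrow> real) measure" where
  "law_on K M L = distr M (borel_of (C_topology K)) (\<lambda>\<omega>. restrict (\<lambda>(x, t). L x t \<omega>) K)"

end

theory Submission
  imports Defs
begin

text \<open>The local time \<open>L = L\<^sup>H\<close> of the path \<open>B = B\<^sup>H\<close> is compared, on \<open>K = [-D,D] \<times> [0,T]\<close>, with a quantity that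
depends on finitely many values of the path. For the triangular probability density \<open>tri \<epsilon>\<close> of half-width \<open>\<epsilon>\<close>, the mollified
occupation density \<open>A\<^sub>\<epsilon>(x,t) = \<integral>\<^sub>0\<^sup>t tri \<epsilon> (B\<^sub>r - x) dr\<close> is the average of the local time \<open>L\<^sup>t\<close> around \<open>x\<close>,
so it differs from \<open>L\<^sup>t\<close> at \<open>x\<close> by at most the modulus of continuity of \<open>L\<^sup>t\<close>. It is also close to a
Riemann sum \<open>A\<^sub>\<epsilon>\<^sub>,\<^sub>N\<close>, a Lipschitz function of \<open>(B\<^sub>t)\<close> on a grid of \<open>N\<close> times. Hence for a bounded
Lipschitz functional \<open>F\<close> on \<open>C(K)\<close> the expectation of \<open>F(L)\<close> is close to that of \<open>F(A\<^sub>\<epsilon>)\<close> and then to that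
of \<open>F(A\<^sub>\<epsilon>\<^sub>,\<^sub>N)\<close>, and the last expectation is continuous in \<open>H\<close>, because it concerns a Gaussian vector whose covariance
is continuous in \<open>H\<close>. Everything depends on the first error being small uniformly for \<open>H\<close> near \<open>H\<^sub>0\<close>;
the second one is controlled by \<open>E |B\<^sub>s - B\<^sub>t| \<le> |s - t|\<^sup>H\<close>.

The uniformity comes from a moment estimate for a large even \<open>n\<close> that depends on an upper bound for \<open>H\<close>
(\<open>local_time_increment_moment\<close>): the increment of \<open>L\<^sup>t - L\<^sup>s\<close> between the levels \<open>x\<close> and \<open>y\<close> has \<open>n\<close>-th
moment at most \<open>C |x - y|\<^sup>3 (t - s)\<^sup>2\<close>, with \<open>C\<close> independent of \<open>H\<close>. Writing \<open>tri \<epsilon>\<close> as a Fourier integral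
reduces it to integrals of \<open>\<Prod>\<^sub>j |u\<^sub>j|\<^sup>\<alpha> exp (- Q(u)/2)\<close> with \<open>\<alpha> = 3/n\<close>, where \<open>Q(u)\<close> is the variance of
\<open>\<Sum>\<^sub>j u\<^sub>j B(r\<^sub>j)\<close>. They are controlled by strong local nondeterminism: \<open>Q(u) \<ge> c \<rho>\<^sup>2\<^sup>H u\<^sub>k\<^sup>2\<close> whenever \<open>r\<^sub>k\<close> has
distance at least \<open>\<rho>\<close> from \<open>0\<close> and from the other times (\<open>fbm_local_nondeterminism\<close>). That bound
follows from the spectral representation of the covariance and the Cauchy-Schwarz inequality, tested
against a triangular bump of width \<open>\<rho>\<close> around \<open>r\<^sub>k\<close>. Used for every \<open>k\<close>, it bounds the factors \<open>|u\<^sub>k|\<^sup>\<alpha>\<close>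
by powers of \<open>Q(u)\<close>; used for the last nonzero \<open>u\<^sub>k\<close>, it bounds the Gaussian integral by a product of
negative powers of the gaps between consecutive times, which is integrable over the ordered simplex.

The exponent \<open>3\<close> gives a modulus of continuity in the level by dyadic chaining, at each time of a grid.
The exponent \<open>2\<close> makes all increments over the cells of a fine time grid small simultaneously, and the
monotonicity of \<open>t \<mapsto> L\<^sup>t\<close> interpolates between grid times (\<open>local_time_uniform_approximation\<close>).

Finally, bounded continuous functionals reduce to Lipschitz ones by infimal convolution
(\<open>expectation_tendsto_from_lipschitz\<close>), and Gaussian vectors are handled by smoothing: their mollified
densities converge pointwise by Fourier inversion and dominated convergence, hence in \<open>L\<^sup>1\<close> by
Scheffe's lemma (\<open>fbm_finite_dimensional_convergence\<close>).\<close>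

section \<open>Spectral representation and strong local nondeterminism\<close>

lemma integrable_abs_powr_split:
  fixes f :: "real \<Rightarrow> real"
  assumes [measurable]: "f \<in> borel_measurable borel" and p: "p > -1" and q: "q < -1"
    and small: "\<And>x. \<bar>x\<bar> \<le> 1 \<Longrightarrow> \<bar>f x\<bar> \<le> A * \<bar>x\<bar> powr p"
    and large: "\<And>x. \<bar>x\<bar> \<ge> 1 \<Longrightarrow> \<bar>f x\<bar> \<le> A * \<bar>x\<bar> powr q"
  shows "integrable lborel f"
proof -
  define g :: "real \<Rightarrow> real" where "g = (\<lambda>x. indicator {0..1} x * x powr p + indicator {1..} x * x powr q)"
  have "((\<lambda>x. x powr p) has_integral (1 powr (p+1) / (p+1))) {0..1}"
    using has_integral_powr_from_0[of p 1] p by simp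
  from nn_integral_has_integral_lebesgue[OF _ this]
  have 1: "integrable lborel (\<lambda>x::real. indicator {0..1} x * x powr p)"
    by (intro integrableI_nonneg) auto
  have "((\<lambda>x. x powr q) has_integral -(1 powr (q+1)) / (q+1)) {1..}"
    using has_integral_powr_to_inf[of q 1] q by simp
  from nn_integral_has_integral_lebesgue[OF _ this]
  have 2: "integrable lborel (\<lambda>x::real. indicator {1..} x * x powr q)"
    by (intro integrableI_nonneg) auto
  have g: "integrable lborel g" unfolding g_def using 1 2 by (rule Bochner_Integration.integrable_add)
  have g': "integrable lborel (\<lambda>x. g (- x))"
    using lborel_integrable_real_affine[OF g, of "-1" 0] by simp
  have gnn: "g x \<ge> 0" for x by (auto simp: g_def)
  have A: "A \<ge> 0" using small[of 1] by auto
  have "integrable lborel (\<lambda>x. A * (g x + g (- x)))"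
    using g g' by auto
  then show ?thesis
  proof (rule Bochner_Integration.integrable_bound)
    show "AE x in lborel. norm (f x) \<le> norm (A * (g x + g (- x)))"
    proof (rule AE_I2)
      fix x :: real
      have "\<bar>f x\<bar> \<le> A * (g x + g (- x))"
      proof (cases "\<bar>x\<bar> \<le> 1")
        case True
        have "\<bar>x\<bar> powr p \<le> g x + g (-x)"
          using True by (cases "x \<ge> 0") (auto simp: g_def indicator_def)
        then show ?thesis using small[OF True] A by (meson mult_left_mono order_trans)
      next
        case False
        then have "\<bar>x\<bar> powr q \<le> g x + g (-x)"
          by (cases "x \<ge> 0") (auto simp: g_def indicator_def)
        then show ?thesis using large[of x] False A by (meson mult_left_mono order_trans linear)
      qed
      then show "norm (f x) \<le> norm (A * (g x + g (- x)))" by simp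
    qed
  qed simp
qed

lemma one_minus_cos_le: "1 - cos (x::real) \<le> x\<^sup>2 / 2"
proof -
  have "1 - cos x = 2 * (sin (x/2))\<^sup>2"
    using cos_double_sin[of "x/2"] by simp
  also have "\<bar>sin (x/2)\<bar> \<le> \<bar>x/2\<bar>" by (rule abs_sin_x_le_abs_x)
  then have "2 * (sin (x/2))\<^sup>2 \<le> 2 * (x/2)\<^sup>2"
    unfolding abs_le_square_iff by simp
  finally show ?thesis by (simp add: power2_eq_square)
qed

text \<open>By scaling, \<open>\<integral> (1 - cos (x l)) |l|\<^sup>-\<^sup>1\<^sup>-\<^sup>p dl = osc_const p * |x|\<^sup>p\<close>. With \<open>p = 2H\<close> this identity is
the spectral representation of fractional Brownian motion; with \<open>p = 1\<close> it computes the Fourier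
transform of a triangle.\<close>

definition osc_const :: "real \<Rightarrow> real" where
  "osc_const p = (LBINT l. (1 - cos l) * \<bar>l\<bar> powr (-1 - p))"

lemma integrable_one_minus_cos_powr:
  fixes p x :: real
  assumes "0 < p" "p < 2"
  shows "integrable lborel (\<lambda>l. (1 - cos (x * l)) * \<bar>l\<bar> powr (-1 - p))"
proof (rule integrable_abs_powr_split[where p = "1 - p" and q = "-1 - p" and A = "2 + x\<^sup>2"])
  fix l :: real
  have *: "\<bar>1 - cos (x*l)\<bar> \<le> (2 + x\<^sup>2) * l\<^sup>2"
    using one_minus_cos_le[of "x*l"] cos_le_one[of "x*l"] zero_le_power2[of l] mult_nonneg_nonneg[OF zero_le_power2[of x] zero_le_power2[of l]]
    unfolding power_mult_distrib distrib_right by linarith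
  have e: "l\<^sup>2 * \<bar>l\<bar> powr (-1-p) = \<bar>l\<bar> powr (1-p)"
  proof (cases "l = 0")
    case False
    then have "l\<^sup>2 = \<bar>l\<bar> powr 2" by (simp add: powr_numeral)
    then have "l\<^sup>2 * \<bar>l\<bar> powr (-1-p) = \<bar>l\<bar> powr (2 + (-1-p))" by (simp only: powr_add)
    then show ?thesis by simp
  qed simp
  show "\<bar>(1 - cos (x * l)) * \<bar>l\<bar> powr (- 1 - p)\<bar> \<le> (2 + x\<^sup>2) * \<bar>l\<bar> powr (1 - p)"
    using mult_right_mono[OF *, of "\<bar>l\<bar> powr (-1-p)"] by (simp add: abs_mult mult.assoc e)
  have **: "\<bar>1 - cos (x*l)\<bar> \<le> 2 + x\<^sup>2" using cos_ge_minus_one[of "x*l"] cos_le_one[of "x*l"]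
    by (smt (verit) zero_le_power2)
  show "\<bar>(1 - cos (x * l)) * \<bar>l\<bar> powr (- 1 - p)\<bar> \<le> (2 + x\<^sup>2) * \<bar>l\<bar> powr (- 1 - p)"
    using mult_right_mono[OF **, of "\<bar>l\<bar> powr (-1-p)"] by (simp add: abs_mult)
qed (use assms in auto)

lemma integral_one_minus_cos_powr:
  assumes "0 < p" "p < 2"
  shows "(LBINT l. (1 - cos (x * l)) * \<bar>l\<bar> powr (-1 - p)) = osc_const p * \<bar>x\<bar> powr p"
proof (cases "x = 0")
  case False
  have "osc_const p = \<bar>x\<bar> * (LBINT l. (1 - cos (x * l)) * \<bar>x * l\<bar> powr (-1 - p))"
    unfolding osc_const_def by (subst lborel_integral_real_affine[OF False, of _ 0]) simp
  also have "\<dots> = \<bar>x\<bar> * (LBINT l. \<bar>x\<bar> powr (-1 - p) * ((1 - cos (x * l)) * \<bar>l\<bar> powr (-1 - p)))"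
    by (simp add: abs_mult powr_mult algebra_simps)
  also have "\<dots> = \<bar>x\<bar> * \<bar>x\<bar> powr (-1-p) * (LBINT l. (1 - cos (x * l)) * \<bar>l\<bar> powr (-1 - p))"
    by simp
  also have "\<bar>x\<bar> * \<bar>x\<bar> powr (-1-p) = \<bar>x\<bar> powr (-p)"
    using False powr_add[of "\<bar>x\<bar>" 1 "-1-p"] by simp
  finally show ?thesis using False by (simp add: powr_minus field_simps)
qed simp

lemma osc_const_nonneg: "0 \<le> osc_const p"
  unfolding osc_const_def by (intro Bochner_Integration.integral_nonneg) auto

lemma osc_const_pos:
  assumes "0 < p" "p < 2" shows "0 < osc_const p"
proof -
  have int: "integrable lborel (\<lambda>l. (1 - cos l) * \<bar>l\<bar> powr (-1 - p))"
    using integrable_one_minus_cos_powr[OF assms, of 1] by simp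
  have "osc_const p \<noteq> 0"
  proof
    assume "osc_const p = 0"
    then have "AE l in lborel. (1 - cos l) * \<bar>l\<bar> powr (-1 - p) = 0"
      unfolding osc_const_def using integral_nonneg_eq_0_iff_AE[OF int] by auto
    then have "AE l in lborel. \<not> (l \<in> {1..2::real})"
    proof (eventually_elim, safe)
      fix l :: real assume "(1 - cos l) * \<bar>l\<bar> powr (-1 - p) = 0" "l \<in> {1..2}"
      then have "cos l = 1" by auto
      moreover have "cos l < cos 0" using \<open>l \<in> {1..2}\<close> pi_gt3 by (intro cos_monotone_0_pi) auto
      ultimately show False by simp
    qed
    then have "emeasure lborel {1..2::real} = 0"
      using AE_iff_measurable[of "{1..2::real}" lborel "\<lambda>l. l \<notin> {1..2}"] by (simp del: atLeastAtMost_iff)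
    then show False by simp
  qed
  then show ?thesis using osc_const_nonneg[of p] by simp
qed

text \<open>The second difference of the absolute value is a triangle: by the product formula for cosines the
integrand is \<open>(g (z + e) + g (z - e))/2 - g z\<close> with \<open>g a = (1 - cos (a l)) |l|\<^sup>-\<^sup>2\<close>, and \<open>g a\<close> integrates
to a multiple of \<open>|a|\<close>. This proves Fourier inversion for the triangle directly.\<close>

lemma integral_cos_one_minus_cos:
  fixes e z :: real
  assumes "e > 0"
  shows "integrable lborel (\<lambda>l. cos (z * l) * ((1 - cos (e * l)) * \<bar>l\<bar> powr (-2)))" (is ?A)
    and "(LBINT l. cos (z * l) * ((1 - cos (e * l)) * \<bar>l\<bar> powr (-2))) = osc_const 1 * max 0 (e - \<bar>z\<bar>)" (is ?B)
proof -
  let ?g = "\<lambda>a l::real. (1 - cos (a * l)) * \<bar>l\<bar> powr (-1 - 1)"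
  have i: "integrable lborel (?g a)" for a
    using integrable_one_minus_cos_powr[of 1 a] by simp
  have v: "integral\<^sup>L lborel (?g a) = osc_const 1 * \<bar>a\<bar>" for a
    using integral_one_minus_cos_powr[of 1 a] by simp
  have eq: "cos (z * l) * ((1 - cos (e * l)) * \<bar>l\<bar> powr (-2)) = ?g (z + e) l / 2 + ?g (z - e) l / 2 - ?g z l" for l
  proof -
    have "cos (z * l) * cos (e * l) = (cos (z*l - e*l) + cos (z*l + e*l)) / 2"
      by (rule cos_times_cos)
    then have c: "cos (z * l) * (1 - cos (e * l)) = cos (z*l) - (cos (z*l - e*l) + cos (z*l + e*l)) / 2"
      by (simp add: algebra_simps)
    have "cos (z * l) * ((1 - cos (e * l)) * w) = (1 - cos ((z+e)*l)) * w / 2 + (1 - cos ((z-e)*l)) * w / 2 - (1 - cos (z*l)) * w" for w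
      unfolding mult.assoc[symmetric] c by (simp add: field_simps)
    then show ?thesis by simp
  qed
  show ?A unfolding eq using i by auto
  have "(LBINT l. cos (z * l) * ((1 - cos (e * l)) * \<bar>l\<bar> powr (-2)))
      = osc_const 1 * \<bar>z+e\<bar> / 2 + osc_const 1 * \<bar>z-e\<bar> / 2 - osc_const 1 * \<bar>z\<bar>"
    unfolding eq using i
    by (simp only: v Bochner_Integration.integral_diff Bochner_Integration.integral_add Bochner_Integration.integrable_add integrable_divide Bochner_Integration.integral_divide)
  also have "\<dots> = osc_const 1 * (\<bar>z+e\<bar> / 2 + \<bar>z-e\<bar> / 2 - \<bar>z\<bar>)" by (simp add: algebra_simps)
  also have "\<bar>z+e\<bar> / 2 + \<bar>z-e\<bar> / 2 - \<bar>z\<bar> = max 0 (e - \<bar>z\<bar>)"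
    using assms by (auto simp: max_def abs_if field_simps)
  finally show ?B .
qed

text \<open>Expanding \<open>0 \<le> \<integral> (B f - C g)\<^sup>2\<close> with \<open>C = \<integral> f g\<close> gives \<open>0 \<le> B (A B - C\<^sup>2)\<close>. Working with an upper
bound \<open>B > 0\<close> in place of \<open>\<integral> g\<^sup>2\<close> avoids the degenerate case.\<close>

lemma cauchy_schwarz_integral_bounds:
  fixes f g :: "'a \<Rightarrow> real"
  assumes "integrable M (\<lambda>x. (f x)\<^sup>2)" "integrable M (\<lambda>x. (g x)\<^sup>2)" "integrable M (\<lambda>x. f x * g x)"
    and "(\<integral>x. (f x)\<^sup>2 \<partial>M) \<le> A" "(\<integral>x. (g x)\<^sup>2 \<partial>M) \<le> B" "B > 0"
  shows "(\<integral>x. f x * g x \<partial>M)\<^sup>2 \<le> A * B"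
proof -
  define C where "C = (\<integral>x. f x * g x \<partial>M)"
  have "0 \<le> (\<integral>x. (B * f x - C * g x)\<^sup>2 \<partial>M)" by (intro Bochner_Integration.integral_nonneg) auto
  also have "\<dots> = (\<integral>x. B\<^sup>2 * (f x)\<^sup>2 - 2 * B * C * (f x * g x) + C\<^sup>2 * (g x)\<^sup>2 \<partial>M)"
    by (intro Bochner_Integration.integral_cong refl) (auto simp: power2_eq_square algebra_simps)
  also have "\<dots> = B\<^sup>2 * (\<integral>x. (f x)\<^sup>2 \<partial>M) - 2 * B * C * C + C\<^sup>2 * (\<integral>x. (g x)\<^sup>2 \<partial>M)"
    using assms(1-3) by (simp add: C_def)
  also have "\<dots> \<le> B\<^sup>2 * A - 2 * B * C * C + C\<^sup>2 * B"
    using assms by (intro add_mono diff_mono order_refl mult_left_mono) auto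
  also have "\<dots> = B * (A * B - C\<^sup>2)" by (simp add: power2_eq_square algebra_simps)
  finally show ?thesis using \<open>B > 0\<close> unfolding C_def[symmetric] by (simp add: zero_le_mult_iff)
qed

definition fbm_cov :: "real \<Rightarrow> real \<Rightarrow> real \<Rightarrow> real" where
  "fbm_cov H s t = (t powr (2*H) + s powr (2*H) - \<bar>t - s\<bar> powr (2*H)) / 2"

text \<open>The integrand equals \<open>(1 - cos tl) + (1 - cos sl) - (1 - cos (t-s)l)\<close> times the weight, and each of
the three terms is integrated by scaling.\<close>

lemma fbm_cov_spectral:
  assumes "0 < H" "H < 1" "0 \<le> s" "0 \<le> t"
  shows "integrable lborel (\<lambda>l. ((cos (s*l) - 1) * (cos (t*l) - 1) + sin (s*l) * sin (t*l)) * \<bar>l\<bar> powr (-1 - 2*H))" (is ?A)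
    and "(LBINT l. ((cos (s*l) - 1) * (cos (t*l) - 1) + sin (s*l) * sin (t*l)) * \<bar>l\<bar> powr (-1 - 2*H))
       = 2 * osc_const (2*H) * fbm_cov H s t" (is ?B)
proof -
  let ?g = "\<lambda>a l. (1 - cos (a * l)) * \<bar>l\<bar> powr (-1 - 2*H)"
  have i: "integrable lborel (?g a)" for a
    using integrable_one_minus_cos_powr[of "2*H" a] assms by simp
  have v: "integral\<^sup>L lborel (?g a) = osc_const (2*H) * \<bar>a\<bar> powr (2*H)" for a
    using integral_one_minus_cos_powr[of "2*H" a] assms by simp
  have eq: "((cos (s*l) - 1) * (cos (t*l) - 1) + sin (s*l) * sin (t*l)) * \<bar>l\<bar> powr (-1 - 2*H)
     = ?g t l + ?g s l - ?g (t - s) l" for l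
  proof -
    have "cos ((t-s)*l) = cos (t*l) * cos (s*l) + sin (t*l) * sin (s*l)"
      by (simp add: left_diff_distrib cos_diff)
    then show ?thesis by (simp add: algebra_simps)
  qed
  show ?A unfolding eq using i by auto
  have "(LBINT l. ?g t l + ?g s l - ?g (t - s) l) = osc_const (2*H) * \<bar>t\<bar> powr (2*H)
      + osc_const (2*H) * \<bar>s\<bar> powr (2*H) - osc_const (2*H) * \<bar>t - s\<bar> powr (2*H)"
    using i by (simp only: v Bochner_Integration.integral_diff Bochner_Integration.integral_add Bochner_Integration.integrable_add)
  then show ?B unfolding eq using assms by (simp add: fbm_cov_def algebra_simps)
qed

lemma fbm_quadratic_form_spectral:
  fixes r u :: "'i \<Rightarrow> real"
  assumes "0 < H" "H < 1" "finite J" "\<And>j. j \<in> J \<Longrightarrow> 0 \<le> r j"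
  defines "P \<equiv> \<lambda>l. \<Sum>j\<in>J. u j * (cos (r j * l) - 1)" and "R \<equiv> \<lambda>l. \<Sum>j\<in>J. u j * sin (r j * l)"
  shows "integrable lborel (\<lambda>l. ((P l)\<^sup>2 + (R l)\<^sup>2) * \<bar>l\<bar> powr (-1 - 2*H))" (is ?A)
    and "(LBINT l. ((P l)\<^sup>2 + (R l)\<^sup>2) * \<bar>l\<bar> powr (-1 - 2*H))
      = 2 * osc_const (2*H) * (\<Sum>i\<in>J. \<Sum>j\<in>J. u i * u j * fbm_cov H (r i) (r j))" (is ?B)
proof -
  let ?h = "\<lambda>i j l. ((cos (r i*l) - 1) * (cos (r j*l) - 1) + sin (r i*l) * sin (r j*l)) * \<bar>l\<bar> powr (-1 - 2*H)"
  have eq: "((P l)\<^sup>2 + (R l)\<^sup>2) * \<bar>l\<bar> powr (-1 - 2*H) = (\<Sum>i\<in>J. \<Sum>j\<in>J. u i * u j * ?h i j l)" for l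
    unfolding P_def R_def power2_eq_square sum_product
    by (simp add: sum_distrib_left sum_distrib_right sum.distrib[symmetric] algebra_simps)
  have i: "integrable lborel (?h i j)" if "i \<in> J" "j \<in> J" for i j
    using fbm_cov_spectral(1)[OF assms(1,2)] assms(4) that by auto
  show ?A unfolding eq using i by (intro Bochner_Integration.integrable_sum integrable_mult_right) auto
  have "(LBINT l. ((P l)\<^sup>2 + (R l)\<^sup>2) * \<bar>l\<bar> powr (-1 - 2*H)) = (\<Sum>i\<in>J. \<Sum>j\<in>J. u i * u j * integral\<^sup>L lborel (?h i j))"
    unfolding eq using i by (simp add: Bochner_Integration.integral_sum Bochner_Integration.integrable_sum)
  also have "\<dots> = (\<Sum>i\<in>J. \<Sum>j\<in>J. u i * u j * (2 * osc_const (2*H) * fbm_cov H (r i) (r j)))"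
    using fbm_cov_spectral(2)[OF assms(1,2)] assms(4) by (intro sum.cong refl) auto
  finally show ?B by (simp add: sum_distrib_left algebra_simps)
qed

text \<open>For \<open>q\<close> between \<open>p\<close> and \<open>p'\<close>, the weight \<open>|l|\<^sup>-\<^sup>1\<^sup>-\<^sup>q\<close> is dominated by the sum of the two extreme
weights, by the first for large and by the second for small \<open>|l|\<close>. This makes the constants uniform
in the Hurst parameter.\<close>

lemma osc_const_le:
  assumes "0 < p" "p \<le> q" "q \<le> p'" "p' < 2"
  shows "osc_const q \<le> osc_const p + osc_const p'"
proof -
  have i: "integrable lborel (\<lambda>l. (1 - cos l) * \<bar>l\<bar> powr (-1 - r))" if "0 < r" "r < 2" for r :: real
    using integrable_one_minus_cos_powr[OF that, of 1] by simp
  have le: "\<bar>l\<bar> powr (-1 - q) \<le> \<bar>l\<bar> powr (-1 - p) + \<bar>l\<bar> powr (-1 - p')" for l :: real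
  proof (cases "\<bar>l\<bar> \<ge> 1")
    case True
    then have "\<bar>l\<bar> powr (-1 - q) \<le> \<bar>l\<bar> powr (-1 - p)" using assms by (intro powr_mono) auto
    then show ?thesis by (smt (verit) powr_ge_zero)
  next
    case False
    then have "\<bar>l\<bar> powr (-1 - q) \<le> \<bar>l\<bar> powr (-1 - p')" using assms by (intro powr_mono') auto
    then show ?thesis by (smt (verit) powr_ge_zero)
  qed
  have "osc_const q \<le> (LBINT l. (1 - cos l) * \<bar>l\<bar> powr (-1 - p) + (1 - cos l) * \<bar>l\<bar> powr (-1 - p'))"
    unfolding osc_const_def using i[of p] i[of p'] i[of q] assms
    by (intro integral_mono Bochner_Integration.integrable_add) (auto simp flip: distrib_left intro!: mult_left_mono le)
  also have "\<dots> = osc_const p + osc_const p'" unfolding osc_const_def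
    using i[of p] i[of p'] assms by (intro Bochner_Integration.integral_add) auto
  finally show ?thesis .
qed

text \<open>The squared norm of the bump \<open>max 0 (1 - |z|)\<close> in the space dual to the spectral measure with
exponent \<open>-1 - p\<close>: its Fourier transform is a multiple of \<open>(1 - cos l) / l\<^sup>2\<close>, whose square is divided
by \<open>|l|\<^sup>-\<^sup>1\<^sup>-\<^sup>p\<close>. It is finite because \<open>p < 2\<close>.\<close>

definition bump_const :: "real \<Rightarrow> real" where
  "bump_const p = (LBINT l. (1 - cos l)\<^sup>2 * \<bar>l\<bar> powr (p - 3))"

lemma integrable_one_minus_cos_sq_powr:
  fixes p x :: real
  assumes "0 < p" "p < 2"
  shows "integrable lborel (\<lambda>l. (1 - cos (x * l))\<^sup>2 * \<bar>l\<bar> powr (p - 3))"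
proof (rule Bochner_Integration.integrable_bound[of lborel "\<lambda>l. 2 * ((1 - cos (x * l)) * \<bar>l\<bar> powr (-1 - (2 - p)))"])
  show "integrable lborel (\<lambda>l. 2 * ((1 - cos (x * l)) * \<bar>l\<bar> powr (-1 - (2 - p))))"
    using integrable_one_minus_cos_powr[of "2 - p" x] assms by simp
  show "AE l in lborel. norm ((1 - cos (x * l))\<^sup>2 * \<bar>l\<bar> powr (p - 3))
      \<le> norm (2 * ((1 - cos (x * l)) * \<bar>l\<bar> powr (-1 - (2 - p))))"
  proof (rule AE_I2)
    fix l :: real
    have "(1 - cos (x * l))\<^sup>2 \<le> 2 * (1 - cos (x * l))"
      unfolding power2_eq_square using cos_ge_minus_one[of "x*l"] cos_le_one[of "x*l"]
      by (intro mult_right_mono) linarith+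
    then show "norm ((1 - cos (x * l))\<^sup>2 * \<bar>l\<bar> powr (p - 3)) \<le> norm (2 * ((1 - cos (x * l)) * \<bar>l\<bar> powr (-1 - (2 - p))))"
      by (simp add: abs_mult mult.assoc[symmetric] mult_right_mono)
  qed
qed simp

lemma integral_one_minus_cos_sq_powr:
  assumes "0 < \<rho>"
  shows "(LBINT l. (1 - cos (\<rho> * l))\<^sup>2 * \<bar>l\<bar> powr (p - 3)) = bump_const p * \<rho> powr (2 - p)"
proof -
  have nz: "\<rho> \<noteq> 0" using assms by simp
  have "bump_const p = \<bar>\<rho>\<bar> * (LBINT l. (1 - cos (\<rho> * l))\<^sup>2 * \<bar>\<rho> * l\<bar> powr (p - 3))"
    unfolding bump_const_def by (subst lborel_integral_real_affine[OF nz, of _ 0]) simp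
  also have "\<dots> = \<bar>\<rho>\<bar> * (LBINT l. \<bar>\<rho>\<bar> powr (p - 3) * ((1 - cos (\<rho> * l))\<^sup>2 * \<bar>l\<bar> powr (p - 3)))"
    by (simp add: abs_mult powr_mult algebra_simps)
  also have "\<dots> = \<rho> * \<rho> powr (p - 3) * (LBINT l. (1 - cos (\<rho> * l))\<^sup>2 * \<bar>l\<bar> powr (p - 3))"
    using assms by simp
  also have "\<rho> * \<rho> powr (p - 3) = inverse (\<rho> powr (2-p))"
    using assms powr_add[of \<rho> 1 "p - 3"] powr_minus[of \<rho> "2-p"] by simp
  finally show ?thesis using assms by (simp add: field_simps)
qed

lemma bump_const_le:
  assumes "0 < p" "p < 2"
  shows "bump_const p \<le> 2 * osc_const (2 - p)"
proof -
  have "bump_const p \<le> (LBINT l. 2 * ((1 - cos l) * \<bar>l\<bar> powr (-1 - (2 - p))))"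
    unfolding bump_const_def
  proof (rule integral_mono)
    show "integrable lborel (\<lambda>l. (1 - cos l)\<^sup>2 * \<bar>l\<bar> powr (p - 3))"
      using integrable_one_minus_cos_sq_powr[OF assms, of 1] by simp
    show "integrable lborel (\<lambda>l. 2 * ((1 - cos l) * \<bar>l\<bar> powr (-1 - (2 - p))))"
      using integrable_one_minus_cos_powr[of "2 - p" 1] assms by simp
    fix l :: real
    have "(1 - cos l)\<^sup>2 \<le> 2 * (1 - cos l)"
      unfolding power2_eq_square using cos_ge_minus_one[of l] cos_le_one[of l]
      by (intro mult_right_mono) linarith+
    then show "(1 - cos l)\<^sup>2 * \<bar>l\<bar> powr (p - 3) \<le> 2 * ((1 - cos l) * \<bar>l\<bar> powr (-1 - (2 - p)))"
      by (simp add: mult.assoc[symmetric] mult_right_mono)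
  qed
  then show ?thesis by (simp add: osc_const_def)
qed

text \<open>Put \<open>\<tau> = r k\<close> and pair the spectral function \<open>\<Sum>\<^sub>j u\<^sub>j (exp (i r\<^sub>j l) - 1)\<close> with the transform of the
bump \<open>z \<mapsto> max 0 (\<rho> - |z - \<tau>|)\<close>. The pairing evaluates \<open>\<Sum>\<^sub>j u\<^sub>j (bump (r\<^sub>j) - bump 0)\<close>, and by the choice
of \<open>\<rho>\<close> only \<open>j = k\<close> survives: the bump vanishes at \<open>0\<close> and at every other \<open>r\<^sub>j\<close> with \<open>u\<^sub>j \<noteq> 0\<close>.
Cauchy-Schwarz then bounds \<open>u\<^sub>k\<^sup>2\<close> by the variance times the squared norm of the bump, which scales as a
power of \<open>\<rho>\<close>.\<close>

lemma fbm_local_nondeterminism_single: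
  fixes r u :: "'i \<Rightarrow> real"
  assumes H: "0 < H" "H < 1" and J: "finite J" "k \<in> J" and r: "\<And>j. j \<in> J \<Longrightarrow> 0 \<le> r j"
    and \<rho>: "0 < \<rho>" "\<rho> \<le> r k" "\<And>j. j \<in> J \<Longrightarrow> j \<noteq> k \<Longrightarrow> u j \<noteq> 0 \<Longrightarrow> \<rho> \<le> \<bar>r j - r k\<bar>"
    and Bd: "2 * osc_const (2*H) * osc_const (2 - 2*H) \<le> Bd" "0 < Bd"
  shows "(osc_const 1)\<^sup>2 * \<rho> powr (2*H) * (u k)\<^sup>2
     \<le> 2 * Bd * (\<Sum>i\<in>J. \<Sum>j\<in>J. u i * u j * fbm_cov H (r i) (r j))"
proof -
  define c where "c = osc_const 1"
  define \<tau> where "\<tau> = r k"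
  define P where "P = (\<lambda>l. \<Sum>j\<in>J. u j * (cos (r j * l) - 1))"
  define R where "R = (\<lambda>l. \<Sum>j\<in>J. u j * sin (r j * l))"
  define Q where "Q = (\<Sum>i\<in>J. \<Sum>j\<in>J. u i * u j * fbm_cov H (r i) (r j))"
  define w where "w = (\<lambda>l::real. \<bar>l\<bar> powr ((-1 - 2*H)/2))"
  define f where "f = (\<lambda>l. (P l * cos (\<tau> * l) + R l * sin (\<tau> * l)) * w l)"
  define g where "g = (\<lambda>l::real. (1 - cos (\<rho> * l)) * \<bar>l\<bar> powr ((2*H - 3)/2))"
  define D where "D = 2 * osc_const (2 - 2*H) * \<rho> powr (2 - 2*H)"
  have w2: "(w l)\<^sup>2 = \<bar>l\<bar> powr (-1 - 2*H)" for l
    unfolding w_def power2_eq_square by (simp flip: powr_add)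
  have [measurable]: "P \<in> borel_measurable borel" "R \<in> borel_measurable borel" "w \<in> borel_measurable borel"
    unfolding P_def R_def w_def by measurable
  then have [measurable]: "f \<in> borel_measurable borel" unfolding f_def by measurable
  have f2: "(f l)\<^sup>2 \<le> ((P l)\<^sup>2 + (R l)\<^sup>2) * \<bar>l\<bar> powr (-1 - 2*H)" for l
  proof -
    have "(P l)\<^sup>2 + (R l)\<^sup>2 - (P l * cos (\<tau> * l) + R l * sin (\<tau> * l))\<^sup>2 = (P l * sin (\<tau> * l) - R l * cos (\<tau> * l))\<^sup>2"
      using sin_cos_squared_add[of "\<tau> * l"] by algebra
    then have "(P l * cos (\<tau> * l) + R l * sin (\<tau> * l))\<^sup>2 \<le> (P l)\<^sup>2 + (R l)\<^sup>2"
      by (smt (verit) zero_le_power2)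
    then show ?thesis unfolding f_def power_mult_distrib w2 by (rule mult_right_mono) simp
  qed
  have intPR: "integrable lborel (\<lambda>l. ((P l)\<^sup>2 + (R l)\<^sup>2) * \<bar>l\<bar> powr (-1 - 2*H))"
    unfolding P_def R_def by (rule fbm_quadratic_form_spectral(1)[OF H J(1) r])
  have valPR: "(LBINT l. ((P l)\<^sup>2 + (R l)\<^sup>2) * \<bar>l\<bar> powr (-1 - 2*H)) = 2 * osc_const (2*H) * Q"
    unfolding P_def R_def Q_def by (rule fbm_quadratic_form_spectral(2)[OF H J(1) r])
  have if2: "integrable lborel (\<lambda>l. (f l)\<^sup>2)"
    by (rule Bochner_Integration.integrable_bound[OF intPR]) (auto intro!: order_trans[OF f2])
  have vf2: "(LBINT l. (f l)\<^sup>2) \<le> 2 * osc_const (2*H) * Q"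
    unfolding valPR[symmetric] by (rule integral_mono[OF if2 intPR f2])
  have g2: "(g l)\<^sup>2 = (1 - cos (\<rho> * l))\<^sup>2 * \<bar>l\<bar> powr (2*H - 3)" for l
    unfolding g_def power_mult_distrib by (simp add: power2_eq_square flip: powr_add)
  have ig2: "integrable lborel (\<lambda>l. (g l)\<^sup>2)"
    unfolding g2 using integrable_one_minus_cos_sq_powr[of "2*H" \<rho>] H by simp
  have vg2: "(LBINT l. (g l)\<^sup>2) \<le> D"
    unfolding g2 integral_one_minus_cos_sq_powr[OF \<rho>(1), of "2*H"] D_def
    using bump_const_le[of "2*H"] H by (intro mult_right_mono) auto
  have Dpos: "D > 0" unfolding D_def using osc_const_pos[of "2 - 2*H"] H \<rho> by auto
  let ?T = "\<lambda>z l. cos (z * l) * ((1 - cos (\<rho> * l)) * \<bar>l\<bar> powr (-2))"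
  have fg: "f l * g l = (\<Sum>j\<in>J. u j * (?T (r j - \<tau>) l - ?T \<tau> l))" for l
  proof -
    have ww: "w l * \<bar>l\<bar> powr ((2*H - 3)/2) = \<bar>l\<bar> powr (-2)"
      unfolding w_def by (simp add: field_simps flip: powr_add)
    have "P l * cos (\<tau> * l) + R l * sin (\<tau> * l) = (\<Sum>j\<in>J. u j * (cos ((r j - \<tau>) * l) - cos (\<tau> * l)))"
      unfolding P_def R_def sum_distrib_right sum.distrib[symmetric]
      by (intro sum.cong refl) (simp add: left_diff_distrib cos_diff algebra_simps)
    then have "f l * g l = (\<Sum>j\<in>J. u j * (cos ((r j - \<tau>) * l) - cos (\<tau> * l))) * ((1 - cos (\<rho> * l)) * (w l * \<bar>l\<bar> powr ((2*H - 3)/2)))"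
      unfolding f_def g_def by (simp add: mult_ac)
    then show ?thesis unfolding ww sum_distrib_right by (simp add: algebra_simps)
  qed
  have iT: "integrable lborel (?T z)" for z by (rule integral_cos_one_minus_cos(1)[OF \<rho>(1)])
  have vT: "integral\<^sup>L lborel (?T z) = c * max 0 (\<rho> - \<bar>z\<bar>)" for z
    unfolding c_def by (rule integral_cos_one_minus_cos(2)[OF \<rho>(1)])
  have ifg: "integrable lborel (\<lambda>l. f l * g l)"
    unfolding fg using iT by (intro Bochner_Integration.integrable_sum integrable_mult_right Bochner_Integration.integrable_diff) auto
  have "(LBINT l. f l * g l) = (\<Sum>j\<in>J. u j * (c * max 0 (\<rho> - \<bar>r j - \<tau>\<bar>) - c * max 0 (\<rho> - \<bar>\<tau>\<bar>)))"
    unfolding fg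
    by (subst Bochner_Integration.integral_sum) (auto simp: iT vT intro!: sum.cong integrable_mult_right Bochner_Integration.integrable_diff)
  also have "\<dots> = (\<Sum>j\<in>J. if j = k then u k * (c * \<rho>) else 0)"
  proof (intro sum.cong refl)
    fix j assume "j \<in> J"
    \<comment> \<open>the bump around \<open>\<tau>\<close> vanishes at \<open>0\<close>\<close>
    have "max 0 (\<rho> - \<bar>\<tau>\<bar>) = 0" using \<rho>(1,2) by (simp add: \<tau>_def)
    moreover have "u j = 0 \<or> max 0 (\<rho> - \<bar>r j - \<tau>\<bar>) = 0" if "j \<noteq> k"
      using \<rho>(3)[OF \<open>j \<in> J\<close> that] by (cases "u j = 0") (simp_all add: \<tau>_def max_absorb1)
    ultimately show "u j * (c * max 0 (\<rho> - \<bar>r j - \<tau>\<bar>) - c * max 0 (\<rho> - \<bar>\<tau>\<bar>)) = (if j = k then u k * (c * \<rho>) else 0)"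
      using \<rho>(1) by (cases "j = k") (auto simp: \<tau>_def)
  qed
  also have "\<dots> = u k * (c * \<rho>)" using J by simp
  finally have vfg: "(LBINT l. f l * g l) = u k * (c * \<rho>)" .
  have Q0: "0 \<le> osc_const (2*H) * Q"
  proof -
    have "0 \<le> (LBINT l. (f l)\<^sup>2)" by (intro Bochner_Integration.integral_nonneg) auto
    then show ?thesis using vf2 by linarith
  qed
  have Qpos: "0 \<le> Q" using Q0 osc_const_pos[of "2*H"] H by (simp add: zero_le_mult_iff)
  have "(u k * (c * \<rho>))\<^sup>2 \<le> 2 * osc_const (2*H) * Q * D"
    unfolding vfg[symmetric] by (rule cauchy_schwarz_integral_bounds[OF if2 ig2 ifg vf2 vg2 Dpos])
  also have "\<dots> = 2 * (2 * osc_const (2*H) * osc_const (2 - 2*H)) * Q * \<rho> powr (2 - 2*H)" by (simp add: D_def)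
  also have "\<dots> \<le> 2 * Bd * Q * \<rho> powr (2 - 2*H)"
    using Bd Qpos by (intro mult_right_mono) auto
  finally have "c\<^sup>2 * (u k)\<^sup>2 * \<rho>\<^sup>2 \<le> 2 * Bd * Q * \<rho> powr (2 - 2*H)" by (simp add: power_mult_distrib mult_ac)
  then have "c\<^sup>2 * (u k)\<^sup>2 * \<rho>\<^sup>2 * \<rho> powr (2*H - 2) \<le> 2 * Bd * Q * \<rho> powr (2 - 2*H) * \<rho> powr (2*H - 2)"
    by (rule mult_right_mono) simp
  moreover have e1: "\<rho>\<^sup>2 * \<rho> powr (2*H - 2) = \<rho> powr (2*H)"
    using \<rho>(1) powr_add[of \<rho> 2 "2*H - 2"] by (simp add: powr_numeral)
  moreover have e2: "\<rho> powr (2 - 2*H) * \<rho> powr (2*H - 2) = 1" using \<rho>(1) by (simp flip: powr_add)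
  ultimately have "c\<^sup>2 * (u k)\<^sup>2 * \<rho> powr (2*H) \<le> 2 * Bd * Q" by (simp only: mult.assoc e1 e2 mult_1_right)
  then show ?thesis unfolding Q_def[symmetric] c_def[symmetric] by (simp only: mult_ac)
qed

text \<open>All constants are bounded for \<open>H\<close> in a compact subinterval of \<open>(0,1)\<close>, and for \<open>\<rho> \<le> T1\<close> the power
\<open>\<rho>\<^sup>2\<^sup>H\<close> dominates a multiple of \<open>\<rho>\<^sup>2\<^sup>b\<close>. From here on the Hurst parameter enters the estimates
only through \<open>b\<close>.\<close>

lemma fbm_local_nondeterminism:
  assumes ab: "0 < a" "a \<le> b" "b < 1" and T1: "1 \<le> T1"
  obtains c0 where "c0 > 0"
    and "\<And>H (J :: 'i set) r u k \<rho>. a \<le> H \<Longrightarrow> H \<le> b \<Longrightarrow> finite J \<Longrightarrow> k \<in> J \<Longrightarrow> (\<And>j. j \<in> J \<Longrightarrow> 0 \<le> r j) \<Longrightarrow>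
        0 < \<rho> \<Longrightarrow> \<rho> \<le> T1 \<Longrightarrow> \<rho> \<le> r k \<Longrightarrow> (\<And>j. j \<in> J \<Longrightarrow> j \<noteq> k \<Longrightarrow> u j \<noteq> 0 \<Longrightarrow> \<rho> \<le> \<bar>r j - r k\<bar>) \<Longrightarrow>
        c0 * \<rho> powr (2*b) * (u k)\<^sup>2 \<le> (\<Sum>i\<in>J. \<Sum>j\<in>J. u i * u j * fbm_cov H (r i) (r j))"
proof
  define Bd where "Bd = 2 * (osc_const (2*a) + osc_const (2*b)) * (osc_const (2 - 2*b) + osc_const (2 - 2*a))"
  define c0 where "c0 = (osc_const 1)\<^sup>2 / (2 * Bd * T1\<^sup>2)"
  have pos: "0 < osc_const (2*a)" "0 < osc_const (2*b)" "0 < osc_const (2 - 2*b)" "0 < osc_const (2 - 2*a)" "0 < osc_const 1"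
    using ab by (auto intro!: osc_const_pos)
  have Bd: "0 < Bd" unfolding Bd_def using pos by simp
  show "c0 > 0" unfolding c0_def using pos Bd T1 by simp
  fix H :: real and J :: "'i set" and r u :: "'i \<Rightarrow> real" and k \<rho>
  assume H: "a \<le> H" "H \<le> b" and J: "finite J" "k \<in> J" and r: "\<And>j. j \<in> J \<Longrightarrow> 0 \<le> r j"
    and \<rho>: "0 < \<rho>" "\<rho> \<le> T1" "\<rho> \<le> r k" "\<And>j. j \<in> J \<Longrightarrow> j \<noteq> k \<Longrightarrow> u j \<noteq> 0 \<Longrightarrow> \<rho> \<le> \<bar>r j - r k\<bar>"
  let ?Q = "\<Sum>i\<in>J. \<Sum>j\<in>J. u i * u j * fbm_cov H (r i) (r j)"
  have "2 * osc_const (2*H) * osc_const (2 - 2*H) \<le> Bd"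
    unfolding Bd_def using H ab pos
    by (intro mult_mono mult_left_mono osc_const_le mult_nonneg_nonneg osc_const_nonneg) auto
  then have *: "(osc_const 1)\<^sup>2 * \<rho> powr (2*H) * (u k)\<^sup>2 \<le> 2 * Bd * ?Q"
    using H ab \<rho>(1,3) Bd r \<rho>(4) by (intro fbm_local_nondeterminism_single[OF _ _ J]) auto
  have "\<rho> powr (2*b) \<le> T1\<^sup>2 * \<rho> powr (2*H)"
  proof -
    have "\<rho> powr (2*b) = \<rho> powr (2*b - 2*H) * \<rho> powr (2*H)" by (simp flip: powr_add)
    also have "\<rho> powr (2*b - 2*H) \<le> T1 powr (2*b - 2*H)" using \<rho> H by (intro powr_mono2) auto
    also have "\<dots> \<le> T1 powr 2" using T1 H ab by (intro powr_mono) auto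
    finally show ?thesis using T1 by (simp add: powr_numeral mult_right_mono)
  qed
  then have "\<rho> powr (2*b) * ((osc_const 1)\<^sup>2 * (u k)\<^sup>2) \<le> T1\<^sup>2 * \<rho> powr (2*H) * ((osc_const 1)\<^sup>2 * (u k)\<^sup>2)"
    by (rule mult_right_mono) simp
  also have "\<dots> \<le> T1\<^sup>2 * (2 * Bd * ?Q)"
    using mult_left_mono[OF *, of "T1\<^sup>2"] by (simp add: mult_ac)
  finally show "c0 * \<rho> powr (2*b) * (u k)\<^sup>2 \<le> ?Q"
    unfolding c0_def using Bd T1 by (simp add: field_simps)
qed

section \<open>Gaussian integrals of quadratic forms\<close>

lemma nn_integral_gaussian_shift:
  fixes a l :: real
  assumes "a > 0"
  shows "(\<integral>\<^sup>+x. ennreal (exp (- (a * (x + l)\<^sup>2))) \<partial>lborel) = ennreal (sqrt (pi / a))"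
proof -
  define \<sigma> where "\<sigma> = sqrt (1 / (2 * a))"
  have \<sigma>: "\<sigma> > 0" "\<sigma>\<^sup>2 = 1 / (2 * a)" using assms by (auto simp: \<sigma>_def)
  have e: "exp (- (a * (x + l)\<^sup>2)) = sqrt (pi / a) * normal_density (-l) \<sigma> x" for x
    using assms by (simp add: normal_density_def \<sigma>)
  have "(\<integral>\<^sup>+x. ennreal (exp (- (a * (x + l)\<^sup>2))) \<partial>lborel)
      = (\<integral>\<^sup>+x. ennreal (sqrt (pi / a)) * ennreal (normal_density (-l) \<sigma> x) \<partial>lborel)"
    unfolding e using assms by (intro nn_integral_cong) (auto simp: ennreal_mult)
  also have "\<dots> = ennreal (sqrt (pi / a)) * (\<integral>\<^sup>+x. ennreal (normal_density (-l) \<sigma> x) \<partial>lborel)"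
    by (rule nn_integral_cmult) simp
  also have "(\<integral>\<^sup>+x. ennreal (normal_density (-l) \<sigma> x) \<partial>lborel) = 1"
    using \<sigma> by (subst nn_integral_eq_integral) (auto simp: integrable_normal_density integral_normal_density)
  finally show ?thesis by simp
qed

abbreviation lborel_power :: "nat set \<Rightarrow> (nat \<Rightarrow> real) measure" where
  "lborel_power I \<equiv> Pi\<^sub>M I (\<lambda>_. lborel)"

interpretation lborel_product: product_sigma_finite "\<lambda>_::nat. lborel :: real measure"
  by standard

text \<open>Integrate out the variable \<open>u\<^sub>k\<close> first. Completing the square leaves the Schur complement as quadratic
form in the remaining variables, and it inherits the lower bounds: its value is that of the old form
at the minimizing \<open>u\<^sub>k\<close>. Index intervals \<open>{k..<n}\<close> are used, rather than a reindexing, so that each step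
removes the least index.\<close>

lemma nn_integral_exp_quadratic_form_interval:
  fixes q :: "nat \<Rightarrow> nat \<Rightarrow> real" and b :: "nat \<Rightarrow> real"
  assumes "k \<le> n"
    and "\<And>i j. q i j = q j i"
    and "\<And>j. b j > 0"
    and "\<And>u j. k \<le> j \<Longrightarrow> j < n \<Longrightarrow> (\<And>i. j < i \<Longrightarrow> i < n \<Longrightarrow> u i = 0) \<Longrightarrow>
           b j * (u j)\<^sup>2 \<le> (\<Sum>i\<in>{k..<n}. \<Sum>j\<in>{k..<n}. q i j * u i * u j)"
  shows "(\<integral>\<^sup>+u. ennreal (exp (- (\<Sum>i\<in>{k..<n}. \<Sum>j\<in>{k..<n}. q i j * u i * u j))) \<partial>lborel_power {k..<n})
     \<le> ennreal (\<Prod>j\<in>{k..<n}. sqrt (pi / b j))"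
  using assms
proof (induction k arbitrary: q rule: inc_induct)
  case base
  then show ?case by (simp add: PiM_empty)
next
  case (step k)
  note sym = step.prems(1) and bpos = step.prems(2) and lower = step.prems(3)
  let ?J = "{Suc k..<n}"
  have ins: "{k..<n} = insert k ?J" using step.hyps by auto
  define Q where "Q = (\<lambda>u. \<Sum>i\<in>{k..<n}. \<Sum>j\<in>{k..<n}. q i j * u i * u j)"
  have Q_split: "Q u = q k k * (u k)\<^sup>2 + 2 * u k * (\<Sum>j\<in>?J. q k j * u j) + (\<Sum>i\<in>?J. \<Sum>j\<in>?J. q i j * u i * u j)" for u
  proof -
    have "(\<Sum>i\<in>?J. q i k * u i * u k) = u k * (\<Sum>j\<in>?J. q k j * u j)"
      unfolding sum_distrib_left using sym by (intro sum.cong) (auto simp: mult_ac)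
    moreover have "(\<Sum>j\<in>?J. q k j * u k * u j) = u k * (\<Sum>j\<in>?J. q k j * u j)"
      unfolding sum_distrib_left by (intro sum.cong) (auto simp: mult_ac)
    ultimately show ?thesis
      unfolding Q_def ins by (simp add: sum.distrib power2_eq_square)
  qed
  have a: "b k \<le> q k k"
  proof -
    have "b k * ((if k = k then 1 else 0) :: real)\<^sup>2 \<le> Q (\<lambda>i. if i = k then 1 else 0)"
      unfolding Q_def using step.hyps by (intro lower) auto
    also have "\<dots> = q k k"
    proof -
      have "(\<Sum>j\<in>?J. q k j * (if j = k then 1 else 0)) = 0" by (intro sum.neutral) auto
      moreover have "(\<Sum>i\<in>?J. \<Sum>j\<in>?J. q i j * (if i = k then 1 else 0) * (if j = k then 1 else 0)) = 0"
        by (intro sum.neutral ballI) auto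
      ultimately show ?thesis unfolding Q_split by simp
    qed
    finally show ?thesis by simp
  qed
  have apos: "q k k > 0" using a bpos[of k] by linarith
  define l where "l = (\<lambda>u. (\<Sum>j\<in>?J. q k j * u j) / q k k)"
  \<comment> \<open>the Schur complement of the entry \<open>q k k\<close>\<close>
  define q' where "q' = (\<lambda>i j. q i j - q k i * q k j / q k k)"
  define Q' where "Q' = (\<lambda>u. \<Sum>i\<in>?J. \<Sum>j\<in>?J. q' i j * u i * u j)"
  have Q_square: "Q u = q k k * (u k + l u)\<^sup>2 + Q' u" for u
  proof -
    have "(\<Sum>i\<in>?J. \<Sum>j\<in>?J. (q k i * q k j / q k k) * u i * u j) = (\<Sum>i\<in>?J. \<Sum>j\<in>?J. (q k i * u i) * (q k j * u j)) / q k k"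
      unfolding sum_divide_distrib by (intro sum.cong refl) (simp add: field_simps)
    also have "\<dots> = (\<Sum>j\<in>?J. q k j * u j)\<^sup>2 / q k k"
      unfolding power2_eq_square by (simp add: sum_product)
    also have "\<dots> = q k k * (l u)\<^sup>2" unfolding l_def using apos by (simp add: power_divide power2_eq_square)
    finally have "Q' u = (\<Sum>i\<in>?J. \<Sum>j\<in>?J. q i j * u i * u j) - q k k * (l u)\<^sup>2"
      unfolding Q'_def q'_def by (simp add: left_diff_distrib sum_subtractf)
    moreover have "(\<Sum>j\<in>?J. q k j * u j) = q k k * l u" using apos by (simp add: l_def)
    ultimately show ?thesis unfolding Q_split by (simp add: power2_eq_square algebra_simps)
  qed
  have l_upd: "l (u(k := x)) = l u" and Q'_upd: "Q' (u(k := x)) = Q' u" for u x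
    unfolding l_def Q'_def by (auto intro!: arg_cong[where f = "\<lambda>x. x / _"] sum.cong)
  have IH: "(\<integral>\<^sup>+u. ennreal (exp (- Q' u)) \<partial>lborel_power ?J) \<le> ennreal (\<Prod>j\<in>?J. sqrt (pi / b j))"
    unfolding Q'_def
  proof (rule step.IH)
    show "q' i j = q' j i" for i j unfolding q'_def using sym[of i j] by simp
    show "b j > 0" for j by (rule bpos)
    fix u :: "nat \<Rightarrow> real" and j assume j: "Suc k \<le> j" "j < n" and z: "\<And>i. j < i \<Longrightarrow> i < n \<Longrightarrow> u i = 0"
    have "b j * ((u(k := - l u)) j)\<^sup>2 \<le> Q (u(k := - l u))"
      unfolding Q_def using j z by (intro lower) auto
    also have "\<dots> = Q' u" unfolding Q_square by (simp add: l_upd Q'_upd)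
    finally show "b j * (u j)\<^sup>2 \<le> (\<Sum>i\<in>?J. \<Sum>j\<in>?J. q' i j * u i * u j)" using j unfolding Q'_def by simp
  qed
  have meas_l: "l \<in> borel_measurable (lborel_power ?J)" unfolding l_def by measurable
  have meas_Q': "Q' \<in> borel_measurable (lborel_power ?J)" unfolding Q'_def by measurable
  have meas_Q: "Q \<in> borel_measurable (lborel_power (insert k ?J))"
    unfolding Q_def ins by measurable
  have "(\<integral>\<^sup>+u. ennreal (exp (- Q u)) \<partial>lborel_power (insert k ?J))
      = (\<integral>\<^sup>+u. \<integral>\<^sup>+x. ennreal (exp (- Q (u(k := x)))) \<partial>lborel \<partial>lborel_power ?J)"
    using meas_Q by (intro lborel_product.product_nn_integral_insert) auto
  also have "\<dots> = (\<integral>\<^sup>+u. \<integral>\<^sup>+x. ennreal (exp (- Q' u)) * ennreal (exp (- (q k k * (x + l u)\<^sup>2))) \<partial>lborel \<partial>lborel_power ?J)"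
  proof -
    have "exp (- Q (u(k := x))) = exp (- Q' u) * exp (- (q k k * (x + l u)\<^sup>2))" for u x
      unfolding Q_square l_upd Q'_upd by (simp flip: exp_add)
    then show ?thesis by (simp add: ennreal_mult)
  qed
  also have "\<dots> = (\<integral>\<^sup>+u. ennreal (exp (- Q' u)) * ennreal (sqrt (pi / q k k)) \<partial>lborel_power ?J)"
    using apos by (simp add: nn_integral_cmult nn_integral_gaussian_shift)
  also have "\<dots> = (\<integral>\<^sup>+u. ennreal (exp (- Q' u)) \<partial>lborel_power ?J) * ennreal (sqrt (pi / q k k))"
    using meas_Q' by (intro nn_integral_multc) auto
  also have "\<dots> \<le> ennreal (\<Prod>j\<in>?J. sqrt (pi / b j)) * ennreal (sqrt (pi / b k))"
    using a apos bpos[of k] by (intro mult_mono IH ennreal_leI) (auto intro!: divide_left_mono)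
  also have "\<dots> = ennreal (\<Prod>j\<in>insert k ?J. sqrt (pi / b j))"
    using bpos by (subst ennreal_mult[symmetric]) (auto intro!: prod_nonneg simp: less_imp_le mult.commute)
  finally show ?case unfolding Q_def ins .
qed

lemma nn_integral_exp_quadratic_form:
  fixes q :: "nat \<Rightarrow> nat \<Rightarrow> real" and b :: "nat \<Rightarrow> real"
  assumes "\<And>i j. q i j = q j i"
    and "\<And>j. b j > 0"
    and "\<And>u j. j < n \<Longrightarrow> (\<And>i. j < i \<Longrightarrow> i < n \<Longrightarrow> u i = 0) \<Longrightarrow>
           b j * (u j)\<^sup>2 \<le> (\<Sum>i<n. \<Sum>j<n. q i j * u i * u j)"
  shows "(\<integral>\<^sup>+u. ennreal (exp (- (\<Sum>i<n. \<Sum>j<n. q i j * u i * u j))) \<partial>lborel_power {..<n})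
     \<le> ennreal (\<Prod>j<n. sqrt (pi / b j))"
  using nn_integral_exp_quadratic_form_interval[of 0 n q b] assms by (simp add: atLeast0LessThan)

text \<open>The exponent is \<open>n \<alpha> / 2\<close> with \<open>\<alpha> = 3 / n\<close>; a part of the Gaussian weight is spent to absorb the
power.\<close>

lemma three_halves_power_exp_bound:
  assumes "(x::real) \<ge> 0"
  shows "x powr (3/2) * exp (- x / 2) \<le> 64 * exp (- x / 4)"
proof -
  have "x powr (3/2) \<le> 1 + x\<^sup>2"
  proof (cases "x \<le> 1")
    case True
    then have "x powr (3/2) \<le> 1" using assms by (simp add: powr_le1)
    then show ?thesis by (smt (verit) zero_le_power2)
  next
    case False
    then have "x powr (3/2) \<le> x powr 2" by (intro powr_mono) auto
    then show ?thesis using False by (simp add: powr_numeral)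
  qed
  also have "\<dots> \<le> 64 * exp (x / 4)"
  proof -
    have "1 + x/4 + (x/4)\<^sup>2 / 2 \<le> exp (x/4)" using assms by (intro exp_lower_Taylor_quadratic) auto
    then have "64 * (1 + x/4 + (x/4)\<^sup>2 / 2) \<le> 64 * exp (x/4)" by (rule mult_left_mono) simp
    moreover have "1 + x\<^sup>2 \<le> 64 * (1 + x/4 + (x/4)\<^sup>2 / 2)" using assms by (simp add: power_divide)
    ultimately show ?thesis by (rule order_trans[rotated])
  qed
  finally have "x powr (3/2) * exp (- x / 2) \<le> 64 * exp (x / 4) * exp (- x / 2)"
    by (rule mult_right_mono) simp
  also have "\<dots> = 64 * exp (- x / 4)" by (simp flip: exp_add)
  finally show ?thesis .
qed

text \<open>Each \<open>|u\<^sub>j|\<close> is at most \<open>(Q / a\<^sub>j)\<^sup>1\<^sup>/\<^sup>2\<close>, so that the product of the \<open>|u\<^sub>j|\<close> to the power \<open>3/n\<close> is at most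
\<open>Q\<^sup>3\<^sup>/\<^sup>2\<close> times a constant, which the exponential absorbs. Two different families of lower bounds occur
because the bounds \<open>a\<^sub>j\<close>, valid for all \<open>u\<close>, are too small to control the Gaussian integral itself.\<close>

lemma nn_integral_weighted_gaussian:
  fixes q :: "nat \<Rightarrow> nat \<Rightarrow> real" and a b :: "nat \<Rightarrow> real"
  assumes n: "n > 0" and sym: "\<And>i j. q i j = q j i"
    and apos: "\<And>j. a j > 0" and bpos: "\<And>j. b j > 0"
    and lower: "\<And>u j. j < n \<Longrightarrow> a j * (u j)\<^sup>2 \<le> (\<Sum>i<n. \<Sum>j<n. q i j * u i * u j)"
    and lower_last: "\<And>u j. j < n \<Longrightarrow> (\<And>i. j < i \<Longrightarrow> i < n \<Longrightarrow> u i = 0) \<Longrightarrow>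
           b j * (u j)\<^sup>2 \<le> (\<Sum>i<n. \<Sum>j<n. q i j * u i * u j)"
  shows "(\<integral>\<^sup>+u. ennreal ((\<Prod>j<n. \<bar>u j\<bar> powr (3 / n)) * exp (- (\<Sum>i<n. \<Sum>j<n. q i j * u i * u j) / 2)) \<partial>lborel_power {..<n})
     \<le> ennreal (64 * (\<Prod>j<n. a j powr (- 3 / (2 * real n)) * sqrt (4 * pi / b j)))"
proof -
  define Q where "Q = (\<lambda>u. \<Sum>i<n. \<Sum>j<n. q i j * u i * u j)"
  have Qmeas: "Q \<in> borel_measurable (lborel_power {..<n})" unfolding Q_def by measurable
  have Qnn: "Q u \<ge> 0" for u
  proof -
    have "0 \<le> a 0 * (u 0)\<^sup>2" using apos[of 0] by simp
    also have "\<dots> \<le> Q u" unfolding Q_def using n by (rule lower)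
    finally show ?thesis .
  qed
  define A where "A = (\<Prod>j<n. a j powr (- 3 / (2 * real n)))"
  have Ann: "A \<ge> 0" unfolding A_def by (intro prod_nonneg) auto
  have pw: "(\<Prod>j<n. \<bar>u j\<bar> powr (3 / n)) * exp (- Q u / 2) \<le> 64 * A * exp (- (Q u / 4))" for u
  proof -
    have "(\<Prod>j<n. \<bar>u j\<bar> powr (3 / n)) \<le> (\<Prod>j<n. a j powr (- 3 / (2 * real n)) * Q u powr (3 / (2 * real n)))"
    proof (intro prod_mono conjI)
      fix j assume "j \<in> {..<n}"
      then have "a j * (u j)\<^sup>2 \<le> Q u" unfolding Q_def by (intro lower) auto
      then have "(u j)\<^sup>2 \<le> inverse (a j) * Q u" using apos[of j] by (simp add: field_simps)
      then have "((u j)\<^sup>2) powr (3 / (2*real n)) \<le> (inverse (a j) * Q u) powr (3 / (2*real n))"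
        by (intro powr_mono2) auto
      also have "\<dots> = a j powr (- 3 / (2 * real n)) * Q u powr (3 / (2 * real n))"
        using apos[of j] Qnn[of u] by (simp add: powr_mult powr_minus inverse_powr)
      also have "((u j)\<^sup>2) powr (3 / (2*real n)) = \<bar>u j\<bar> powr (3 / n)"
      proof (cases "u j = 0")
        case False
        then have "(u j)\<^sup>2 = \<bar>u j\<bar> powr 2" by (simp add: powr_numeral)
        then have "((u j)\<^sup>2) powr (3 / (2*real n)) = \<bar>u j\<bar> powr (2 * (3 / (2*real n)))" by (simp only: powr_powr)
        then show ?thesis by simp
      qed simp
      finally show "\<bar>u j\<bar> powr (3 / n) \<le> a j powr (- 3 / (2 * real n)) * Q u powr (3 / (2 * real n))" .
    qed auto
    also have "\<dots> = A * (Q u powr (3 / (2 * real n)))^n" unfolding A_def by (simp add: prod.distrib)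
    also have "(Q u powr (3 / (2 * real n)))^n = Q u powr (3/2)"
    proof (cases "Q u = 0")
      case False
      then have "(Q u powr (3 / (2 * real n)))^n = (Q u powr (3 / (2 * real n))) powr n" using Qnn[of u] by (simp add: powr_realpow)
      also have "\<dots> = Q u powr (3/2)" using n by (simp add: powr_powr)
      finally show ?thesis .
    qed (use n in simp)
    finally have "(\<Prod>j<n. \<bar>u j\<bar> powr (3 / n)) * exp (- Q u / 2) \<le> A * Q u powr (3/2) * exp (- Q u / 2)"
      by (rule mult_right_mono) simp
    also have "\<dots> \<le> A * (64 * exp (- Q u / 4))"
      using three_halves_power_exp_bound[OF Qnn[of u]] Ann by (simp add: mult.assoc mult_left_mono)
    finally show ?thesis by simp
  qed
  have "(\<integral>\<^sup>+u. ennreal ((\<Prod>j<n. \<bar>u j\<bar> powr (3 / n)) * exp (- Q u / 2)) \<partial>lborel_power {..<n})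
     \<le> (\<integral>\<^sup>+u. ennreal (64 * A) * ennreal (exp (- (Q u / 4))) \<partial>lborel_power {..<n})"
    using pw Ann by (intro nn_integral_mono) (simp add: ennreal_mult[symmetric] ennreal_leI)
  also have "\<dots> = ennreal (64 * A) * (\<integral>\<^sup>+u. ennreal (exp (- (Q u / 4))) \<partial>lborel_power {..<n})"
    using Qmeas by (intro nn_integral_cmult) auto
  also have "(\<integral>\<^sup>+u. ennreal (exp (- (Q u / 4))) \<partial>lborel_power {..<n}) \<le> ennreal (\<Prod>j<n. sqrt (pi / (b j / 4)))"
  proof -
    have e: "Q u / 4 = (\<Sum>i<n. \<Sum>j<n. (q i j / 4) * u i * u j)" for u
      unfolding Q_def sum_divide_distrib by simp
    show ?thesis unfolding e
    proof (rule nn_integral_exp_quadratic_form)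
      fix u :: "nat \<Rightarrow> real" and j assume "j < n" "\<And>i. j < i \<Longrightarrow> i < n \<Longrightarrow> u i = 0"
      then have "b j * (u j)\<^sup>2 \<le> Q u" unfolding Q_def by (rule lower_last)
      then show "b j / 4 * (u j)\<^sup>2 \<le> (\<Sum>i<n. \<Sum>j<n. q i j / 4 * u i * u j)" unfolding e[symmetric] by simp
    qed (use sym bpos in auto)
  qed
  also have "ennreal (64 * A) * ennreal (\<Prod>j<n. sqrt (pi / (b j / 4))) = ennreal (64 * A * (\<Prod>j<n. sqrt (pi / (b j / 4))))"
    using Ann by (intro ennreal_mult[symmetric]) (auto intro!: prod_nonneg simp: less_imp_le[OF bpos])
  also have "64 * A * (\<Prod>j<n. sqrt (pi / (b j / 4))) = 64 * (\<Prod>j<n. a j powr (- 3 / (2 * real n)) * sqrt (4 * pi / b j))"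
    by (simp add: A_def prod.distrib mult.commute)
  finally show ?thesis unfolding Q_def by (simp add: mult_left_mono)
qed

section \<open>The triangular kernel and its Fourier transform\<close>

text \<open>The triangular probability density with support \<open>[-e, e]\<close>. Compact support makes the error of
mollification a modulus of continuity, while the Fourier transform is nonnegative and integrable.\<close>

definition tri :: "real \<Rightarrow> real \<Rightarrow> real" where
  "tri e z = max 0 (e - \<bar>z\<bar>) / e\<^sup>2"

text \<open>The Fourier transform of \<open>tri e\<close>, normalized so that no constant appears in the inversion formula.
At \<open>l = 0\<close> the value is \<open>0\<close> by the convention for powers of \<open>0\<close>, which affects only a null set.\<close>

definition tri_hat :: "real \<Rightarrow> real \<Rightarrow> real" where
  "tri_hat e l = (1 - cos (e * l)) * \<bar>l\<bar> powr (-2) / (osc_const 1 * e\<^sup>2)"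

lemma tri_measurable [measurable]: "tri e \<in> borel_measurable borel"
  unfolding tri_def by measurable

lemma tri_hat_measurable [measurable]: "tri_hat e \<in> borel_measurable borel"
  unfolding tri_hat_def by measurable

lemma tri_nonneg: "0 \<le> tri e z" by (simp add: tri_def)

lemma tri_eq_0: "e \<le> \<bar>z\<bar> \<Longrightarrow> tri e z = 0" by (simp add: tri_def)

lemma tri_le: "e > 0 \<Longrightarrow> tri e z \<le> 1 / e"
  by (simp add: tri_def power2_eq_square field_simps)

lemma tri_lipschitz: "\<bar>tri e x - tri e y\<bar> \<le> \<bar>x - y\<bar> / e\<^sup>2"
proof -
  have "\<bar>max 0 (e - \<bar>x\<bar>) - max 0 (e - \<bar>y\<bar>)\<bar> \<le> \<bar>x - y\<bar>" by (auto simp: max_def)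
  then show ?thesis
    unfolding tri_def diff_divide_distrib[symmetric] abs_divide by (simp add: divide_right_mono)
qed

lemma tri_continuous [continuous_intros]: "continuous_on S f \<Longrightarrow> continuous_on S (\<lambda>x. tri e (f x))"
  unfolding tri_def by (auto intro!: continuous_intros simp: divide_inverse)

lemma osc_const_1_pos: "osc_const 1 > 0" by (rule osc_const_pos) auto

lemma tri_hat_nonneg: "0 \<le> tri_hat e l"
  unfolding tri_hat_def using osc_const_1_pos by (intro divide_nonneg_nonneg mult_nonneg_nonneg) auto

lemma tri_hat_minus: "tri_hat e (- l) = tri_hat e l"
  by (simp add: tri_hat_def)

lemma tri_hat_le: assumes "e > 0" shows "tri_hat e l \<le> 1 / osc_const 1"
proof (cases "l = 0")
  case False
  have "(1 - cos (e * l)) * \<bar>l\<bar> powr (-2) = (1 - cos (e * l)) / l\<^sup>2"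
    using False by (simp add: powr_minus powr_numeral divide_inverse)
  also have "\<dots> \<le> (e * l)\<^sup>2 / 2 / l\<^sup>2" by (intro divide_right_mono one_minus_cos_le) auto
  also have "\<dots> \<le> e\<^sup>2" using False by (simp add: power_mult_distrib)
  finally have "tri_hat e l \<le> e\<^sup>2 / (osc_const 1 * e\<^sup>2)"
    unfolding tri_hat_def using osc_const_1_pos by (intro divide_right_mono) auto
  then show ?thesis using assms by simp
qed (use osc_const_1_pos in \<open>simp add: tri_hat_def\<close>)

lemma integrable_tri_hat: "e > 0 \<Longrightarrow> integrable lborel (tri_hat e)"
  unfolding tri_hat_def using integrable_one_minus_cos_powr[of 1 e] by simp

lemma cis_measurable [measurable]: "cis \<in> borel_measurable borel"
  by (intro borel_measurable_continuous_onI continuous_intros)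

lemma tri_fourier:
  assumes "e > 0"
  shows "complex_of_real (tri e z) = (CLBINT l. complex_of_real (tri_hat e l) * cis (l * z))"
proof -
  have ic: "integrable lborel (\<lambda>l. complex_of_real (tri_hat e l) * cis (l * z))"
  proof (rule Bochner_Integration.integrable_bound[OF integrable_tri_hat[OF assms]])
    show "(\<lambda>l. complex_of_real (tri_hat e l) * cis (l * z)) \<in> borel_measurable lborel" by measurable
  qed (simp add: norm_mult)
  have "Re (CLBINT l. complex_of_real (tri_hat e l) * cis (l * z)) = (LBINT l. tri_hat e l * cos (l * z))"
    by (subst integral_Re[OF ic, symmetric]) simp
  also have "\<dots> = (LBINT l. cos (z * l) * ((1 - cos (e * l)) * \<bar>l\<bar> powr (-2)) / (osc_const 1 * e\<^sup>2))"
    by (simp add: tri_hat_def mult_ac)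
  also have "\<dots> = tri e z"
    using osc_const_1_pos by (simp only: integral_divide_zero integral_cos_one_minus_cos(2)[OF assms]) (simp add: tri_def)
  finally have re: "Re (CLBINT l. complex_of_real (tri_hat e l) * cis (l * z)) = tri e z" .
  have "Im (CLBINT l. complex_of_real (tri_hat e l) * cis (l * z)) = (LBINT l. tri_hat e l * sin (l * z))"
    by (subst integral_Im[OF ic, symmetric]) simp
  moreover have "(LBINT l. tri_hat e l * sin (l * z)) = - (LBINT l. tri_hat e l * sin (l * z))"
    by (subst lborel_integral_real_affine[where c = "-1" and t = 0]) (simp_all add: tri_hat_minus)
  ultimately have im: "Im (CLBINT l. complex_of_real (tri_hat e l) * cis (l * z)) = 0" by simp
  show ?thesis using re im by (simp add: complex_eq_iff)
qed

text \<open>A product of one-dimensional integrals is an integral over the product space. After exchanging it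
with the expectation, only the joint characteristic function \<open>\<phi>\<close> of the variables remains.\<close>

lemma gaussian_fourier_product:
  fixes X :: "nat \<Rightarrow> 'w \<Rightarrow> real" and g :: "nat \<Rightarrow> real \<Rightarrow> complex"
  assumes "prob_space M" and X: "\<And>j. j < n \<Longrightarrow> X j \<in> borel_measurable M"
    and g: "\<And>j. j < n \<Longrightarrow> integrable lborel (g j)"
    and ch: "\<And>u. (\<integral>\<omega>. cis (\<Sum>j<n. u j * X j \<omega>) \<partial>M) = complex_of_real (\<phi> u)"
  shows "(\<integral>\<omega>. (\<Prod>j<n. CLBINT l. g j l * cis (l * X j \<omega>)) \<partial>M)
     = (\<integral>u. (\<Prod>j<n. g j (u j)) * complex_of_real (\<phi> u) \<partial>lborel_power {..<n})"
proof -
  interpret M: prob_space M by fact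
  interpret P: sigma_finite_measure "lborel_power {..<n}" by (rule lborel_product.sigma_finite) simp
  interpret MP: pair_sigma_finite M "lborel_power {..<n}" ..
  have [measurable]: "j < n \<Longrightarrow> g j \<in> borel_measurable borel" for j using g[of j] by auto
  have ig: "integrable lborel (\<lambda>l. g j l * cis (l * x))" if "j < n" for j x
    using that by (intro Bochner_Integration.integrable_bound[OF g[OF that]]) (auto simp: norm_mult)
  define f where "f = (\<lambda>\<omega> u. (\<Prod>j<n. g j (u j) * cis (u j * X j \<omega>)))"
  note X[measurable]
  have nf: "norm (f \<omega> u) = (\<Prod>j<n. norm (g j (u j)))" for \<omega> u
    unfolding f_def by (simp add: prod_norm[symmetric] norm_mult)
  have fint: "integrable (lborel_power {..<n}) (f \<omega>)" for \<omega>
    unfolding f_def using ig by (intro lborel_product.product_integrable_prod) auto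
  have fi: "integrable (M \<Otimes>\<^sub>M lborel_power {..<n}) (case_prod f)"
  proof (rule MP.Fubini_integrable)
    show "case_prod f \<in> borel_measurable (M \<Otimes>\<^sub>M lborel_power {..<n})"
      unfolding f_def case_prod_beta by measurable
    show "integrable M (\<lambda>\<omega>. \<integral>u. norm (case_prod f (\<omega>, u)) \<partial>lborel_power {..<n})"
      by (simp add: nf)
    show "AE \<omega> in M. integrable (lborel_power {..<n}) (\<lambda>u. case_prod f (\<omega>, u))"
      using fint by simp
  qed
  have "(\<integral>\<omega>. (\<Prod>j<n. CLBINT l. g j l * cis (l * X j \<omega>)) \<partial>M) = (\<integral>\<omega>. (\<integral>u. f \<omega> u \<partial>lborel_power {..<n}) \<partial>M)"
    unfolding f_def using ig by (intro Bochner_Integration.integral_cong refl lborel_product.product_integral_prod[symmetric]) auto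
  also have "\<dots> = (\<integral>u. (\<integral>\<omega>. f \<omega> u \<partial>M) \<partial>lborel_power {..<n})"
    by (rule MP.Fubini_integral[OF fi, symmetric])
  also have "\<dots> = (\<integral>u. (\<Prod>j<n. g j (u j)) * complex_of_real (\<phi> u) \<partial>lborel_power {..<n})"
  proof (intro Bochner_Integration.integral_cong refl)
    fix u :: "nat \<Rightarrow> real"
    have "f \<omega> u = (\<Prod>j<n. g j (u j)) * cis (\<Sum>j<n. u j * X j \<omega>)" for \<omega>
      unfolding f_def prod.distrib cis_conv_exp by (simp add: exp_sum sum_distrib_left)
    then show "(\<integral>\<omega>. f \<omega> u \<partial>M) = (\<Prod>j<n. g j (u j)) * complex_of_real (\<phi> u)"
      by (simp add: ch)
  qed
  finally show ?thesis .
qed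

section \<open>Integrals over ordered times\<close>

text \<open>The time before the \<open>j\<close>-th one, where the starting point \<open>s\<close> plays the role of a time of index \<open>-1\<close>.
The gaps are then \<open>r j - prev s r j\<close> for all \<open>j\<close>, including \<open>0\<close>.\<close>

definition prev :: "real \<Rightarrow> (nat \<Rightarrow> real) \<Rightarrow> nat \<Rightarrow> real" where
  "prev s r j = (case j of 0 \<Rightarrow> s | Suc i \<Rightarrow> r i)"

text \<open>The indicator of \<open>s < r\<^sub>0 < \<dots> < r\<^sub>n\<^sub>-\<^sub>1 \<le> t\<close> (of everything if \<open>n = 0\<close>). Strict inequalities keep all
gaps positive.\<close>

definition ordered_ind :: "real \<Rightarrow> real \<Rightarrow> nat \<Rightarrow> (nat \<Rightarrow> real) \<Rightarrow> real" where
  "ordered_ind s t n r = (\<Prod>j<n. if prev s r j < r j \<and> r j \<le> t then 1 else 0)"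

lemma prev_upd: "j \<le> n \<Longrightarrow> prev s (r(n := x)) j = prev s r j"
  by (auto simp: prev_def split: nat.splits)

lemma prev_measurable [measurable]:
  assumes "j \<le> n" shows "(\<lambda>r. prev s r j) \<in> borel_measurable (lborel_power {..<n})"
  using assms by (cases j) (auto simp: prev_def)

lemma ordered_ind_measurable [measurable]: "ordered_ind s t n \<in> borel_measurable (lborel_power {..<n})"
  unfolding ordered_ind_def[abs_def]
proof (intro borel_measurable_prod)
  fix j assume "j \<in> {..<n}"
  then have [measurable]: "(\<lambda>r. prev s r j) \<in> borel_measurable (lborel_power {..<n})"
    "(\<lambda>r. r j) \<in> borel_measurable (lborel_power {..<n})" by auto
  show "(\<lambda>r. if prev s r j < r j \<and> r j \<le> t then 1 else 0 :: real) \<in> borel_measurable (lborel_power {..<n})"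
    by measurable
qed

lemma ordered_ind_01: "ordered_ind s t n r = 0 \<or> ordered_ind s t n r = 1"
  by (induction n) (auto simp: ordered_ind_def)

lemma ordered_ind_nonneg: "0 \<le> ordered_ind s t n r"
  using ordered_ind_01[of s t n r] by auto

lemma ordered_ind_Suc_upd:
  "ordered_ind s t (Suc n) (r(n := x)) = ordered_ind s t n r * (if prev s r n < x \<and> x \<le> t then 1 else 0)"
proof -
  have "(\<Prod>j<n. if prev s (r(n := x)) j < (r(n := x)) j \<and> (r(n := x)) j \<le> t then 1 else 0 :: real)
     = (\<Prod>j<n. if prev s r j < r j \<and> r j \<le> t then 1 else 0)"
    by (intro prod.cong refl) (auto simp: prev_upd)
  then show ?thesis by (simp add: ordered_ind_def prev_upd)
qed

lemma ordered_ind_nonzero: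
  assumes "ordered_ind s t n r \<noteq> 0" "s \<le> t"
  shows "j < n \<Longrightarrow> prev s r j < r j" "j < n \<Longrightarrow> r j \<le> t"
    "j \<le> n \<Longrightarrow> s \<le> prev s r j" "j \<le> n \<Longrightarrow> prev s r j \<le> t" "i < j \<Longrightarrow> j < n \<Longrightarrow> r i < r j"
proof -
  have *: "prev s r j < r j \<and> r j \<le> t" if "j < n" for j
    using assms(1) that unfolding ordered_ind_def by (auto split: if_splits)
  then show "j < n \<Longrightarrow> prev s r j < r j" "j < n \<Longrightarrow> r j \<le> t" by auto
  show "j \<le> n \<Longrightarrow> s \<le> prev s r j"
  proof (induction j)
    case (Suc j)
    then have "s \<le> prev s r j" by simp
    also have "\<dots> < r j" using *[of j] Suc by simp
    finally show ?case by (simp add: prev_def)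
  qed (simp add: prev_def)
  show "j \<le> n \<Longrightarrow> prev s r j \<le> t" using *[of "j - 1"] assms(2) by (cases j) (auto simp: prev_def)
  have Sucs: "r i < r (Suc i)" if "Suc i < n" for i using *[OF that] by (simp add: prev_def)
  show "i < j \<Longrightarrow> j < n \<Longrightarrow> r i < r j"
  proof (induction j)
    case (Suc j)
    show ?case
    proof (cases "i = j")
      case False
      then have "r i < r j" using Suc by simp
      also have "r j < r (Suc j)" using Suc by (intro Sucs) simp
      finally show ?thesis .
    qed (use Suc Sucs in auto)
  qed simp
qed

text \<open>The power \<open>n\<close> of an integral is \<open>n!\<close> times the integral over ordered times. For the induction the
largest time is integrated first, and the integral that it produces, a power of the integral of \<open>h\<close>
over \<open>[r\<^sub>n\<^sub>-\<^sub>1, t]\<close>, has to be carried along as an additional factor with arbitrary \<open>m\<close>.\<close>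

lemma integral_ordered_product_tail:
  fixes h :: "real \<Rightarrow> real"
  assumes st: "s \<le> t" and h: "continuous_on UNIV h"
  defines "K \<equiv> \<lambda>x. integral {s..x} h"
  shows "(\<integral>r. ordered_ind s t n r * (\<Prod>j<n. h (r j)) * ((K t - K (prev s r n)) ^ m / fact m) \<partial>lborel_power {..<n})
     = K t ^ (n + m) / fact (n + m)"
proof (induction n arbitrary: m)
  case 0
  then show ?case by (simp add: PiM_empty ordered_ind_def prev_def K_def)
next
  case (Suc n)
  define J where "J = (\<lambda>x. K t - K x)"
  have hm[measurable]: "h \<in> borel_measurable borel" using h by (rule borel_measurable_continuous_onI)
  have Kd: "(K has_vector_derivative h x) (at x within {s..t})" if "x \<in> {s..t}" for x
    unfolding K_def by (rule integral_has_vector_derivative[OF _ that]) (rule continuous_on_subset[OF h], simp)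
  have Kc: "continuous_on {s..t} K"
    using Kd has_vector_derivative_continuous by (force simp: continuous_on_eq_continuous_within)
  have Jc: "continuous_on {s..t} J" unfolding J_def by (intro continuous_intros Kc)
  have hc: "continuous_on {s..t} h" using h continuous_on_subset by blast
  have Jd: "((\<lambda>x. - (J x ^ Suc m / fact (Suc m))) has_vector_derivative h x * (J x ^ m / fact m)) (at x within {s..t})"
    if "x \<in> {s..t}" for x
  proof -
    have K': "(K has_real_derivative h x) (at x within {s..t})"
      using Kd[OF that] by (simp add: has_real_derivative_iff_has_vector_derivative)
    have "((\<lambda>x. (K t - K x) ^ Suc m) has_real_derivative real (Suc m) * ((K t - K x) ^ m * (- h x))) (at x within {s..t})"
      by (rule derivative_eq_intros K' refl)+ simp
    then have "((\<lambda>x. (- 1 / fact (Suc m)) * (K t - K x) ^ Suc m) has_real_derivative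
        (- 1 / fact (Suc m)) * (real (Suc m) * ((K t - K x) ^ m * (- h x)))) (at x within {s..t})"
      by (rule DERIV_cmult)
    moreover have "(\<lambda>x. (- 1 / fact (Suc m)) * (K t - K x) ^ Suc m) = (\<lambda>x. - (J x ^ Suc m / fact (Suc m)))"
      by (simp add: J_def fun_eq_iff del: fact_Suc)
    moreover have "(- 1 / fact (Suc m)) * (real (Suc m) * ((K t - K x) ^ m * (- h x))) = h x * (J x ^ m / fact m)"
    proof -
      have *: "- 1 / (c * d) * (c * (y * - z)) = z * (y / d)" if "c \<noteq> 0" "d \<noteq> 0" for c d y z :: real
        using that by (simp add: field_simps)
      show ?thesis unfolding J_def fact_Suc by (rule *) simp_all
    qed
    ultimately show ?thesis
      by (simp only: has_real_derivative_iff_has_vector_derivative)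
  qed
  have inner: "(LBINT x. (if p < x \<and> x \<le> t then 1 else 0) * (h x * (J x ^ m / fact m))) = J p ^ Suc m / fact (Suc m)"
    if p: "s \<le> p" "p \<le> t" for p
  proof -
    have "(LBINT x. (if p < x \<and> x \<le> t then 1 else 0) * (h x * (J x ^ m / fact m)))
       = (LBINT x. indicator {p..t} x *\<^sub>R (h x * (J x ^ m / fact m)))"
    proof (rule integral_cong_AE)
      have sub: "continuous_on {p..t} (\<lambda>x. h x * (J x ^ m / fact m))" "continuous_on {p<..t} (\<lambda>x. h x * (J x ^ m / fact m))"
        using p by (auto intro!: continuous_intros continuous_on_subset[OF Jc] continuous_on_subset[OF hc])
      show "(\<lambda>x. indicator {p..t} x *\<^sub>R (h x * (J x ^ m / fact m))) \<in> borel_measurable lborel"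
        using borel_measurable_continuous_on_indicator[OF _ sub(1)] by simp
      have "(\<lambda>x. indicator {p<..t} x *\<^sub>R (h x * (J x ^ m / fact m))) \<in> borel_measurable lborel"
        using borel_measurable_continuous_on_indicator[OF _ sub(2)] by simp
      also have "(\<lambda>x. indicator {p<..t} x *\<^sub>R (h x * (J x ^ m / fact m))) = (\<lambda>x. (if p < x \<and> x \<le> t then 1 else 0) * (h x * (J x ^ m / fact m)))"
        by (auto simp: fun_eq_iff indicator_def)
      finally show "(\<lambda>x. (if p < x \<and> x \<le> t then 1 else 0) * (h x * (J x ^ m / fact m))) \<in> borel_measurable lborel" .
      show "AE x in lborel. (if p < x \<and> x \<le> t then 1 else 0) * (h x * (J x ^ m / fact m)) = indicat_real {p..t} x *\<^sub>R (h x * (J x ^ m / fact m))"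
        using AE_lborel_singleton[of p] by eventually_elim (auto simp: indicator_def)
    qed
    also have "\<dots> = - (J t ^ Suc m / fact (Suc m)) - - (J p ^ Suc m / fact (Suc m))"
    proof (rule integral_FTC_atLeastAtMost[OF p(2)])
      fix x assume "p \<le> x" "x \<le> t"
      then show "((\<lambda>x. - (J x ^ Suc m / fact (Suc m))) has_vector_derivative h x * (J x ^ m / fact m)) (at x within {p..t})"
        using p by (intro has_vector_derivative_within_subset[OF Jd]) auto
    qed (use p in \<open>auto intro!: continuous_intros continuous_on_subset[OF Jc] continuous_on_subset[OF hc]\<close>)
    also have "J t = 0" by (simp add: J_def)
    finally show ?thesis by simp
  qed
  obtain Ch where Ch: "\<And>x. x \<in> {s..t} \<Longrightarrow> \<bar>h x\<bar> \<le> Ch"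
    using compact_imp_bounded[OF compact_continuous_image[OF hc compact_Icc]]
    unfolding bounded_iff ball_simps real_norm_def by blast
  obtain Cj where Cj: "\<And>x. x \<in> {s..t} \<Longrightarrow> \<bar>J x\<bar> \<le> Cj"
    using compact_imp_bounded[OF compact_continuous_image[OF Jc compact_Icc]]
    unfolding bounded_iff ball_simps real_norm_def by blast
  have Ch0: "Ch \<ge> 0" using Ch[of s] st by auto
  have Cj0: "Cj \<ge> 0" using Cj[of s] st by auto
  define f where "f = (\<lambda>r. ordered_ind s t (Suc n) r * (\<Prod>j<Suc n. h (r j)) * (J (prev s r (Suc n)) ^ m / fact m))"
  have fint: "integrable (lborel_power {..<Suc n}) f"
  proof (rule Bochner_Integration.integrable_bound)
    show "integrable (lborel_power {..<Suc n}) (\<lambda>r. (\<Prod>j<Suc n. indicator {s..t} (r j) * Ch) * (Cj ^ m / fact m))"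
    proof -
      have "integrable lborel (indicat_real {s..t})"
        by (rule integrable_real_indicator) (auto simp: emeasure_lborel_Icc_eq)
      then show ?thesis by (intro integrable_mult_left lborel_product.product_integrable_prod) auto
    qed
    \<comment> \<open>\<open>J\<close> is known to be regular only on \<open>[s, t]\<close>, which contains every ordered tuple of times\<close>
    define J' where "J' = (\<lambda>x. indicator {s..t} x * J x)"
    have J'm[measurable]: "J' \<in> borel_measurable borel"
      unfolding J'_def using borel_measurable_continuous_on_indicator[OF _ Jc] by simp
    have feq: "f = (\<lambda>r. ordered_ind s t (Suc n) r * (\<Prod>j<Suc n. h (r j)) * (J' (prev s r (Suc n)) ^ m / fact m))"
    proof
      fix r
      show "f r = ordered_ind s t (Suc n) r * (\<Prod>j<Suc n. h (r j)) * (J' (prev s r (Suc n)) ^ m / fact m)"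
        using ordered_ind_nonzero(3,4)[of s t "Suc n" r "Suc n"] st
        by (cases "ordered_ind s t (Suc n) r = 0") (auto simp: f_def J'_def)
    qed
    have [measurable]: "(\<lambda>r. prev s r (Suc n)) \<in> borel_measurable (lborel_power {..<Suc n})" by (rule prev_measurable) simp
    show "f \<in> borel_measurable (lborel_power {..<Suc n})" unfolding feq by measurable
    show "AE r in lborel_power {..<Suc n}. norm (f r) \<le> norm ((\<Prod>j<Suc n. indicator {s..t} (r j) * Ch) * (Cj ^ m / fact m))"
    proof (rule AE_I2)
      fix r
      show "norm (f r) \<le> norm ((\<Prod>j<Suc n. indicator {s..t} (r j) * Ch) * (Cj ^ m / fact m))"
      proof (cases "ordered_ind s t (Suc n) r = 0")
        case False
        note nz = ordered_ind_nonzero[OF False st]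
        have in_range: "r j \<in> {s..t}" if "j < Suc n" for j using nz(1,2,3)[of j] that by force
        have "norm (f r) = (\<Prod>j<Suc n. \<bar>h (r j)\<bar>) * (\<bar>J (prev s r (Suc n))\<bar> ^ m / fact m)"
          using False ordered_ind_01[of s t "Suc n" r] by (simp add: f_def abs_mult abs_prod power_abs del: prod.lessThan_Suc)
        also have "\<dots> \<le> (\<Prod>j<Suc n. indicator {s..t} (r j) * Ch) * (Cj ^ m / fact m)"
          using in_range Ch Cj nz(3,4)[of "Suc n"]
          by (intro mult_mono prod_mono divide_right_mono power_mono conjI prod_nonneg ballI mult_nonneg_nonneg Ch0) (auto intro: Ch0)
        finally have "norm (f r) \<le> (\<Prod>j<Suc n. indicator {s..t} (r j) * Ch) * (Cj ^ m / fact m)" .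
        then show ?thesis unfolding real_norm_def by (rule order_trans) (rule abs_ge_self)
      qed (simp add: f_def)
    qed
  qed
  have "(\<integral>r. f r \<partial>lborel_power {..<Suc n}) = (\<integral>r. (LBINT x. f (r(n := x))) \<partial>lborel_power {..<n})"
    using lborel_product.product_integral_insert[of "{..<n}" n f] fint by (simp add: lessThan_Suc)
  also have "\<dots> = (\<integral>r. ordered_ind s t n r * (\<Prod>j<n. h (r j)) * (J (prev s r n) ^ Suc m / fact (Suc m)) \<partial>lborel_power {..<n})"
  proof (intro Bochner_Integration.integral_cong refl)
    fix r
    have "f (r(n := x)) = ordered_ind s t n r * (\<Prod>j<n. h (r j)) * ((if prev s r n < x \<and> x \<le> t then 1 else 0) * (h x * (J x ^ m / fact m)))" for x
      unfolding f_def ordered_ind_Suc_upd by (simp add: prev_def mult_ac)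
    then have "(LBINT x. f (r(n := x))) = ordered_ind s t n r * (\<Prod>j<n. h (r j)) * (LBINT x. (if prev s r n < x \<and> x \<le> t then 1 else 0) * (h x * (J x ^ m / fact m)))"
      by simp
    also have "\<dots> = ordered_ind s t n r * (\<Prod>j<n. h (r j)) * (J (prev s r n) ^ Suc m / fact (Suc m))"
      using inner[of "prev s r n"] ordered_ind_nonzero(3,4)[of s t n r n] st
      by (cases "ordered_ind s t n r = 0") auto
    finally show "(LBINT x. f (r(n := x))) = ordered_ind s t n r * (\<Prod>j<n. h (r j)) * (J (prev s r n) ^ Suc m / fact (Suc m))" .
  qed
  also have "\<dots> = K t ^ (n + Suc m) / fact (n + Suc m)" unfolding J_def by (rule Suc.IH)
  finally show ?case unfolding f_def J_def by simp
qed

lemma integral_power_ordered_product: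
  fixes h :: "real \<Rightarrow> real"
  assumes "s \<le> t" "continuous_on UNIV h"
  shows "integral {s..t} h ^ n = fact n * (\<integral>r. ordered_ind s t n r * (\<Prod>j<n. h (r j)) \<partial>lborel_power {..<n})"
  using integral_ordered_product_tail[OF assms, of n 0] by simp

lemma nn_integral_shifted_powr:
  fixes p t \<beta> :: real
  assumes "p \<le> t" "\<beta> < 1"
  shows "(\<integral>\<^sup>+x. ennreal ((if p < x \<and> x \<le> t then 1 else 0) * (x - p) powr (- \<beta>)) \<partial>lborel) \<le> ennreal ((t - p) powr (1 - \<beta>) / (1 - \<beta>))"
proof -
  have "((\<lambda>x. x powr (-\<beta>)) has_integral ((t - p) powr (-\<beta>+1) / (-\<beta>+1))) {0..t - p}"
    using assms by (intro has_integral_powr_from_0) auto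
  then have "(\<integral>\<^sup>+x. ennreal (indicator {0..t-p} x * x powr (-\<beta>)) \<partial>lborel) = ennreal ((t - p) powr (1 - \<beta>) / (1 - \<beta>))"
    by (subst nn_integral_has_integral_lebesgue) auto
  moreover have "(\<integral>\<^sup>+x. ennreal ((if p < x \<and> x \<le> t then 1 else 0) * (x - p) powr (- \<beta>)) \<partial>lborel)
     = (\<integral>\<^sup>+x. ennreal ((if p < p + 1 * x \<and> p + 1 * x \<le> t then 1 else 0) * (p + 1 * x - p) powr (- \<beta>)) \<partial>lborel)"
    by (subst nn_integral_real_affine[where c = 1 and t = p]) auto
  moreover have "\<dots> \<le> (\<integral>\<^sup>+x. ennreal (indicator {0..t-p} x * x powr (-\<beta>)) \<partial>lborel)"
    by (intro nn_integral_mono ennreal_leI) (auto simp: indicator_def)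
  ultimately show ?thesis by simp
qed

text \<open>Integrating the largest time first contributes at most \<open>(t - s)\<^sup>1\<^sup>-\<^sup>\<beta> / (1 - \<beta>)\<close>, whatever the
preceding times are.\<close>

lemma nn_integral_ordered_gaps:
  assumes st: "s \<le> t" and \<beta>: "\<beta> < 1"
  shows "(\<integral>\<^sup>+r. ennreal (ordered_ind s t n r * (\<Prod>j<n. (r j - prev s r j) powr (- \<beta>))) \<partial>lborel_power {..<n})
     \<le> ennreal (((t - s) powr (1 - \<beta>) / (1 - \<beta>)) ^ n)"
proof (induction n)
  case 0
  then show ?case by (simp add: PiM_empty ordered_ind_def)
next
  case (Suc n)
  define f where "f = (\<lambda>n r. ordered_ind s t n r * (\<Prod>j<n. (r j - prev s r j) powr (- \<beta>)))"
  have fm: "f n \<in> borel_measurable (lborel_power {..<n})" for n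
  proof -
    have [measurable]: "(\<lambda>r. prev s r j) \<in> borel_measurable (lborel_power {..<n})" if "j < n" for j
      using that by (intro prev_measurable) simp
    show ?thesis unfolding f_def by measurable
  qed
  have fnn: "f n r \<ge> 0" for r unfolding f_def by (intro mult_nonneg_nonneg ordered_ind_nonneg prod_nonneg) auto
  define C where "C = (t - s) powr (1 - \<beta>) / (1 - \<beta>)"
  have C0: "C \<ge> 0" using \<beta> by (simp add: C_def)
  have upd: "f (Suc n) (r(n := x)) = f n r * ((if prev s r n < x \<and> x \<le> t then 1 else 0) * (x - prev s r n) powr (- \<beta>))" for r x
  proof -
    have "(\<Prod>j<n. ((r(n := x)) j - prev s (r(n := x)) j) powr (- \<beta>)) = (\<Prod>j<n. (r j - prev s r j) powr (- \<beta>))"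
      by (intro prod.cong refl) (auto simp: prev_upd)
    then show ?thesis unfolding f_def ordered_ind_Suc_upd by (simp add: prev_upd mult_ac)
  qed
  have "(\<integral>\<^sup>+r. ennreal (f (Suc n) r) \<partial>lborel_power (insert n {..<n}))
     = (\<integral>\<^sup>+r. (\<integral>\<^sup>+x. ennreal (f (Suc n) (r(n := x))) \<partial>lborel) \<partial>lborel_power {..<n})"
    using fm[of "Suc n"] by (intro lborel_product.product_nn_integral_insert) (auto simp: lessThan_Suc)
  also have "\<dots> \<le> (\<integral>\<^sup>+r. ennreal (f n r) * ennreal C \<partial>lborel_power {..<n})"
  proof (rule nn_integral_mono)
    fix r
    show "(\<integral>\<^sup>+x. ennreal (f (Suc n) (r(n := x))) \<partial>lborel) \<le> ennreal (f n r) * ennreal C"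
    proof (cases "ordered_ind s t n r = 0")
      case True
      then have "f n r = 0" by (simp add: f_def)
      then show ?thesis by (simp add: upd)
    next
      case False
      let ?p = "prev s r n"
      have p: "s \<le> ?p" "?p \<le> t" using ordered_ind_nonzero(3,4)[OF False st] by auto
      have "(\<integral>\<^sup>+x. ennreal (f (Suc n) (r(n := x))) \<partial>lborel)
         = ennreal (f n r) * (\<integral>\<^sup>+x. ennreal ((if ?p < x \<and> x \<le> t then 1 else 0) * (x - ?p) powr (- \<beta>)) \<partial>lborel)"
        unfolding upd using fnn by (subst nn_integral_cmult[symmetric]) (auto simp: ennreal_mult)
      also have "\<dots> \<le> ennreal (f n r) * ennreal ((t - ?p) powr (1 - \<beta>) / (1 - \<beta>))"
        using p \<beta> by (intro mult_left_mono nn_integral_shifted_powr) auto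
      also have "\<dots> \<le> ennreal (f n r) * ennreal C"
        unfolding C_def using p \<beta> by (intro mult_left_mono ennreal_leI divide_right_mono powr_mono2) auto
      finally show ?thesis .
    qed
  qed
  also have "\<dots> = (\<integral>\<^sup>+r. ennreal (f n r) \<partial>lborel_power {..<n}) * ennreal C"
    using fm by (intro nn_integral_multc) auto
  also have "\<dots> \<le> ennreal (C ^ n) * ennreal C"
    using Suc.IH unfolding f_def C_def[symmetric] by (intro mult_right_mono) auto
  also have "\<dots> = ennreal (C ^ Suc n)" using C0 by (simp add: ennreal_mult[symmetric] mult.commute)
  finally show ?case unfolding f_def C_def lessThan_Suc .
qed

section \<open>Gaussian variables and fractional Brownian motion\<close>

text \<open>Degenerate laws are constant almost everywhere; the others have moments of every order.\<close>

lemma gaussian_variable_square_integrable: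
  assumes "prob_space M" and X: "gaussian_variable M X"
  shows "X \<in> borel_measurable M" "integrable M X" "integrable M (\<lambda>\<omega>. (X \<omega>)\<^sup>2)"
proof -
  interpret prob_space M by fact
  show Xm[measurable]: "X \<in> borel_measurable M" using X by (simp add: gaussian_variable_def)
  obtain m where *: "integrable M (\<lambda>\<omega>. (X \<omega> - m))" "integrable M (\<lambda>\<omega>. (X \<omega> - m)\<^sup>2)"
  proof -
    from X consider m where "AE \<omega> in M. X \<omega> = m"
      | m \<sigma> where "\<sigma> > 0" "distributed M lborel X (\<lambda>x. ennreal (normal_density m \<sigma> x))"
      unfolding gaussian_variable_def by blast
    then show ?thesis
    proof cases
      case (1 m)
      have "integrable M (\<lambda>\<omega>. X \<omega> - m) \<longleftrightarrow> integrable M (\<lambda>_. 0::real)"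
        using 1 by (intro integrable_cong_AE) auto
      moreover have "integrable M (\<lambda>\<omega>. (X \<omega> - m)\<^sup>2) \<longleftrightarrow> integrable M (\<lambda>_. 0::real)"
        using 1 by (intro integrable_cong_AE) auto
      ultimately show ?thesis using that by simp
    next
      case (2 m \<sigma>)
      have "integrable M (\<lambda>\<omega>. (X \<omega> - m) ^ k)" for k
        using distributed_integrable[OF 2(2), of "\<lambda>x. (x - m) ^ k"] integrable_normal_moment[OF 2(1), of m k] by simp
      from this[of 1] this[of 2] show ?thesis using that by simp
    qed
  qed
  have "integrable M (\<lambda>\<omega>. (X \<omega> - m) + m)" using *(1) by (intro Bochner_Integration.integrable_add) auto
  then show "integrable M X" by simp
  have "integrable M (\<lambda>\<omega>. (X \<omega> - m)\<^sup>2 + 2 * m * (X \<omega> - m) + m\<^sup>2)"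
    using * by (intro Bochner_Integration.integrable_add) auto
  also have "(\<lambda>\<omega>. (X \<omega> - m)\<^sup>2 + 2 * m * (X \<omega> - m) + m\<^sup>2) = (\<lambda>\<omega>. (X \<omega>)\<^sup>2)"
    by (auto simp: power2_eq_square algebra_simps)
  finally show "integrable M (\<lambda>\<omega>. (X \<omega>)\<^sup>2)" .
qed

lemma centered_gaussian_char:
  assumes "prob_space M" and X: "gaussian_variable M X" and mean: "integral\<^sup>L M X = 0"
  shows "(\<integral>\<omega>. cis (X \<omega>) \<partial>M) = complex_of_real (exp (- (\<integral>\<omega>. (X \<omega>)\<^sup>2 \<partial>M) / 2))"
proof -
  interpret prob_space M by fact
  have Xm[measurable]: "X \<in> borel_measurable M" using X by (simp add: gaussian_variable_def)
  from X consider m where "AE \<omega> in M. X \<omega> = m"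
    | m \<sigma> where "\<sigma> > 0" "distributed M lborel X (\<lambda>x. ennreal (normal_density m \<sigma> x))"
    unfolding gaussian_variable_def by blast
  then show ?thesis
  proof cases
    case (1 m)
    have "integral\<^sup>L M X = (\<integral>\<omega>. m \<partial>M)" using 1 by (intro integral_cong_AE) auto
    then have "m = 0" using mean prob_space by simp
    then have ae: "AE \<omega> in M. X \<omega> = 0" using 1 by simp
    have "(\<integral>\<omega>. cis (X \<omega>) \<partial>M) = (\<integral>\<omega>. 1 \<partial>M)" using ae by (intro integral_cong_AE) auto
    moreover have "(\<integral>\<omega>. (X \<omega>)\<^sup>2 \<partial>M) = (\<integral>\<omega>. 0 \<partial>M)" using ae by (intro integral_cong_AE) auto
    ultimately show ?thesis using prob_space by simp
  next
    case (2 m \<sigma>)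
    have m0: "m = 0" using normal_distributed_expectation[OF 2] mean by simp
    have var: "(\<integral>\<omega>. (X \<omega>)\<^sup>2 \<partial>M) = \<sigma>\<^sup>2" using normal_distributed_variance[OF 2] mean by simp
    have std: "distributed M lborel (\<lambda>\<omega>. X \<omega> / \<sigma>) (\<lambda>x. ennreal (std_normal_density x))"
      using normal_standard_normal_convert[OF 2(1), of X m] 2(2) m0 by simp
    have d: "distr M lborel (\<lambda>\<omega>. X \<omega> / \<sigma>) = std_normal_distribution"
      using distributed_distr_eq_density[OF std] by simp
    have "complex_of_real (exp (- \<sigma>\<^sup>2 / 2)) = char std_normal_distribution \<sigma>"
      unfolding char_std_normal_distribution by simp
    also have "\<dots> = (\<integral>x. iexp (\<sigma> * x) \<partial>distr M lborel (\<lambda>\<omega>. X \<omega> / \<sigma>))"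
      unfolding char_def d ..
    also have "\<dots> = (\<integral>\<omega>. iexp (\<sigma> * (X \<omega> / \<sigma>)) \<partial>M)"
      by (intro integral_distr) auto
    also have "\<dots> = (\<integral>\<omega>. cis (X \<omega>) \<partial>M)" using 2(1) by (simp add: cis_conv_exp)
    finally show ?thesis using var by simp
  qed
qed

lemma fbm_prob_space: "fractional_brownian_motion H M B \<Longrightarrow> prob_space M"
  by (simp add: fractional_brownian_motion_def)

text \<open>A Gaussian process is defined through sums over sets of times. Here the times \<open>r j\<close> may coincide, so
the coefficients that belong to the same time have to be collected.\<close>

lemma fbm_linear_combination_gaussian:
  assumes "fractional_brownian_motion H M B" and J: "finite J" "\<And>j. j \<in> J \<Longrightarrow> 0 \<le> r j"
  shows "gaussian_variable M (\<lambda>\<omega>. \<Sum>j\<in>J. u j * B (r j) \<omega>)"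
proof -
  have gp: "gaussian_process M {0..} B" using assms(1) by (simp add: fractional_brownian_motion_def)
  have "(\<lambda>\<omega>. \<Sum>j\<in>J. u j * B (r j) \<omega>) = (\<lambda>\<omega>. \<Sum>t\<in>r ` J. (\<Sum>j\<in>{x \<in> J. r x = t}. u j) * B t \<omega>)"
  proof
    fix \<omega>
    have "(\<Sum>j\<in>J. u j * B (r j) \<omega>) = (\<Sum>t\<in>r ` J. \<Sum>j\<in>{x \<in> J. r x = t}. u j * B (r j) \<omega>)"
      using J(1) by (intro sum.group[symmetric]) auto
    also have "\<dots> = (\<Sum>t\<in>r ` J. (\<Sum>j\<in>{x \<in> J. r x = t}. u j) * B t \<omega>)"
      unfolding sum_distrib_right by (intro sum.cong refl) auto
    finally show "(\<Sum>j\<in>J. u j * B (r j) \<omega>) = (\<Sum>t\<in>r ` J. (\<Sum>j\<in>{x \<in> J. r x = t}. u j) * B t \<omega>)" .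
  qed
  moreover have "gaussian_variable M (\<lambda>\<omega>. \<Sum>t\<in>r ` J. (\<Sum>j\<in>{x \<in> J. r x = t}. u j) * B t \<omega>)"
  proof -
    have "finite (r ` J) \<and> r ` J \<subseteq> {0..}" using J by auto
    then show ?thesis
      by (rule gp[unfolded gaussian_process_def, rule_format, of "r ` J" "\<lambda>t. \<Sum>j\<in>{x \<in> J. r x = t}. u j"])
  qed
  ultimately show ?thesis by simp
qed

lemma fbm_gaussian_variable:
  assumes "fractional_brownian_motion H M B" "0 \<le> t"
  shows "gaussian_variable M (B t)"
  using fbm_linear_combination_gaussian[OF assms(1), of "{t}" "\<lambda>x. x" "\<lambda>_. 1"] assms(2) by simp

lemma fbm_borel_measurable:
  assumes "fractional_brownian_motion H M B" "0 \<le> t"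
  shows "B t \<in> borel_measurable M"
  using fbm_gaussian_variable[OF assms] by (simp add: gaussian_variable_def)

lemma fbm_integrable:
  assumes "fractional_brownian_motion H M B" "0 \<le> t"
  shows "integrable M (B t)"
  using gaussian_variable_square_integrable(2)[OF fbm_prob_space[OF assms(1)] fbm_gaussian_variable[OF assms]] .

lemma fbm_product_integrable:
  assumes B: "fractional_brownian_motion H M B" and "0 \<le> s" "0 \<le> t"
  shows "integrable M (\<lambda>\<omega>. B s \<omega> * B t \<omega>)"
proof -
  have sq: "integrable M (\<lambda>\<omega>. (B r \<omega>)\<^sup>2)" if "0 \<le> r" for r
    using gaussian_variable_square_integrable(3)[OF fbm_prob_space[OF B] fbm_gaussian_variable[OF B that]] .
  note fbm_borel_measurable[OF B \<open>0 \<le> s\<close>, measurable] fbm_borel_measurable[OF B \<open>0 \<le> t\<close>, measurable]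
  show ?thesis
  proof (rule Bochner_Integration.integrable_bound)
    show "integrable M (\<lambda>\<omega>. (B s \<omega>)\<^sup>2 + (B t \<omega>)\<^sup>2)" using sq assms by auto
    show "AE \<omega> in M. norm (B s \<omega> * B t \<omega>) \<le> norm ((B s \<omega>)\<^sup>2 + (B t \<omega>)\<^sup>2)"
    proof (rule AE_I2)
      fix \<omega>
      have "0 \<le> (\<bar>B s \<omega>\<bar> - \<bar>B t \<omega>\<bar>)\<^sup>2" by simp
      then have "2 * (\<bar>B s \<omega>\<bar> * \<bar>B t \<omega>\<bar>) \<le> (B s \<omega>)\<^sup>2 + (B t \<omega>)\<^sup>2" by (simp add: power2_eq_square algebra_simps)
      moreover have "0 \<le> \<bar>B s \<omega>\<bar> * \<bar>B t \<omega>\<bar>" by simp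
      ultimately show "norm (B s \<omega> * B t \<omega>) \<le> norm ((B s \<omega>)\<^sup>2 + (B t \<omega>)\<^sup>2)"
        unfolding real_norm_def abs_mult by linarith
    qed
  qed measurable
qed

lemma fbm_covariance:
  assumes "fractional_brownian_motion H M B" "0 \<le> s" "0 \<le> t"
  shows "(\<integral>\<omega>. B s \<omega> * B t \<omega> \<partial>M) = fbm_cov H s t"
  using assms by (simp add: fractional_brownian_motion_def fbm_cov_def)

lemma fbm_linear_combination_variance:
  assumes B: "fractional_brownian_motion H M B" and J: "finite J" "\<And>j. j \<in> J \<Longrightarrow> 0 \<le> r j"
  shows "(\<integral>\<omega>. (\<Sum>j\<in>J. u j * B (r j) \<omega>)\<^sup>2 \<partial>M) = (\<Sum>i\<in>J. \<Sum>j\<in>J. fbm_cov H (r i) (r j) * u i * u j)"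
proof -
  have i: "integrable M (\<lambda>\<omega>. B (r i) \<omega> * B (r j) \<omega>)" if "i \<in> J" "j \<in> J" for i j
    using J(2) that by (intro fbm_product_integrable[OF B]) auto
  have "(\<integral>\<omega>. (\<Sum>j\<in>J. u j * B (r j) \<omega>)\<^sup>2 \<partial>M) = (\<integral>\<omega>. (\<Sum>i\<in>J. \<Sum>j\<in>J. (u i * u j) * (B (r i) \<omega> * B (r j) \<omega>)) \<partial>M)"
    unfolding power2_eq_square sum_product by (simp add: mult_ac)
  also have "\<dots> = (\<Sum>i\<in>J. \<Sum>j\<in>J. (u i * u j) * (\<integral>\<omega>. B (r i) \<omega> * B (r j) \<omega> \<partial>M))"
    using i by (subst Bochner_Integration.integral_sum) (auto intro!: sum.cong Bochner_Integration.integrable_sum)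
  also have "\<dots> = (\<Sum>i\<in>J. \<Sum>j\<in>J. fbm_cov H (r i) (r j) * u i * u j)"
    using fbm_covariance[OF B] J(2) by (intro sum.cong refl) auto
  finally show ?thesis .
qed

lemma fbm_char:
  assumes B: "fractional_brownian_motion H M B" and J: "finite J" "\<And>j. j \<in> J \<Longrightarrow> 0 \<le> r j"
  shows "(\<integral>\<omega>. cis (\<Sum>j\<in>J. u j * B (r j) \<omega>) \<partial>M)
     = complex_of_real (exp (- (\<Sum>i\<in>J. \<Sum>j\<in>J. fbm_cov H (r i) (r j) * u i * u j) / 2))"
proof -
  have "(\<integral>\<omega>. (\<Sum>j\<in>J. u j * B (r j) \<omega>) \<partial>M) = (\<Sum>j\<in>J. u j * integral\<^sup>L M (B (r j)))"
    using fbm_integrable[OF B] J(2) by (subst Bochner_Integration.integral_sum) auto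
  also have "\<dots> = 0" using B J(2) by (intro sum.neutral) (auto simp: fractional_brownian_motion_def)
  finally have mean: "(\<integral>\<omega>. (\<Sum>j\<in>J. u j * B (r j) \<omega>) \<partial>M) = 0" .
  have "gaussian_variable M (\<lambda>\<omega>. \<Sum>j\<in>J. u j * B (r j) \<omega>)"
    by (rule fbm_linear_combination_gaussian[OF B J])
  from centered_gaussian_char[OF fbm_prob_space[OF B] this mean]
  show ?thesis
    by (simp only: fbm_linear_combination_variance[where r = r and u = u, OF B J])
qed

lemma fbm_increment_mean_abs:
  assumes B: "fractional_brownian_motion H M B" and st: "0 \<le> s" "0 \<le> t"
  shows "integrable M (\<lambda>\<omega>. \<bar>B s \<omega> - B t \<omega>\<bar>)" "(\<integral>\<omega>. \<bar>B s \<omega> - B t \<omega>\<bar> \<partial>M) \<le> \<bar>s - t\<bar> powr H"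
proof -
  interpret prob_space M by (rule fbm_prob_space[OF B])
  show i: "integrable M (\<lambda>\<omega>. \<bar>B s \<omega> - B t \<omega>\<bar>)"
    using fbm_integrable[OF B] st by auto
  note pi = fbm_product_integrable[OF B]
  have i2: "integrable M (\<lambda>\<omega>. \<bar>B s \<omega> - B t \<omega>\<bar>\<^sup>2)"
  proof -
    have "integrable M (\<lambda>\<omega>. B s \<omega> * B s \<omega> - 2 * (B s \<omega> * B t \<omega>) + B t \<omega> * B t \<omega>)"
      using pi st by (intro Bochner_Integration.integrable_add Bochner_Integration.integrable_diff) auto
    then show ?thesis by (simp add: power2_eq_square algebra_simps)
  qed
  have "(\<integral>\<omega>. \<bar>B s \<omega> - B t \<omega>\<bar>\<^sup>2 \<partial>M) = (\<integral>\<omega>. B s \<omega> * B s \<omega> - 2 * (B s \<omega> * B t \<omega>) + B t \<omega> * B t \<omega> \<partial>M)"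
    by (intro Bochner_Integration.integral_cong refl) (simp add: power2_eq_square algebra_simps)
  also have "\<dots> = fbm_cov H s s - 2 * fbm_cov H s t + fbm_cov H t t"
    using pi st fbm_covariance[OF B] by simp
  also have "\<dots> = \<bar>s - t\<bar> powr (2 * H)"
    by (simp add: fbm_cov_def abs_minus_commute field_simps)
  also have "\<dots> = (\<bar>s - t\<bar> powr H)\<^sup>2"
    by (simp add: power2_eq_square flip: powr_add)
  finally have v: "(\<integral>\<omega>. \<bar>B s \<omega> - B t \<omega>\<bar>\<^sup>2 \<partial>M) = (\<bar>s - t\<bar> powr H)\<^sup>2" .
  have "(\<integral>\<omega>. \<bar>B s \<omega> - B t \<omega>\<bar> \<partial>M)\<^sup>2 \<le> (\<integral>\<omega>. \<bar>B s \<omega> - B t \<omega>\<bar>\<^sup>2 \<partial>M) * 1"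
    using cauchy_schwarz_integral_bounds[of M "\<lambda>\<omega>. \<bar>B s \<omega> - B t \<omega>\<bar>" "\<lambda>_. 1" _ 1] i i2 prob_space by simp
  then show "(\<integral>\<omega>. \<bar>B s \<omega> - B t \<omega>\<bar> \<partial>M) \<le> \<bar>s - t\<bar> powr H"
    unfolding v by (simp add: power2_le_iff_abs_le)
qed

section \<open>Moments of mollified occupation densities\<close>

lemma norm_cis_diff_le: "norm (cis a - cis b) \<le> \<bar>a - b\<bar>"
proof -
  have "cis a - cis b = cis b * (cis (a - b) - 1)"
    by (simp add: algebra_simps cis_mult)
  then have "norm (cis a - cis b) = norm (iexp (a - b) - 1)"
    by (simp add: norm_mult cis_conv_exp)
  also have "\<dots> \<le> \<bar>a - b\<bar>" using iexp_approx1[of "a - b" 0] by simp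
  finally show ?thesis .
qed

text \<open>The difference is at most \<open>2\<close> and at most \<open>|a - b|\<close>; interpolation between the two bounds gives any
exponent in \<open>(0,1]\<close>.\<close>

lemma norm_cis_diff_powr_le:
  assumes "0 < \<alpha>" "\<alpha> \<le> 1"
  shows "norm (cis a - cis b) \<le> 2 * \<bar>a - b\<bar> powr \<alpha>"
proof (cases "\<bar>a - b\<bar> \<le> 1")
  case True
  have "norm (cis a - cis b) \<le> \<bar>a - b\<bar> powr 1" using norm_cis_diff_le[of a b] by simp
  also have "\<dots> \<le> \<bar>a - b\<bar> powr \<alpha>" using True assms by (intro powr_mono') auto
  finally show ?thesis by (smt (verit) powr_ge_zero)
next
  case False
  have "norm (cis a - cis b) \<le> 2" using norm_triangle_ineq4[of "cis a" "cis b"] by simp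
  also have "1 powr \<alpha> \<le> \<bar>a - b\<bar> powr \<alpha>" using False assms by (intro powr_mono2) auto
  then have "2 \<le> 2 * \<bar>a - b\<bar> powr \<alpha>" by simp
  finally show ?thesis .
qed

text \<open>Each factor is the Fourier integral of \<open>tri_hat e l * (cis (- l x) - cis (- l y))\<close>, which is bounded by a
multiple of \<open>|l|\<^sup>\<alpha> |x - y|\<^sup>\<alpha>\<close> with \<open>\<alpha> = 3/n\<close> uniformly in \<open>e\<close>. The \<open>n\<close> factors together give \<open>|x - y|\<^sup>3\<close>.\<close>

lemma fbm_tri_difference_product_expectation:
  fixes r :: "nat \<Rightarrow> real"
  assumes B: "fractional_brownian_motion H M B" and r: "\<And>j. j < n \<Longrightarrow> 0 \<le> r j" and e: "e > 0" and n: "n \<ge> 3"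
  shows "ennreal \<bar>\<integral>\<omega>. (\<Prod>j<n. tri e (B (r j) \<omega> - x) - tri e (B (r j) \<omega> - y)) \<partial>M\<bar>
    \<le> ennreal ((2 / osc_const 1) ^ n * \<bar>x - y\<bar> ^ 3) *
      (\<integral>\<^sup>+u. ennreal ((\<Prod>j<n. \<bar>u j\<bar> powr (3 / n)) * exp (- (\<Sum>i<n. \<Sum>j<n. fbm_cov H (r i) (r j) * u i * u j) / 2)) \<partial>lborel_power {..<n})"
proof -
  interpret prob_space M by (rule fbm_prob_space[OF B])
  define g where "g = (\<lambda>l. complex_of_real (tri_hat e l) * (cis (- (l * x)) - cis (- (l * y))))"
  define \<phi> where "\<phi> = (\<lambda>u :: nat \<Rightarrow> real. exp (- (\<Sum>i<n. \<Sum>j<n. fbm_cov H (r i) (r j) * u i * u j) / 2))"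
  have n1: "0 < 3 / real n" "3 / real n \<le> 1" using n by auto
  have gm[measurable]: "g \<in> borel_measurable borel" unfolding g_def by measurable
  have ic: "integrable lborel (\<lambda>l. complex_of_real (tri_hat e l) * cis (l * z))" for z
  proof (rule Bochner_Integration.integrable_bound[OF integrable_tri_hat[OF e]])
    show "(\<lambda>l. complex_of_real (tri_hat e l) * cis (l * z)) \<in> borel_measurable lborel" by measurable
  qed (simp add: norm_mult)
  have gi: "integrable lborel g"
    using Bochner_Integration.integrable_diff[OF ic[of "-x"] ic[of "-y"]] by (simp add: g_def algebra_simps)
  have four: "complex_of_real (tri e (z - x) - tri e (z - y)) = (CLBINT l. g l * cis (l * z))" for z
  proof -
    have "complex_of_real (tri e (z - x) - tri e (z - y))
      = (CLBINT l. complex_of_real (tri_hat e l) * cis (l * (z - x)) - complex_of_real (tri_hat e l) * cis (l * (z - y)))"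
      using ic by (simp add: tri_fourier[OF e])
    also have "\<dots> = (CLBINT l. g l * cis (l * z))"
    proof -
      have "cis (l * (z - w)) = cis (- (l * w)) * cis (l * z)" for l w
        by (simp add: cis_mult right_diff_distrib)
      then show ?thesis by (simp add: g_def left_diff_distrib right_diff_distrib mult.assoc)
    qed
    finally show ?thesis .
  qed
  have ng: "norm (g l) \<le> (1 / osc_const 1) * (2 * (\<bar>l\<bar> powr (3/n) * \<bar>x - y\<bar> powr (3/n)))" for l
  proof -
    have "norm (g l) = tri_hat e l * norm (cis (- (l * x)) - cis (- (l * y)))"
      by (simp add: g_def norm_mult tri_hat_nonneg)
    also have "\<dots> \<le> (1 / osc_const 1) * (2 * \<bar>- (l * x) - - (l * y)\<bar> powr (3/n))"
      using osc_const_1_pos by (intro mult_mono tri_hat_le e norm_cis_diff_powr_le n1) auto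
    also have "\<bar>- (l * x) - - (l * y)\<bar> = \<bar>l\<bar> * \<bar>x - y\<bar>"
    proof -
      have "- (l * x) - - (l * y) = - (l * (x - y))" by (simp add: algebra_simps)
      then show ?thesis by (simp only: abs_minus_cancel abs_mult)
    qed
    finally show ?thesis by (simp add: powr_mult)
  qed
  have "complex_of_real (\<integral>\<omega>. (\<Prod>j<n. tri e (B (r j) \<omega> - x) - tri e (B (r j) \<omega> - y)) \<partial>M)
     = (\<integral>\<omega>. (\<Prod>j<n. CLBINT l. g l * cis (l * B (r j) \<omega>)) \<partial>M)"
    unfolding four[symmetric] by (simp flip: of_real_prod of_real_diff)
  also have "\<dots> = (\<integral>u. (\<Prod>j<n. g (u j)) * complex_of_real (\<phi> u) \<partial>lborel_power {..<n})"
  proof (rule gaussian_fourier_product[OF prob_space_axioms])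
    show "B (r j) \<in> borel_measurable M" if "j < n" for j by (rule fbm_borel_measurable[OF B r[OF that]])
    show "(\<integral>\<omega>. cis (\<Sum>j<n. u j * B (r j) \<omega>) \<partial>M) = complex_of_real (\<phi> u)" for u
      unfolding \<phi>_def using r by (intro fbm_char[OF B]) auto
  qed (rule gi)
  finally have eq: "complex_of_real (\<integral>\<omega>. (\<Prod>j<n. tri e (B (r j) \<omega> - x) - tri e (B (r j) \<omega> - y)) \<partial>M)
     = (\<integral>u. (\<Prod>j<n. g (u j)) * complex_of_real (\<phi> u) \<partial>lborel_power {..<n})" .
  have "ennreal \<bar>\<integral>\<omega>. (\<Prod>j<n. tri e (B (r j) \<omega> - x) - tri e (B (r j) \<omega> - y)) \<partial>M\<bar>
     = ennreal (norm (\<integral>u. (\<Prod>j<n. g (u j)) * complex_of_real (\<phi> u) \<partial>lborel_power {..<n}))"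
    by (simp flip: eq)
  also have "\<dots> \<le> (\<integral>\<^sup>+u. ennreal (norm ((\<Prod>j<n. g (u j)) * complex_of_real (\<phi> u))) \<partial>lborel_power {..<n})"
  proof (cases "integrable (lborel_power {..<n}) (\<lambda>u. (\<Prod>j<n. g (u j)) * complex_of_real (\<phi> u))")
    case True then show ?thesis by (rule integral_norm_bound_ennreal)
  qed (simp add: not_integrable_integral_eq)
  also have "\<dots> \<le> (\<integral>\<^sup>+u. ennreal ((2 / osc_const 1) ^ n * \<bar>x - y\<bar> ^ 3) * ennreal ((\<Prod>j<n. \<bar>u j\<bar> powr (3 / n)) * \<phi> u) \<partial>lborel_power {..<n})"
  proof (intro nn_integral_mono)
    fix u :: "nat \<Rightarrow> real"
    have "norm (\<Prod>j<n. g (u j)) \<le> (\<Prod>j<n. (1 / osc_const 1) * (2 * (\<bar>u j\<bar> powr (3/n) * \<bar>x - y\<bar> powr (3/n))))"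
      unfolding prod_norm[symmetric] by (intro prod_mono conjI norm_ge_zero ng)
    also have "\<dots> = (2 / osc_const 1) ^ n * (\<bar>x - y\<bar> powr (3/n)) ^ n * (\<Prod>j<n. \<bar>u j\<bar> powr (3 / n))"
      by (simp add: prod.distrib power_divide prod_dividef)
    also have "(\<bar>x - y\<bar> powr (3/n)) ^ n = \<bar>x - y\<bar> ^ 3"
    proof (cases "x = y")
      case False
      then have "(\<bar>x - y\<bar> powr (3/n)) ^ n = \<bar>x - y\<bar> powr ((3 / n) * n)"
        by (simp add: powr_powr flip: powr_realpow)
      then show ?thesis using n False by (simp add: powr_numeral)
    qed (use n in simp)
    finally have "norm ((\<Prod>j<n. g (u j)) * complex_of_real (\<phi> u)) \<le> (2 / osc_const 1) ^ n * \<bar>x - y\<bar> ^ 3 * (\<Prod>j<n. \<bar>u j\<bar> powr (3 / n)) * \<phi> u"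
      unfolding norm_mult by (simp add: \<phi>_def mult_right_mono)
    then show "ennreal (norm ((\<Prod>j<n. g (u j)) * complex_of_real (\<phi> u)))
       \<le> ennreal ((2 / osc_const 1) ^ n * \<bar>x - y\<bar> ^ 3) * ennreal ((\<Prod>j<n. \<bar>u j\<bar> powr (3 / n)) * \<phi> u)"
      using osc_const_1_pos by (subst ennreal_mult[symmetric]) (auto simp: \<phi>_def mult.assoc intro!: mult_nonneg_nonneg prod_nonneg ennreal_leI)
  qed
  also have "\<dots> = ennreal ((2 / osc_const 1) ^ n * \<bar>x - y\<bar> ^ 3) * (\<integral>\<^sup>+u. ennreal ((\<Prod>j<n. \<bar>u j\<bar> powr (3 / n)) * \<phi> u) \<partial>lborel_power {..<n})"
    unfolding \<phi>_def by (intro nn_integral_cmult) measurable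
  finally show ?thesis unfolding \<phi>_def .
qed

text \<open>For ordered times the distance from \<open>r\<^sub>k\<close> to the other times is at least the smaller one of the gaps
before and after \<open>r\<^sub>k\<close>. It is bounded below by their product divided by \<open>T1\<close>, which factorizes. Each gap
then occurs with the exponent \<open>- b\<close> from the Gaussian integral and, twice, with the exponent
\<open>- b \<alpha> = - 3 b / n\<close> from the factors \<open>|u\<^sub>k|\<^sup>\<alpha>\<close>.\<close>

lemma fbm_ordered_product_expectation:
  fixes n :: nat
  assumes ab: "0 < a" "a \<le> b" "b < 1" and T1: "1 \<le> T1" and n: "n \<ge> 3"
  obtains C where "C > 0"
    and "\<And>H (M :: 'w measure) B r s t e x y. a \<le> H \<Longrightarrow> H \<le> b \<Longrightarrow> fractional_brownian_motion H M B \<Longrightarrow> 0 \<le> s \<Longrightarrow> s \<le> t \<Longrightarrow> t \<le> T1 \<Longrightarrow>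
      ordered_ind s t n r \<noteq> 0 \<Longrightarrow> e > 0 \<Longrightarrow>
      \<bar>\<integral>\<omega>. (\<Prod>j<n. tri e (B (r j) \<omega> - x) - tri e (B (r j) \<omega> - y)) \<partial>M\<bar>
       \<le> C * \<bar>x - y\<bar> ^ 3 * (\<Prod>j<n. (r j - prev s r j) powr (- (b + 6 * b / n)))"
proof (rule fbm_local_nondeterminism[OF ab T1, where 'i = nat])
  fix c0 :: real
  assume c0: "c0 > 0" and lnd: "\<And>H (J :: nat set) r u k \<rho>. a \<le> H \<Longrightarrow> H \<le> b \<Longrightarrow> finite J \<Longrightarrow> k \<in> J \<Longrightarrow> (\<And>j. j \<in> J \<Longrightarrow> 0 \<le> r j) \<Longrightarrow>
        0 < \<rho> \<Longrightarrow> \<rho> \<le> T1 \<Longrightarrow> \<rho> \<le> r k \<Longrightarrow> (\<And>j. j \<in> J \<Longrightarrow> j \<noteq> k \<Longrightarrow> u j \<noteq> 0 \<Longrightarrow> \<rho> \<le> \<bar>r j - r k\<bar>) \<Longrightarrow>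
        c0 * \<rho> powr (2*b) * (u k)\<^sup>2 \<le> (\<Sum>i\<in>J. \<Sum>j\<in>J. u i * u j * fbm_cov H (r i) (r j))"
  define C2 where "C2 = c0 powr (- 3 / (2*real n)) * T1 powr (3 * b / n) * sqrt (4 * pi / c0)"
  define C where "C = (2 / osc_const 1) ^ n * (64 * C2 ^ n)"
  have C2: "C2 > 0" unfolding C2_def using c0 T1 by simp
  show thesis
  proof (rule that)
    show "C > 0" unfolding C_def using C2 osc_const_1_pos by simp
    fix H :: real and M :: "'w measure" and B r s t e x y
    assume H: "a \<le> H" "H \<le> b" and B: "fractional_brownian_motion H M B" and st: "0 \<le> s" "s \<le> t" "t \<le> T1"
      and ord: "ordered_ind s t n r \<noteq> 0" and e: "(e::real) > 0"
    note nz = ordered_ind_nonzero[OF ord st(2)]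
    define G where "G = (\<lambda>j. if j < n then r j - prev s r j else T1)"
    have Gpos: "G j > 0" for j unfolding G_def using nz(1) T1 by auto
    have GT: "G j \<le> T1" for j unfolding G_def using nz(2,3)[of j] st by (auto intro: order_trans)
    have rpos: "0 \<le> r j" if "j < n" for j using nz(1,3)[of j] that st by auto
    have Gr: "G j \<le> r j" if "j < n" for j using that nz(3)[of j] st by (auto simp: G_def)
    have gap_left: "G k \<le> \<bar>r i - r k\<bar>" if "i < k" "k < n" for i k
    proof -
      obtain k' where k: "k = Suc k'" using \<open>i < k\<close> by (cases k) auto
      have "r i \<le> r k'" using nz(5)[of i k'] that k by (cases "i = k'") auto
      then show ?thesis using that k nz(1)[of k] by (simp add: G_def prev_def)
    qed
    have gap_right: "G (Suc k) \<le> \<bar>r i - r k\<bar>" if "k < i" "i < n" for i k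
    proof -
      have "r (Suc k) \<le> r i" using nz(5)[of "Suc k" i] that by (cases "Suc k = i") auto
      then show ?thesis using that nz(1)[of "Suc k"] by (simp add: G_def prev_def)
    qed
    \<comment> \<open>at most both neighbouring gaps, as all gaps are at most \<open>T1\<close>; \<open>G n = T1\<close> stands for the missing last one\<close>
    define \<rho> where "\<rho> = (\<lambda>j. G j * G (Suc j) / T1)"
    have \<rho>pos: "\<rho> j > 0" for j unfolding \<rho>_def using Gpos T1 by simp
    have \<rho>G: "\<rho> j \<le> G j" "\<rho> j \<le> G (Suc j)" for j
    proof -
      have "G j * G (Suc j) \<le> G j * T1" "G j * G (Suc j) \<le> T1 * G (Suc j)"
        using Gpos GT by (auto intro!: mult_left_mono mult_right_mono less_imp_le)
      then show "\<rho> j \<le> G j" "\<rho> j \<le> G (Suc j)" using T1 by (auto simp: \<rho>_def field_simps)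
    qed
    let ?q = "\<lambda>i j. fbm_cov H (r i) (r j)"
    let ?a = "\<lambda>j. c0 * \<rho> j powr (2*b)" and ?b = "\<lambda>j. c0 * G j powr (2*b)"
    have sym: "?q i j = ?q j i" for i j
      using abs_minus_commute[of "r i" "r j"] by (simp add: fbm_cov_def)
    have Qeq: "(\<Sum>i<n. \<Sum>j<n. ?q i j * u i * u j) = (\<Sum>i<n. \<Sum>j<n. u i * u j * ?q i j)" for u
      by (simp add: mult_ac)
    have lower: "?a k * (u k)\<^sup>2 \<le> (\<Sum>i<n. \<Sum>j<n. ?q i j * u i * u j)" if "k < n" for u k
      unfolding Qeq
    proof (rule lnd[OF H])
      show "\<rho> k \<le> T1" using \<rho>G[of k] GT[of k] by linarith
      show "\<rho> k \<le> r k" using \<rho>G[of k] Gr[OF that] by linarith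
      show "\<rho> k \<le> \<bar>r j - r k\<bar>" if "j \<in> {..<n}" "j \<noteq> k" for j
        using that \<open>k < n\<close> gap_left[of j k] gap_right[of k j] \<rho>G[of k] by (cases "j < k") auto
    qed (use that rpos \<rho>pos in auto)
    have lower_last: "?b k * (u k)\<^sup>2 \<le> (\<Sum>i<n. \<Sum>j<n. ?q i j * u i * u j)"
      if "k < n" and z: "\<And>i. k < i \<Longrightarrow> i < n \<Longrightarrow> u i = 0" for u k
      unfolding Qeq
    proof (rule lnd[OF H])
      show "G k \<le> \<bar>r j - r k\<bar>" if "j \<in> {..<n}" "j \<noteq> k" "u j \<noteq> 0" for j
        using that \<open>k < n\<close> z[of j] gap_left[of j k] by (cases "j < k") auto
    qed (use that rpos Gpos GT Gr in auto)
    define b' where "b' = b + 6 * b / n"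
    have factor: "?a j powr (- 3 / (2*real n)) * sqrt (4 * pi / ?b j)
       = C2 * (G j powr (- (b + 3*b/n)) * G (Suc j) powr (- (3*b/n)))" for j
    proof -
      have "?a j powr (- 3 / (2*real n)) = c0 powr (- 3 / (2*real n)) * (\<rho> j powr (2*b)) powr (- 3 / (2*real n))"
        using c0 by (simp add: powr_mult)
      also have "(\<rho> j powr (2*b)) powr (- 3 / (2*real n)) = \<rho> j powr (- (3*b/n))"
        by (simp add: powr_powr)
      also have "\<dots> = G j powr (- (3*b/n)) * G (Suc j) powr (- (3*b/n)) * T1 powr (3*b/n)"
        unfolding \<rho>_def using Gpos[of j] Gpos[of "Suc j"] T1
        by (simp add: powr_divide powr_mult powr_minus divide_simps)
      finally have 1: "?a j powr (- 3 / (2*real n)) = c0 powr (- 3 / (2*real n)) * (G j powr (- (3*b/n)) * G (Suc j) powr (- (3*b/n)) * T1 powr (3*b/n))" .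
      have "sqrt (4 * pi / ?b j) = sqrt (4 * pi / c0) / sqrt (G j powr (2*b))"
        by (simp add: real_sqrt_divide real_sqrt_mult)
      also have "sqrt (G j powr (2*b)) = G j powr b" using Gpos[of j] by (simp add: powr_half_sqrt[symmetric] powr_powr)
      finally have 2: "sqrt (4 * pi / ?b j) = sqrt (4 * pi / c0) * G j powr (- b)" by (simp add: powr_minus divide_inverse)
      have 3: "G j powr (- (b + 3*b/n)) = G j powr (- b) * G j powr (- (3*b/n))" by (simp flip: powr_add)
      show ?thesis unfolding 1 2 3 C2_def by (simp only: mult_ac)
    qed
    \<comment> \<open>the product over the shifted gaps replaces \<open>G 0\<close> by \<open>G n = T1\<close>, which is larger\<close>
    have shift: "(\<Prod>j<n. G (Suc j) powr (- (3*b/n))) \<le> (\<Prod>j<n. G j powr (- (3*b/n)))"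
    proof -
      have "G 0 * (\<Prod>j<n. G (Suc j)) = (\<Prod>j<n. G j) * G n" by (metis prod.lessThan_Suc prod.lessThan_Suc_shift mult.commute)
      moreover have "G n = T1" by (simp add: G_def)
      ultimately have "(\<Prod>j<n. G j) * T1 = G 0 * (\<Prod>j<n. G (Suc j))" by simp
      also have "\<dots> \<le> T1 * (\<Prod>j<n. G (Suc j))"
        by (intro mult_right_mono GT prod_nonneg) (auto intro: less_imp_le Gpos)
      finally have le: "(\<Prod>j<n. G j) \<le> (\<Prod>j<n. G (Suc j))" using T1 by simp
      have "(\<Prod>j<n. G (Suc j) powr (- (3*b/n))) = (\<Prod>j<n. G (Suc j)) powr (- (3*b/n))"
        by (rule prod_powr_distrib[symmetric])
      also have "\<dots> \<le> (\<Prod>j<n. G j) powr (- (3*b/n))"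
        using le ab by (intro powr_mono2') (auto intro!: prod_pos Gpos)
      also have "\<dots> = (\<Prod>j<n. G j powr (- (3*b/n)))"
        by (rule prod_powr_distrib)
      finally show ?thesis .
    qed
    have "(\<Prod>j<n. ?a j powr (- 3 / (2*real n)) * sqrt (4 * pi / ?b j))
       = C2 ^ n * ((\<Prod>j<n. G j powr (- (b + 3*b/n))) * (\<Prod>j<n. G (Suc j) powr (- (3*b/n))))"
      unfolding factor by (simp add: prod.distrib)
    also have "\<dots> \<le> C2 ^ n * ((\<Prod>j<n. G j powr (- (b + 3*b/n))) * (\<Prod>j<n. G j powr (- (3*b/n))))"
      using C2 by (intro mult_left_mono shift prod_nonneg) auto
    also have "\<dots> = C2 ^ n * (\<Prod>j<n. G j powr (- b'))"
    proof -
      have "G j powr (- (b + 3*b/n)) * G j powr (- (3*b/n)) = G j powr (- b')" for j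
      proof -
        have "- (b + 3*b/n) + - (3*b/n) = - b'" by (simp add: b'_def)
        then show ?thesis by (simp only: powr_add[symmetric])
      qed
      then show ?thesis by (simp flip: prod.distrib)
    qed
    also have "(\<Prod>j<n. G j powr (- b')) = (\<Prod>j<n. (r j - prev s r j) powr (- b'))"
      by (intro prod.cong refl) (simp add: G_def)
    finally have bound: "(\<Prod>j<n. ?a j powr (- 3 / (2*real n)) * sqrt (4 * pi / ?b j)) \<le> C2 ^ n * (\<Prod>j<n. (r j - prev s r j) powr (- b'))" .
    let ?P = "\<Prod>j<n. (r j - prev s r j) powr (- b')"
    have P0: "?P \<ge> 0" by (intro prod_nonneg) auto
    let ?E = "\<integral>\<omega>. (\<Prod>j<n. tri e (B (r j) \<omega> - x) - tri e (B (r j) \<omega> - y)) \<partial>M"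
    have "ennreal \<bar>?E\<bar> \<le> ennreal ((2 / osc_const 1) ^ n * \<bar>x - y\<bar> ^ 3) *
      (\<integral>\<^sup>+u. ennreal ((\<Prod>j<n. \<bar>u j\<bar> powr (3 / n)) * exp (- (\<Sum>i<n. \<Sum>j<n. ?q i j * u i * u j) / 2)) \<partial>lborel_power {..<n})"
      using rpos by (intro fbm_tri_difference_product_expectation[OF B] e n) auto
    also have "\<dots> \<le> ennreal ((2 / osc_const 1) ^ n * \<bar>x - y\<bar> ^ 3) * ennreal (64 * (\<Prod>j<n. ?a j powr (- 3 / (2 * real n)) * sqrt (4 * pi / ?b j)))"
    proof (rule mult_left_mono)
      show "(\<integral>\<^sup>+u. ennreal ((\<Prod>j<n. \<bar>u j\<bar> powr (3 / n)) * exp (- (\<Sum>i<n. \<Sum>j<n. ?q i j * u i * u j) / 2)) \<partial>lborel_power {..<n})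
        \<le> ennreal (64 * (\<Prod>j<n. ?a j powr (- 3 / (2 * real n)) * sqrt (4 * pi / ?b j)))"
      proof (rule nn_integral_weighted_gaussian[where q = ?q and a = ?a and b = ?b])
        show "?a j > 0" "?b j > 0" for j using c0 \<rho>pos[of j] Gpos[of j] by auto
      qed (use n sym lower lower_last in auto)
    qed simp
    also have "\<dots> \<le> ennreal ((2 / osc_const 1) ^ n * \<bar>x - y\<bar> ^ 3) * ennreal (64 * (C2 ^ n * ?P))"
      by (intro mult_left_mono ennreal_leI bound) auto
    also have "\<dots> = ennreal (C * \<bar>x - y\<bar> ^ 3 * ?P)"
      using P0 C2 osc_const_1_pos by (subst ennreal_mult[symmetric]) (auto simp: C_def mult_ac)
    finally show "\<bar>?E\<bar> \<le> C * \<bar>x - y\<bar> ^ 3 * (\<Prod>j<n. (r j - prev s r j) powr (- (b + 6 * b / n)))"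
      using P0 \<open>C > 0\<close> by (subst (asm) ennreal_le_iff) (auto simp: b'_def)
  qed
qed

lemma floor_fraction_tendsto:
  fixes s :: real
  shows "(\<lambda>k. real_of_int \<lfloor>real (Suc k) * s\<rfloor> / real (Suc k)) \<longlonglongrightarrow> s"
proof (rule tendsto_sandwich[of "\<lambda>k. s - 1 / real (Suc k)" _ _ "\<lambda>_. s"])
  show "(\<lambda>k. s - 1 / real (Suc k)) \<longlonglongrightarrow> s"
    using tendsto_diff[OF tendsto_const[of "s"] LIMSEQ_inverse_real_of_nat] by (simp add: inverse_eq_divide)
  show "\<forall>\<^sub>F k in sequentially. s - 1 / real (Suc k) \<le> real_of_int \<lfloor>real (Suc k) * s\<rfloor> / real (Suc k)"
  proof (intro always_eventually allI)
    fix k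
    have "real (Suc k) * s - 1 \<le> real_of_int \<lfloor>real (Suc k) * s\<rfloor>" by linarith
    then have "(real (Suc k) * s - 1) / real (Suc k) \<le> real_of_int \<lfloor>real (Suc k) * s\<rfloor> / real (Suc k)"
      by (rule divide_right_mono) simp
    then show "s - 1 / real (Suc k) \<le> real_of_int \<lfloor>real (Suc k) * s\<rfloor> / real (Suc k)"
      by (simp add: diff_divide_distrib)
  qed
  show "\<forall>\<^sub>F k in sequentially. real_of_int \<lfloor>real (Suc k) * s\<rfloor> / real (Suc k) \<le> s"
  proof (intro always_eventually allI)
    fix k
    have "real_of_int \<lfloor>real (Suc k) * s\<rfloor> / real (Suc k) \<le> real (Suc k) * s / real (Suc k)"
      by (intro divide_right_mono) auto
    then show "real_of_int \<lfloor>real (Suc k) * s\<rfloor> / real (Suc k) \<le> s" by simp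
  qed
qed simp

text \<open>Evaluation at the discretized time \<open>\<lfloor>k t\<rfloor> / k\<close> involves countably many sections, and by continuity it
converges to the evaluation at \<open>t\<close>.\<close>

lemma caratheodory_measurable:
  fixes f :: "real \<Rightarrow> 'w \<Rightarrow> real"
  assumes f: "\<And>t. f t \<in> borel_measurable M"
    and cont: "\<And>\<omega>. \<omega> \<in> space M \<Longrightarrow> continuous_on UNIV (\<lambda>t. f t \<omega>)"
  shows "(\<lambda>(\<omega>, t). f t \<omega>) \<in> borel_measurable (M \<Otimes>\<^sub>M borel)"
proof -
  define g where "g = (\<lambda>(k::nat) (p :: 'w \<times> real). f (real_of_int \<lfloor>real (Suc k) * snd p\<rfloor> / real (Suc k)) (fst p))"
  have "(\<lambda>p. f (snd p) (fst p)) \<in> borel_measurable (M \<Otimes>\<^sub>M borel)"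
  proof (rule borel_measurable_LIMSEQ_real)
    show "g k \<in> borel_measurable (M \<Otimes>\<^sub>M borel)" for k
    proof -
      have 1: "(\<lambda>p :: 'w \<times> real. f (real_of_int i / real (Suc k)) (fst p)) \<in> borel_measurable (M \<Otimes>\<^sub>M borel)" for i :: int
        by (rule measurable_compose[OF measurable_fst f])
      have 2: "(\<lambda>p :: 'w \<times> real. \<lfloor>real (Suc k) * snd p\<rfloor>) \<in> measurable (M \<Otimes>\<^sub>M borel) (count_space UNIV)"
        by measurable
      show ?thesis unfolding g_def by (rule measurable_compose_countable[OF 1 2])
    qed
    fix p :: "'w \<times> real" assume "p \<in> space (M \<Otimes>\<^sub>M borel)"
    then have \<omega>: "fst p \<in> space M" by (auto simp: space_pair_measure)
    note floor_fraction_tendsto[of "snd p"]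
    then show "(\<lambda>k. g k p) \<longlonglongrightarrow> f (snd p) (fst p)"
      unfolding g_def using cont[OF \<omega>] by (intro continuous_on_tendsto_compose[of UNIV "\<lambda>t. f t (fst p)"]) auto
  qed
  then show ?thesis by (simp add: case_prod_beta')
qed

lemma fbm_path_continuous:
  assumes "fractional_brownian_motion H M B" "\<omega> \<in> space M"
  shows "continuous_on UNIV (\<lambda>r. B (max 0 r) \<omega>)"
proof -
  have "continuous_on {0..} (\<lambda>t. B t \<omega>)" using assms by (simp add: fractional_brownian_motion_def)
  then show ?thesis by (rule continuous_on_compose2) (auto intro!: continuous_intros)
qed

lemma fbm_jointly_measurable:
  assumes B: "fractional_brownian_motion H M B"
  shows "(\<lambda>(\<omega>, r). B (max 0 r) \<omega>) \<in> borel_measurable (M \<Otimes>\<^sub>M borel)"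
  by (rule caratheodory_measurable) (auto intro: fbm_borel_measurable[OF B] fbm_path_continuous[OF B])

text \<open>Expand the power into an integral over ordered times and exchange it with the expectation. The
assumption on \<open>n\<close> says that \<open>n (1 - \<beta>) \<ge> 2\<close> for the exponent \<open>\<beta> = b + 6 b / n\<close> of the gaps.\<close>

lemma fbm_tri_difference_integral_moment:
  fixes n :: nat and a b T1 :: real
  assumes ab: "0 < a" "a \<le> b" "b < 1" and T1: "1 \<le> T1" and n: "n \<ge> 3"
    and n_large: "2 + 6 * b \<le> n * (1 - b)"
  obtains C where "C > 0"
    and "\<And>H (M :: 'w measure) B s t e x y. a \<le> H \<Longrightarrow> H \<le> b \<Longrightarrow> fractional_brownian_motion H M B \<Longrightarrow> 0 \<le> s \<Longrightarrow> s \<le> t \<Longrightarrow> t \<le> T1 \<Longrightarrow> e > 0 \<Longrightarrow>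
      \<bar>\<integral>\<omega>. (integral {s..t} (\<lambda>r. tri e (B (max 0 r) \<omega> - x) - tri e (B (max 0 r) \<omega> - y))) ^ n \<partial>M\<bar>
       \<le> C * \<bar>x - y\<bar> ^ 3 * (t - s)\<^sup>2"
proof (rule fbm_ordered_product_expectation[OF ab T1 n, where 'w = 'w])
  fix C0 :: real
  assume C0: "C0 > 0" and expect: "\<And>H (M :: 'w measure) B r s t e x y. a \<le> H \<Longrightarrow> H \<le> b \<Longrightarrow> fractional_brownian_motion H M B \<Longrightarrow> 0 \<le> s \<Longrightarrow> s \<le> t \<Longrightarrow> t \<le> T1 \<Longrightarrow>
      ordered_ind s t n r \<noteq> 0 \<Longrightarrow> e > 0 \<Longrightarrow>
      \<bar>\<integral>\<omega>. (\<Prod>j<n. tri e (B (r j) \<omega> - x) - tri e (B (r j) \<omega> - y)) \<partial>M\<bar>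
       \<le> C0 * \<bar>x - y\<bar> ^ 3 * (\<Prod>j<n. (r j - prev s r j) powr (- (b + 6 * b / n)))"
  define \<beta> where "\<beta> = b + 6 * b / n"
  have npos: "real n > 0" using n by simp
  have n\<beta>: "real n * (1 - \<beta>) = n * (1 - b) - 6 * b" using npos by (simp add: \<beta>_def field_simps)
  have \<beta>1: "\<beta> < 1"
  proof -
    have "0 < real n * (1 - \<beta>)" using n_large n\<beta> by linarith
    then show ?thesis using npos by (simp add: zero_less_mult_iff)
  qed
  have \<beta>0: "0 \<le> \<beta>" using ab by (simp add: \<beta>_def)
  define C where "C = fact n * (C0 * (1 / (1 - \<beta>)) ^ n * T1 ^ n)"
  show thesis
  proof (rule that)
    show "C > 0" unfolding C_def using C0 \<beta>1 T1 by (intro mult_pos_pos zero_less_power divide_pos_pos) auto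
    fix H :: real and M :: "'w measure" and B s t e x y
    assume H: "a \<le> H" "H \<le> b" and B: "fractional_brownian_motion H M B" and st: "0 \<le> s" "s \<le> t" "t \<le> T1" and e: "(e::real) > 0"
    interpret prob_space M by (rule fbm_prob_space[OF B])
    interpret P: sigma_finite_measure "lborel_power {..<n}" by (rule lborel_product.sigma_finite) simp
    interpret MP: pair_sigma_finite M "lborel_power {..<n}" ..
    define h where "h = (\<lambda>\<omega> r. tri e (B (max 0 r) \<omega> - x) - tri e (B (max 0 r) \<omega> - y))"
    have hc: "continuous_on UNIV (h \<omega>)" if "\<omega> \<in> space M" for \<omega>
      unfolding h_def by (intro continuous_intros tri_continuous fbm_path_continuous[OF B that])
    have hm: "(\<lambda>(\<omega>, r). h \<omega> r) \<in> borel_measurable (M \<Otimes>\<^sub>M borel)"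
    proof -
      note fbm_jointly_measurable[OF B, measurable]
      have "(\<lambda>p. tri e ((case p of (\<omega>, r) \<Rightarrow> B (max 0 r) \<omega>) - x) - tri e ((case p of (\<omega>, r) \<Rightarrow> B (max 0 r) \<omega>) - y)) \<in> borel_measurable (M \<Otimes>\<^sub>M borel)"
        by measurable
      then show ?thesis unfolding h_def by (simp add: case_prod_beta')
    qed
    have hb: "\<bar>h \<omega> r\<bar> \<le> 1 / e" for \<omega> r
      unfolding h_def using tri_le[OF e] tri_nonneg by (smt (verit))
    define f where "f = (\<lambda>\<omega> r. ordered_ind s t n r * (\<Prod>j<n. h \<omega> (r j)))"
    have fi: "integrable (M \<Otimes>\<^sub>M lborel_power {..<n}) (case_prod f)"
    proof (rule Bochner_Integration.integrable_bound)
      let ?G = "\<lambda>r :: nat \<Rightarrow> real. \<Prod>j<n. indicator {s..t} (r j) * (1 / e)"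
      have "integrable lborel (indicat_real {s..t})"
        by (rule integrable_real_indicator) (auto simp: emeasure_lborel_Icc_eq)
      then have Gi: "integrable (lborel_power {..<n}) ?G"
        by (intro lborel_product.product_integrable_prod integrable_mult_left) auto
      show "integrable (M \<Otimes>\<^sub>M lborel_power {..<n}) (\<lambda>p. ?G (snd p))"
      proof (rule MP.Fubini_integrable)
        show "AE \<omega> in M. integrable (lborel_power {..<n}) (\<lambda>r. ?G (snd (\<omega>, r)))" using Gi by simp
      qed auto
      show "case_prod f \<in> borel_measurable (M \<Otimes>\<^sub>M lborel_power {..<n})"
      proof -
        have [measurable]: "(\<lambda>p. h (fst p) (snd p j)) \<in> borel_measurable (M \<Otimes>\<^sub>M lborel_power {..<n})" if "j \<in> {..<n}" for j
        proof -
          have "(\<lambda>p. (fst p, snd p j)) \<in> measurable (M \<Otimes>\<^sub>M lborel_power {..<n}) (M \<Otimes>\<^sub>M borel)"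
            using that by measurable
          from measurable_compose[OF this hm] show ?thesis by simp
        qed
        show ?thesis unfolding f_def case_prod_beta by measurable
      qed
      show "AE p in M \<Otimes>\<^sub>M lborel_power {..<n}. norm (case_prod f p) \<le> norm (?G (snd p))"
      proof (rule AE_I2)
        fix p :: "'w \<times> (nat \<Rightarrow> real)"
        obtain \<omega> r where p: "p = (\<omega>, r)" by (cases p)
        have "norm (f \<omega> r) \<le> ?G r"
        proof (cases "ordered_ind s t n r = 0")
          case True
          then show ?thesis using e by (auto simp: f_def intro!: prod_nonneg)
        next
          case False
          note nz = ordered_ind_nonzero[OF False st(2)]
          have "norm (f \<omega> r) = (\<Prod>j<n. \<bar>h \<omega> (r j)\<bar>)"
            using False ordered_ind_01[of s t n r] by (simp add: f_def abs_prod)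
          also have "\<dots> \<le> ?G r"
          proof (intro prod_mono conjI abs_ge_zero)
            fix j assume "j \<in> {..<n}"
            then have "r j \<in> {s..t}" using nz(1,2,3)[of j] by force
            then show "\<bar>h \<omega> (r j)\<bar> \<le> indicator {s..t} (r j) * (1 / e)" using hb[of \<omega> "r j"] by simp
          qed
          finally show ?thesis .
        qed
        also have "\<dots> \<le> norm (?G r)" unfolding real_norm_def by (rule abs_ge_self)
        finally show "norm (case_prod f p) \<le> norm (?G (snd p))" by (simp add: p)
      qed
    qed
    have pw: "ennreal (norm (\<integral>\<omega>. f \<omega> r \<partial>M)) \<le> ennreal (C0 * \<bar>x - y\<bar> ^ 3) * ennreal (ordered_ind s t n r * (\<Prod>j<n. (r j - prev s r j) powr (- \<beta>)))" for r
    proof (cases "ordered_ind s t n r = 0")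
      case False
      note nz = ordered_ind_nonzero[OF False st(2)]
      have "max 0 (r j) = r j" if "j < n" for j using nz(1,3)[of j] that st by simp
      then have "(\<integral>\<omega>. f \<omega> r \<partial>M) = ordered_ind s t n r * (\<integral>\<omega>. (\<Prod>j<n. tri e (B (r j) \<omega> - x) - tri e (B (r j) \<omega> - y)) \<partial>M)"
        by (simp add: f_def h_def)
      then have "norm (\<integral>\<omega>. f \<omega> r \<partial>M) = ordered_ind s t n r * \<bar>\<integral>\<omega>. (\<Prod>j<n. tri e (B (r j) \<omega> - x) - tri e (B (r j) \<omega> - y)) \<partial>M\<bar>"
        by (simp add: abs_mult ordered_ind_nonneg)
      also have "\<dots> \<le> ordered_ind s t n r * (C0 * \<bar>x - y\<bar> ^ 3 * (\<Prod>j<n. (r j - prev s r j) powr (- \<beta>)))"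
        unfolding \<beta>_def by (intro mult_left_mono expect[OF H B st False e] ordered_ind_nonneg)
      finally show ?thesis using C0
        by (subst ennreal_mult[symmetric]) (auto intro!: mult_nonneg_nonneg prod_nonneg ordered_ind_nonneg ennreal_leI simp: mult_ac)
    qed (simp add: f_def)
    let ?I = "\<lambda>\<omega>. integral {s..t} (h \<omega>)"
    have "(\<integral>\<omega>. ?I \<omega> ^ n \<partial>M) = (\<integral>\<omega>. fact n * (\<integral>r. f \<omega> r \<partial>lborel_power {..<n}) \<partial>M)"
      unfolding f_def using integral_power_ordered_product[OF st(2) hc] by (intro Bochner_Integration.integral_cong refl) auto
    also have "\<dots> = fact n * (\<integral>\<omega>. (\<integral>r. f \<omega> r \<partial>lborel_power {..<n}) \<partial>M)" by simp
    also have "(\<integral>\<omega>. (\<integral>r. f \<omega> r \<partial>lborel_power {..<n}) \<partial>M) = (\<integral>r. (\<integral>\<omega>. f \<omega> r \<partial>M) \<partial>lborel_power {..<n})"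
      by (rule MP.Fubini_integral[OF fi, symmetric])
    finally have eq: "(\<integral>\<omega>. ?I \<omega> ^ n \<partial>M) = fact n * (\<integral>r. (\<integral>\<omega>. f \<omega> r \<partial>M) \<partial>lborel_power {..<n})" .
    have gm: "(\<lambda>r. ordered_ind s t n r * (\<Prod>j<n. (r j - prev s r j) powr (- \<beta>))) \<in> borel_measurable (lborel_power {..<n})"
    proof -
      have [measurable]: "(\<lambda>r. prev s r j) \<in> borel_measurable (lborel_power {..<n})" if "j < n" for j
        using that by (intro prev_measurable) simp
      show ?thesis by measurable
    qed
    define q where "q = real n * (1 - \<beta>)"
    have q2: "q \<ge> 2" unfolding q_def n\<beta> using n_large by linarith
    have qn: "q \<le> n" unfolding q_def using \<beta>0 npos by (simp add: mult_left_le)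
    \<comment> \<open>\<open>(t - s)\<^sup>q \<le> T1\<^sup>n (t - s)\<^sup>2\<close> for \<open>2 \<le> q \<le> n\<close>, where \<open>q = n (1 - \<beta>)\<close>\<close>
    have tsq: "((t - s) powr (1 - \<beta>) / (1 - \<beta>)) ^ n \<le> (1 / (1 - \<beta>)) ^ n * T1 ^ n * (t - s)\<^sup>2"
    proof (cases "s = t")
      case False
      then have ts: "t - s > 0" using st by simp
      have "((t - s) powr (1 - \<beta>)) ^ n = (t - s) powr q"
        using ts by (simp add: powr_powr q_def mult.commute flip: powr_realpow)
      also have "\<dots> = (t - s) powr (q - 2) * (t - s) powr 2" by (simp flip: powr_add)
      also have "(t - s) powr (q - 2) \<le> T1 powr (q - 2)" using ts st q2 by (intro powr_mono2) auto
      also have "T1 powr (q - 2) \<le> T1 powr n" using T1 qn by (intro powr_mono) auto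
      also have "T1 powr n = T1 ^ n" using T1 by (simp add: powr_realpow)
      also have "(t - s) powr 2 = (t - s)\<^sup>2" using ts by (simp add: powr_numeral)
      finally have "((t - s) powr (1 - \<beta>)) ^ n \<le> T1 ^ n * (t - s)\<^sup>2" by (simp add: mult_right_mono)
      then show ?thesis
        using \<beta>1 unfolding divide_inverse power_mult_distrib by (simp add: mult_left_mono mult.assoc mult.commute)
    qed (use n in \<open>simp add: power_0_left\<close>)
    have "ennreal \<bar>\<integral>r. (\<integral>\<omega>. f \<omega> r \<partial>M) \<partial>lborel_power {..<n}\<bar> \<le> (\<integral>\<^sup>+r. ennreal (norm (\<integral>\<omega>. f \<omega> r \<partial>M)) \<partial>lborel_power {..<n})"
    proof (cases "integrable (lborel_power {..<n}) (\<lambda>r. \<integral>\<omega>. f \<omega> r \<partial>M)")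
      case True then show ?thesis unfolding real_norm_def[symmetric] by (rule integral_norm_bound_ennreal)
    qed (simp add: not_integrable_integral_eq)
    also have "\<dots> \<le> (\<integral>\<^sup>+r. ennreal (C0 * \<bar>x - y\<bar> ^ 3) * ennreal (ordered_ind s t n r * (\<Prod>j<n. (r j - prev s r j) powr (- \<beta>))) \<partial>lborel_power {..<n})"
      by (intro nn_integral_mono pw)
    also have "\<dots> = ennreal (C0 * \<bar>x - y\<bar> ^ 3) * (\<integral>\<^sup>+r. ennreal (ordered_ind s t n r * (\<Prod>j<n. (r j - prev s r j) powr (- \<beta>))) \<partial>lborel_power {..<n})"
      using gm by (intro nn_integral_cmult) auto
    also have "\<dots> \<le> ennreal (C0 * \<bar>x - y\<bar> ^ 3) * ennreal (((t - s) powr (1 - \<beta>) / (1 - \<beta>)) ^ n)"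
      by (intro mult_left_mono nn_integral_ordered_gaps st \<beta>1) auto
    also have "\<dots> \<le> ennreal (C0 * \<bar>x - y\<bar> ^ 3) * ennreal ((1 / (1 - \<beta>)) ^ n * T1 ^ n * (t - s)\<^sup>2)"
      by (intro mult_left_mono ennreal_leI tsq) auto
    also have "\<dots> = ennreal (C0 * \<bar>x - y\<bar> ^ 3 * ((1 / (1 - \<beta>)) ^ n * T1 ^ n * (t - s)\<^sup>2))"
      using C0 T1 \<beta>1 by (intro ennreal_mult[symmetric]) auto
    finally have "\<bar>\<integral>r. (\<integral>\<omega>. f \<omega> r \<partial>M) \<partial>lborel_power {..<n}\<bar> \<le> C0 * \<bar>x - y\<bar> ^ 3 * ((1 / (1 - \<beta>)) ^ n * T1 ^ n * (t - s)\<^sup>2)"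
      using C0 T1 \<beta>1 by (subst (asm) ennreal_le_iff) (auto intro!: mult_nonneg_nonneg)
    then have "\<bar>\<integral>\<omega>. ?I \<omega> ^ n \<partial>M\<bar> \<le> fact n * (C0 * \<bar>x - y\<bar> ^ 3 * ((1 / (1 - \<beta>)) ^ n * T1 ^ n * (t - s)\<^sup>2))"
      unfolding eq abs_mult by (simp add: mult_left_mono)
    also have "\<dots> = C * \<bar>x - y\<bar> ^ 3 * (t - s)\<^sup>2" by (simp only: C_def mult_ac)
    finally show "\<bar>\<integral>\<omega>. (integral {s..t} (\<lambda>r. tri e (B (max 0 r) \<omega> - x) - tri e (B (max 0 r) \<omega> - y))) ^ n \<partial>M\<bar> \<le> C * \<bar>x - y\<bar> ^ 3 * (t - s)\<^sup>2"
      unfolding h_def .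
  qed
qed

section \<open>Occupation densities and the moments of local times\<close>

lemma tri_has_integral_one:
  assumes e: "e > 0"
  shows "integrable lborel (tri e)" "(LBINT z. tri e z) = 1"
proof -
  \<comment> \<open>an antiderivative of the right half of the triangle\<close>
  define F where "F = (\<lambda>z. (e * z - z * z / 2) / e\<^sup>2)"
  have nn: "(\<integral>\<^sup>+z. ennreal (indicator {0..e} z * ((e - z) / e\<^sup>2)) \<partial>lborel) = ennreal (1/2)"
  proof -
    have "((\<lambda>z. (e - z) / e\<^sup>2) has_integral (F e - F 0)) {0..e}"
    proof (rule fundamental_theorem_of_calculus)
      fix z assume "z \<in> {0..e}"
      have "((\<lambda>z. e * z - z * z / 2) has_real_derivative (e - z)) (at z within {0..e})"
        by (auto intro!: derivative_eq_intros)
      then have "(F has_real_derivative (e - z) / e\<^sup>2) (at z within {0..e})"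
        unfolding F_def by (rule DERIV_cdivide)
      then show "(F has_vector_derivative (e - z) / e\<^sup>2) (at z within {0..e})"
        by (simp add: has_real_derivative_iff_has_vector_derivative)
    qed (use e in simp)
    moreover have "F e - F 0 = 1/2" using e by (simp add: F_def power2_eq_square field_simps)
    ultimately show ?thesis by (subst nn_integral_has_integral_lebesgue) auto
  qed
  have nn': "(\<integral>\<^sup>+z. ennreal (indicator {0..e} (- z) * ((e - - z) / e\<^sup>2)) \<partial>lborel) = ennreal (1/2)"
    using nn_integral_real_affine[of "\<lambda>z. ennreal (indicator {0..e} z * ((e - z) / e\<^sup>2))" "-1" 0] nn by simp
  have "(\<integral>\<^sup>+z. ennreal (tri e z) \<partial>lborel) =
     (\<integral>\<^sup>+z. ennreal (indicator {0..e} z * ((e - z) / e\<^sup>2)) + ennreal (indicator {0..e} (- z) * ((e - - z) / e\<^sup>2)) \<partial>lborel)"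
  proof (rule nn_integral_cong_AE)
    show "AE z in lborel. ennreal (tri e z) = ennreal (indicator {0..e} z * ((e - z) / e\<^sup>2)) + ennreal (indicator {0..e} (- z) * ((e - - z) / e\<^sup>2))"
      using AE_lborel_singleton[of "0::real"]
    proof eventually_elim
      case (elim z)
      then show ?case using e by (auto simp: tri_def indicator_def max_def)
    qed
  qed
  also have "\<dots> = ennreal (1/2) + ennreal (1/2)"
    using nn nn' by (subst nn_integral_add) auto
  also have "\<dots> = ennreal (1/2 + 1/2)" by (rule ennreal_plus[symmetric]) auto
  also have "\<dots> = 1" by simp
  finally have one: "(\<integral>\<^sup>+z. ennreal (tri e z) \<partial>lborel) = 1" .
  show "integrable lborel (tri e)"
    using one by (intro integrableI_nonneg) (auto simp: tri_nonneg)
  show "(LBINT z. tri e z) = 1"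
    using one by (subst integral_eq_nn_integral) (auto simp: tri_nonneg)
qed

lemma tri_translate_integral_one:
  assumes e: "e > 0"
  shows "integrable lborel (\<lambda>z. tri e (z - x))" "(LBINT z. tri e (z - x)) = 1"
  using lborel_integrable_real_affine[OF tri_has_integral_one(1)[OF e], of 1 "-x"]
    lborel_integral_real_affine[of 1 "tri e" "-x"] tri_has_integral_one(2)[OF e] by auto

lemma mollify_close:
  assumes e: "e > 0" and l: "continuous_on UNIV l"
    and close: "\<And>z. \<bar>z - x\<bar> \<le> e \<Longrightarrow> \<bar>l z - l x\<bar> \<le> \<eta>"
  shows "\<bar>(LBINT z. tri e (z - x) * l z) - l x\<bar> \<le> \<eta>"
proof -
  note ti = tri_translate_integral_one[OF e, of x]
  have [measurable]: "l \<in> borel_measurable borel" using l by (rule borel_measurable_continuous_onI)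
  have bd: "\<bar>tri e (z - x) * (l z - l x)\<bar> \<le> tri e (z - x) * \<eta>" for z
  proof (cases "\<bar>z - x\<bar> \<le> e")
    case True then show ?thesis using close[OF True] by (simp add: abs_mult tri_nonneg mult_left_mono)
  qed (simp add: tri_eq_0)
  have i2: "integrable lborel (\<lambda>z. tri e (z - x) * (l z - l x))"
    by (rule Bochner_Integration.integrable_bound[OF integrable_mult_left[OF ti(1), of \<eta>]])
       (auto intro!: AE_I2 order_trans[OF bd])
  have "(LBINT z. tri e (z - x) * l z) = (LBINT z. tri e (z - x) * (l z - l x) + tri e (z - x) * l x)"
    by (simp add: algebra_simps)
  also have "\<dots> = (LBINT z. tri e (z - x) * (l z - l x)) + l x"
    using i2 ti by (subst Bochner_Integration.integral_add) auto
  finally have "(LBINT z. tri e (z - x) * l z) - l x = (LBINT z. tri e (z - x) * (l z - l x))" by simp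
  also have "\<bar>\<dots>\<bar> \<le> (LBINT z. \<bar>tri e (z - x) * (l z - l x)\<bar>)" by (rule integral_abs_bound)
  also have "\<dots> \<le> (LBINT z. tri e (z - x) * \<eta>)"
    using i2 ti(1) bd by (intro integral_mono) auto
  also have "\<dots> = \<eta>" using ti by simp
  finally show ?thesis by simp
qed

lemma mollify_tendsto:
  assumes l: "continuous_on UNIV l" and e: "\<And>k. e k > 0" "e \<longlonglongrightarrow> 0"
  shows "(\<lambda>k. LBINT z. tri (e k) (z - x) * l z) \<longlonglongrightarrow> l x"
proof (rule LIMSEQ_I)
  fix r :: real assume "r > 0"
  have "isCont l x" using l by (simp add: continuous_on_eq_continuous_at)
  then obtain d where d: "d > 0" "\<And>z. \<bar>z - x\<bar> < d \<Longrightarrow> \<bar>l z - l x\<bar> < r / 2"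
    using \<open>r > 0\<close> unfolding continuous_at_eps_delta dist_real_def by (metis half_gt_zero)
  obtain N where N: "\<And>k. k \<ge> N \<Longrightarrow> \<bar>e k\<bar> < d" using LIMSEQ_D[OF e(2) d(1)] by auto
  have "\<bar>(LBINT z. tri (e k) (z - x) * l z) - l x\<bar> \<le> r / 2" if "k \<ge> N" for k
    using d(2) N[OF that] by (intro mollify_close e l) (auto intro!: less_imp_le)
  then show "\<exists>no. \<forall>n\<ge>no. norm ((LBINT z. tri (e n) (z - x) * l z) - l x) < r"
  proof (intro exI[of _ N] allI impI)
    fix k assume "k \<ge> N"
    then have "\<bar>(LBINT z. tri (e k) (z - x) * l z) - l x\<bar> \<le> r / 2" by fact
    then show "norm ((LBINT z. tri (e k) (z - x) * l z) - l x) < r" using \<open>r > 0\<close> by simp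
  qed
qed

text \<open>The path \<open>b\<close> agrees with \<open>x\<close> at nonnegative times and makes continuity available on the whole line.\<close>

lemma occupation_formula:
  assumes b: "continuous_on UNIV b" and bx: "\<And>r. 0 \<le> r \<Longrightarrow> x r = b r" and t: "0 \<le> t"
    and dens: "is_lebesgue_density (occupation_measure x t) l"
    and g: "continuous_on UNIV g" "\<And>z. 0 \<le> g z"
  shows "integral {0..t} (\<lambda>r. g (b r)) = (LBINT z. g z * l z)"
proof -
  have [measurable]: "b \<in> borel_measurable borel" "g \<in> borel_measurable borel"
    using b g(1) by (auto intro: borel_measurable_continuous_onI)
  have lm[measurable]: "l \<in> borel_measurable borel" and lnn: "AE z in lborel. 0 \<le> l z"
    and eq: "occupation_measure x t = density lborel (\<lambda>z. ennreal (l z))"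
    using dens by (auto simp: is_lebesgue_density_def)
  have xm: "x \<in> measurable (restrict_space lborel {0..t}) borel"
  proof -
    have "b \<in> measurable (restrict_space lborel {0..t}) borel"
      by (rule measurable_restrict_space1) simp
    then show ?thesis by (rule measurable_cong[THEN iffD1, rotated]) (auto simp: space_restrict_space bx)
  qed
  have "integral {0..t} (\<lambda>r. g (b r)) = (LINT r:{0..t}|lborel. g (b r))"
  proof (rule set_borel_integral_eq_integral(2)[symmetric])
    show "set_integrable lborel {0..t} (\<lambda>r. g (b r))"
      using b g by (intro borel_integrable_atLeastAtMost') (auto intro!: continuous_on_compose2[OF g(1)] continuous_on_subset[OF b])
  qed
  also have "\<dots> = (\<integral>r. g (b r) \<partial>restrict_space lborel {0..t})"
    by (simp add: integral_restrict_space set_lebesgue_integral_def)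
  also have "\<dots> = (\<integral>r. g (x r) \<partial>restrict_space lborel {0..t})"
    by (intro Bochner_Integration.integral_cong) (auto simp: space_restrict_space bx)
  also have "\<dots> = (\<integral>z. g z \<partial>occupation_measure x t)"
    unfolding occupation_measure_def using xm by (intro integral_distr[symmetric]) auto
  also have "\<dots> = (LBINT z. l z *\<^sub>R g z)"
    unfolding eq using lnn by (intro integral_density) auto
  finally show ?thesis by (simp add: mult.commute)
qed

lemma occupation_density_bounds:
  assumes dens: "is_lebesgue_density (occupation_measure x t) l" and t: "0 \<le> t"
    and b: "continuous_on UNIV b" and bx: "\<And>r. 0 \<le> r \<Longrightarrow> x r = b r"
  shows "integrable lborel l" "(LBINT z. l z) = t"
proof -
  have lm[measurable]: "l \<in> borel_measurable borel" and lnn: "AE z in lborel. 0 \<le> l z"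
    and eq: "occupation_measure x t = density lborel (\<lambda>z. ennreal (l z))"
    using dens by (auto simp: is_lebesgue_density_def)
  have [measurable]: "b \<in> borel_measurable borel" using b by (rule borel_measurable_continuous_onI)
  have xm: "x \<in> measurable (restrict_space lborel {0..t}) borel"
  proof -
    have "b \<in> measurable (restrict_space lborel {0..t}) borel"
      by (rule measurable_restrict_space1) simp
    then show ?thesis by (rule measurable_cong[THEN iffD1, rotated]) (auto simp: space_restrict_space bx)
  qed
  have "(\<integral>\<^sup>+z. ennreal (l z) \<partial>lborel) = emeasure (occupation_measure x t) UNIV"
    unfolding eq by (subst emeasure_density) auto
  also have "\<dots> = emeasure (restrict_space lborel {0..t}) (x -` UNIV \<inter> space (restrict_space lborel {0..t}))"
    unfolding occupation_measure_def using xm by (intro emeasure_distr) auto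
  also have "\<dots> = ennreal t"
    using t by (simp add: space_restrict_space emeasure_restrict_space emeasure_lborel_Icc_eq)
  finally have nn: "(\<integral>\<^sup>+z. ennreal (l z) \<partial>lborel) = ennreal t" .
  show "integrable lborel l" using nn lnn by (intro integrableI_nonneg) auto
  show "(LBINT z. l z) = t" using nn lnn t by (subst integral_eq_nn_integral) auto
qed

lemma jointly_continuous_section:
  assumes "jointly_continuous M L" "\<omega> \<in> space M" "0 \<le> t"
  shows "continuous_on UNIV (\<lambda>x. L x t \<omega>)"
proof -
  have "continuous_on (UNIV \<times> {0..}) (\<lambda>(x, t). L x t \<omega>)" using assms by (simp add: jointly_continuous_def)
  then have "continuous_on UNIV ((\<lambda>(x, t). L x t \<omega>) \<circ> (\<lambda>x. (x, t)))"
    using assms(3) by (intro continuous_on_compose continuous_intros) (auto elim: continuous_on_subset)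
  then show ?thesis by (simp add: comp_def)
qed

text \<open>As a Lebesgue integral over time of a jointly measurable function, the mollified occupation density is
measurable; for continuous paths this integral agrees with the gauge integral.\<close>

lemma fbm_tri_integral_measurable:
  assumes B: "fractional_brownian_motion H M B"
  shows "(\<lambda>\<omega>. integral {s..t} (\<lambda>r. tri e (B (max 0 r) \<omega> - x))) \<in> borel_measurable M"
proof -
  note fbm_jointly_measurable[OF B, measurable]
  have "(\<lambda>(\<omega>, r). indicator {s..t} r *\<^sub>R tri e ((case (\<omega>, r) of (\<omega>, r) \<Rightarrow> B (max 0 r) \<omega>) - x)) \<in> borel_measurable (M \<Otimes>\<^sub>M lborel)"
    by measurable
  then have m: "(\<lambda>\<omega>. LINT r:{s..t}|lborel. tri e (B (max 0 r) \<omega> - x)) \<in> borel_measurable M"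
    unfolding set_lebesgue_integral_def by (intro lborel.borel_measurable_lebesgue_integral) simp
  show ?thesis
  proof (rule measurable_cong[THEN iffD1, OF _ m])
    fix \<omega> assume "\<omega> \<in> space M"
    show "(LINT r:{s..t}|lborel. tri e (B (max 0 r) \<omega> - x)) = integral {s..t} (\<lambda>r. tri e (B (max 0 r) \<omega> - x))"
      by (intro set_borel_integral_eq_integral(2) borel_integrable_atLeastAtMost' tri_continuous continuous_intros
          continuous_on_subset[OF fbm_path_continuous[OF B \<open>\<omega> \<in> space M\<close>]]) auto
  qed
qed

lemma local_time_mollified:
  assumes B: "fractional_brownian_motion H M B" and L: "local_time M B L" and e: "e > 0" and t: "0 \<le> t"
  shows "AE \<omega> in M. \<forall>x. integral {0..t} (\<lambda>r. tri e (B (max 0 r) \<omega> - x)) = (LBINT z. tri e (z - x) * L z t \<omega>)"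
proof -
  have "AE \<omega> in M. is_lebesgue_density (occupation_measure (\<lambda>s. B s \<omega>) t) (\<lambda>x. L x t \<omega>)"
    using L t by (simp add: local_time_def)
  then show ?thesis using AE_space
  proof eventually_elim
    case (elim \<omega>)
    show ?case
    proof
      fix x
      show "integral {0..t} (\<lambda>r. tri e (B (max 0 r) \<omega> - x)) = (LBINT z. tri e (z - x) * L z t \<omega>)"
        by (rule occupation_formula[OF fbm_path_continuous[OF B elim(2)] _ t elim(1)])
           (auto intro!: tri_continuous continuous_intros tri_nonneg)
    qed
  qed
qed

text \<open>Mollified occupation densities converge almost surely to the continuous density, so the moment bound
passes to the limit by Fatou's lemma. Evenness of \<open>n\<close> turns the bound for the expectation of a power
into one for the absolute moment.\<close>

lemma local_time_increment_moment:
  fixes n :: nat and a b T1 :: real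
  assumes ab: "0 < a" "a \<le> b" "b < 1" and T1: "1 \<le> T1" and n: "n \<ge> 3" "even n"
    and n_large: "2 + 6 * b \<le> n * (1 - b)"
  obtains C where "C > 0"
    and "\<And>H (M :: 'w measure) B L s t x y. a \<le> H \<Longrightarrow> H \<le> b \<Longrightarrow> fractional_brownian_motion H M B \<Longrightarrow>
       local_time M B L \<Longrightarrow> jointly_continuous M L \<Longrightarrow> 0 \<le> s \<Longrightarrow> s \<le> t \<Longrightarrow> t \<le> T1 \<Longrightarrow>
      (\<integral>\<^sup>+\<omega>. ennreal (\<bar>(L x t \<omega> - L x s \<omega>) - (L y t \<omega> - L y s \<omega>)\<bar> ^ n) \<partial>M) \<le> ennreal (C * \<bar>x - y\<bar> ^ 3 * (t - s)\<^sup>2)"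
proof (rule fbm_tri_difference_integral_moment[OF ab T1 n(1) n_large, where 'w = 'w])
  fix C :: real
  assume C: "C > 0" and mom: "\<And>H (M :: 'w measure) B s t e x y. a \<le> H \<Longrightarrow> H \<le> b \<Longrightarrow> fractional_brownian_motion H M B \<Longrightarrow> 0 \<le> s \<Longrightarrow> s \<le> t \<Longrightarrow> t \<le> T1 \<Longrightarrow> e > 0 \<Longrightarrow>
      \<bar>\<integral>\<omega>. (integral {s..t} (\<lambda>r. tri e (B (max 0 r) \<omega> - x) - tri e (B (max 0 r) \<omega> - y))) ^ n \<partial>M\<bar>
       \<le> C * \<bar>x - y\<bar> ^ 3 * (t - s)\<^sup>2"
  show thesis
  proof (rule that[OF C])
    fix H :: real and M :: "'w measure" and B L s t x y
    assume H: "a \<le> H" "H \<le> b" and B: "fractional_brownian_motion H M B" and L: "local_time M B L"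
      and J: "jointly_continuous M L" and st: "0 \<le> s" "s \<le> t" "t \<le> T1"
    interpret prob_space M by (rule fbm_prob_space[OF B])
    define e where "e = (\<lambda>k. 1 / real (Suc k))"
    have e: "e k > 0" for k by (simp add: e_def)
    have e0: "e \<longlonglongrightarrow> 0" unfolding e_def using LIMSEQ_inverse_real_of_nat by (simp add: inverse_eq_divide)
    define A where "A = (\<lambda>k t x \<omega>. integral {0..t} (\<lambda>r. tri (e k) (B (max 0 r) \<omega> - x)))"
    define I where "I = (\<lambda>k \<omega>. (A k t x \<omega> - A k s x \<omega>) - (A k t y \<omega> - A k s y \<omega>))"
    have [measurable]: "A k t x \<in> borel_measurable M" for k t x
      unfolding A_def by (rule fbm_tri_integral_measurable[OF B])
    have Im[measurable]: "I k \<in> borel_measurable M" for k unfolding I_def by measurable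
    have iint: "(\<lambda>r. tri (e k) (B (max 0 r) \<omega> - x)) integrable_on {p..q}" if "\<omega> \<in> space M" for k \<omega> x p q
      by (intro integrable_continuous_interval tri_continuous continuous_intros continuous_on_subset[OF fbm_path_continuous[OF B that]]) auto
    have Ieq: "I k \<omega> = integral {s..t} (\<lambda>r. tri (e k) (B (max 0 r) \<omega> - x) - tri (e k) (B (max 0 r) \<omega> - y))" if "\<omega> \<in> space M" for k \<omega>
    proof -
      have "A k t z \<omega> - A k s z \<omega> = integral {s..t} (\<lambda>r. tri (e k) (B (max 0 r) \<omega> - z))" for z
        unfolding A_def using Henstock_Kurzweil_Integration.integral_combine[OF st(1,2) iint[OF that, of k z]] by simp
      then show ?thesis unfolding I_def using iint[OF that] by (simp add: Henstock_Kurzweil_Integration.integral_diff)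
    qed
    have Ab: "\<bar>A k p z \<omega>\<bar> \<le> p / e k" if "\<omega> \<in> space M" "0 \<le> p" for k p z \<omega>
    proof -
      have "norm (A k p z \<omega>) \<le> integral {0..p} (\<lambda>r. 1 / e k)"
        unfolding A_def using tri_le[OF e] tri_nonneg
        by (intro integral_norm_bound_integral iint that(1)) auto
      then show ?thesis using that by simp
    qed
    have Ib: "\<bar>I k \<omega>\<bar> \<le> 4 * t / e k" if "\<omega> \<in> space M" for k \<omega>
    proof -
      have "\<bar>I k \<omega>\<bar> \<le> \<bar>A k t x \<omega>\<bar> + \<bar>A k s x \<omega>\<bar> + \<bar>A k t y \<omega>\<bar> + \<bar>A k s y \<omega>\<bar>" unfolding I_def by linarith
      also have "\<dots> \<le> t / e k + s / e k + t / e k + s / e k" using Ab[OF that] st by (intro add_mono) auto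
      also have "\<dots> \<le> 4 * t / e k" using st e[of k] by (simp add: field_simps)
      finally show ?thesis .
    qed
    have Iint: "integrable M (\<lambda>\<omega>. I k \<omega> ^ n)" for k
    proof (rule integrable_const_bound)
      show "AE \<omega> in M. norm (I k \<omega> ^ n) \<le> (4 * t / e k) ^ n"
        using Ib by (intro AE_I2) (simp add: power_abs power_mono)
    qed measurable
    have mom_k: "(\<integral>\<^sup>+\<omega>. ennreal (\<bar>I k \<omega>\<bar> ^ n) \<partial>M) \<le> ennreal (C * \<bar>x - y\<bar> ^ 3 * (t - s)\<^sup>2)" for k
    proof -
      have "(\<integral>\<^sup>+\<omega>. ennreal (\<bar>I k \<omega>\<bar> ^ n) \<partial>M) = (\<integral>\<^sup>+\<omega>. ennreal (I k \<omega> ^ n) \<partial>M)"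
        using n(2) by (simp add: power_even_abs)
      also have "\<dots> = ennreal (\<integral>\<omega>. I k \<omega> ^ n \<partial>M)"
        using n(2) by (intro nn_integral_eq_integral Iint) (auto simp: zero_le_even_power)
      also have "(\<integral>\<omega>. I k \<omega> ^ n \<partial>M) = (\<integral>\<omega>. (integral {s..t} (\<lambda>r. tri (e k) (B (max 0 r) \<omega> - x) - tri (e k) (B (max 0 r) \<omega> - y))) ^ n \<partial>M)"
        using Ieq by (intro Bochner_Integration.integral_cong) auto
      also have "ennreal \<dots> \<le> ennreal (C * \<bar>x - y\<bar> ^ 3 * (t - s)\<^sup>2)"
        using mom[OF H B st e, of k x y] by (intro ennreal_leI) linarith
      finally show ?thesis .
    qed
    have s0: "0 \<le> t" using st by simp
    have ae: "AE \<omega> in M. \<forall>k x. A k p x \<omega> = (LBINT z. tri (e k) (z - x) * L z p \<omega>)" if "0 \<le> p" for p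
      unfolding AE_all_countable A_def by (intro allI local_time_mollified[OF B L e that])
    have lim: "AE \<omega> in M. (\<lambda>k. ennreal (\<bar>I k \<omega>\<bar> ^ n)) \<longlonglongrightarrow> ennreal (\<bar>(L x t \<omega> - L x s \<omega>) - (L y t \<omega> - L y s \<omega>)\<bar> ^ n)"
      using ae[OF st(1)] ae[OF s0] AE_space
    proof eventually_elim
      case (elim \<omega>)
      have "(\<lambda>k. A k p z \<omega>) \<longlonglongrightarrow> L z p \<omega>" if "p = s \<or> p = t" for p z
      proof -
        have "0 \<le> p" using that st by auto
        have "A k p z \<omega> = (LBINT u. tri (e k) (u - z) * L u p \<omega>)" for k using elim that by auto
        then show ?thesis using mollify_tendsto[OF jointly_continuous_section[OF J elim(3) \<open>0 \<le> p\<close>] e e0] by simp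
      qed
      then have "(\<lambda>k. I k \<omega>) \<longlonglongrightarrow> (L x t \<omega> - L x s \<omega>) - (L y t \<omega> - L y s \<omega>)"
        unfolding I_def by (intro tendsto_intros) auto
      then show ?case by (intro tendsto_ennrealI tendsto_power tendsto_rabs)
    qed
    have "(\<integral>\<^sup>+\<omega>. ennreal (\<bar>(L x t \<omega> - L x s \<omega>) - (L y t \<omega> - L y s \<omega>)\<bar> ^ n) \<partial>M)
       = (\<integral>\<^sup>+\<omega>. liminf (\<lambda>k. ennreal (\<bar>I k \<omega>\<bar> ^ n)) \<partial>M)"
    proof (rule nn_integral_cong_AE)
      show "AE \<omega> in M. ennreal (\<bar>(L x t \<omega> - L x s \<omega>) - (L y t \<omega> - L y s \<omega>)\<bar> ^ n) = liminf (\<lambda>k. ennreal (\<bar>I k \<omega>\<bar> ^ n))"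
        using lim
      proof eventually_elim
        case (elim \<omega>)
        then show ?case using lim_imp_Liminf[OF sequentially_bot elim] by simp
      qed
    qed
    also have "\<dots> \<le> liminf (\<lambda>k. \<integral>\<^sup>+\<omega>. ennreal (\<bar>I k \<omega>\<bar> ^ n) \<partial>M)"
      by (rule nn_integral_liminf) measurable
    also have "\<dots> \<le> limsup (\<lambda>k. \<integral>\<^sup>+\<omega>. ennreal (\<bar>I k \<omega>\<bar> ^ n) \<partial>M)" by (rule Liminf_le_Limsup) simp
    also have "\<dots> \<le> ennreal (C * \<bar>x - y\<bar> ^ 3 * (t - s)\<^sup>2)"
      by (intro Limsup_bounded always_eventually allI mom_k)
    finally show "(\<integral>\<^sup>+\<omega>. ennreal (\<bar>(L x t \<omega> - L x s \<omega>) - (L y t \<omega> - L y s \<omega>)\<bar> ^ n) \<partial>M) \<le> ennreal (C * \<bar>x - y\<bar> ^ 3 * (t - s)\<^sup>2)" .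
  qed
qed

section \<open>Dyadic chaining\<close>

text \<open>The geometric series of the chaining argument sums to \<open>1 / (1 - 2\<^sup>-\<^sup>1\<^sup>/\<^sup>n)\<close>. It is used once for each of the
two points and once to dominate the step between their dyadic approximations.\<close>

definition chain_const :: "nat \<Rightarrow> real" where
  "chain_const n = 3 / (1 - 2 powr (- 1 / n))"

lemma chain_ratio:
  assumes "n > 0" shows "0 < (2::real) powr (- 1 / real n)" "(2::real) powr (- 1 / real n) < 1"
proof -
  show "(2::real) powr (- 1 / real n) < 1"
    using powr_less_mono[of "- 1 / real n" 0 2] assms by simp
qed simp

lemma chain_const_pos: "n > 0 \<Longrightarrow> chain_const n > 0"
  using chain_ratio[of n] by (simp add: chain_const_def)

text \<open>Each point is approximated by \<open>\<lfloor>2\<^sup>k z\<rfloor> / 2\<^sup>k\<close>. Passing from \<open>k\<close> to \<open>k + 1\<close> moves it by at most one dyadic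
step, on which \<open>\<phi>\<close> changes by at most \<open>\<beta>\<^sup>1\<^sup>/\<^sup>n q\<^sup>k\<^sup>+\<^sup>1\<close> with \<open>q = 2\<^sup>-\<^sup>1\<^sup>/\<^sup>n\<close>. At level \<open>m\<close> the
approximations of \<open>x\<close> and \<open>y\<close> coincide or are adjacent.\<close>

lemma dyadic_chaining:
  fixes \<phi> :: "real \<Rightarrow> real"
  assumes cont: "continuous_on {0..1} \<phi>" and n: "n > 0" and \<beta>: "\<beta> > 0"
    and incr: "\<And>k i. i < 2 ^ k \<Longrightarrow> 2 ^ k * \<bar>\<phi> (real (Suc i) / 2 ^ k) - \<phi> (real i / 2 ^ k)\<bar> ^ n \<le> \<beta>"
    and xy: "x \<in> {0..1}" "y \<in> {0..1}" "\<bar>x - y\<bar> \<le> 1 / 2 ^ m"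
  shows "\<bar>\<phi> x - \<phi> y\<bar> \<le> chain_const n * \<beta> powr (1 / n) * (2 powr (- 1 / n)) ^ m"
proof -
  define q :: real where "q = 2 powr (- 1 / n)"
  have q: "0 < q" "q < 1" unfolding q_def using chain_ratio[OF n] by auto
  define D where "D = (\<lambda>k. \<beta> powr (1 / n) * q ^ k)"
  have Dnn: "D k \<ge> 0" for k unfolding D_def using q by simp
  have step: "\<bar>\<phi> (real (Suc i) / 2 ^ k) - \<phi> (real i / 2 ^ k)\<bar> \<le> D k" if "i < 2 ^ k" for i k
  proof -
    let ?d = "\<bar>\<phi> (real (Suc i) / 2 ^ k) - \<phi> (real i / 2 ^ k)\<bar>"
    have "?d ^ n \<le> \<beta> / 2 ^ k" using incr[OF that] by (simp add: field_simps)
    also have "\<dots> = D k ^ n"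
    proof -
      have "q ^ n = q powr n" using q by (simp add: powr_realpow)
      also have "\<dots> = 2 powr (- 1 / n * n)" unfolding q_def by (simp only: powr_powr)
      also have "\<dots> = 1 / 2" using n by (simp add: powr_minus_divide)
      finally have "q ^ n = 1 / 2" .
      then have "(q ^ k) ^ n = 1 / 2 ^ k" by (metis power_commutes power_mult mult.commute power_one_over)
      moreover have "(\<beta> powr (1 / n)) ^ n = \<beta>" using n \<beta> by (simp add: powr_powr flip: powr_realpow)
      ultimately show ?thesis by (simp add: D_def power_mult_distrib)
    qed
    finally show ?thesis using n Dnn[of k] power_mono_iff[of ?d "D k" n] by simp
  qed
  define p where "p = (\<lambda>k (z::real). nat \<lfloor>2 ^ k * z\<rfloor>)"
  define \<pi> where "\<pi> = (\<lambda>k z. real (p k z) / 2 ^ k)"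
  have p_le: "real (p k z) \<le> 2 ^ k * z" and p_gt: "2 ^ k * z < real (p k z) + 1" if "z \<in> {0..1}" for k z
  proof -
    have "0 \<le> 2 ^ k * z" using that by simp
    then show "real (p k z) \<le> 2 ^ k * z" "2 ^ k * z < real (p k z) + 1" unfolding p_def by (simp_all add: of_nat_floor)
  qed
  have \<pi>01: "\<pi> k z \<in> {0..1}" if "z \<in> {0..1}" for k z
  proof -
    have "real (p k z) \<le> 2 ^ k" using p_le[OF that, of k] that by (smt (verit) atLeastAtMost_iff mult_left_le zero_le_power)
    then show ?thesis by (simp add: \<pi>_def)
  qed
  have close: "\<bar>\<phi> (real i / 2 ^ k) - \<phi> (real j / 2 ^ k)\<bar> \<le> D k"
    if ij: "i \<le> 2 ^ k" "j \<le> 2 ^ k" "i \<le> j + 1" "j \<le> i + 1" for i j k :: nat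
  proof -
    consider "i = j" | "i = Suc j" | "j = Suc i" using ij by linarith
    then show ?thesis
    proof cases
      case 1 then show ?thesis using Dnn by simp
    next
      case 2 then show ?thesis using step[of j k] ij by simp
    next
      case 3 then show ?thesis using step[of i k] ij by (simp add: abs_minus_commute)
    qed
  qed
  have p_bound: "p k z \<le> 2 ^ k" if "z \<in> {0..1}" for k z
    using \<pi>01[OF that, of k] by (simp add: \<pi>_def)
  have refine: "\<bar>\<phi> (\<pi> (Suc k) z) - \<phi> (\<pi> k z)\<bar> \<le> D (Suc k)" if z: "z \<in> {0..1}" for k z
  proof -
    have 1: "\<pi> k z = real (2 * p k z) / 2 ^ Suc k" by (simp add: \<pi>_def)
    have "real (2 * p k z) < real (p (Suc k) z) + 1" using p_le[OF z, of k] p_gt[OF z, of "Suc k"] by simp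
    moreover have "real (p (Suc k) z) < real (2 * p k z) + 2" using p_gt[OF z, of k] p_le[OF z, of "Suc k"] by simp
    ultimately have "2 * p k z \<le> p (Suc k) z + 1" "p (Suc k) z \<le> 2 * p k z + 1" by linarith+
    then show ?thesis unfolding 1 unfolding \<pi>_def using p_bound[OF z, of k] p_bound[OF z, of "Suc k"] by (intro close) auto
  qed
  have tele: "\<bar>\<phi> (\<pi> (m + j) z) - \<phi> (\<pi> m z)\<bar> \<le> D m * ((1 - q ^ j) / (1 - q))" if z: "z \<in> {0..1}" for j z
  proof (induction j)
    case (Suc j)
    have "\<bar>\<phi> (\<pi> (m + Suc j) z) - \<phi> (\<pi> m z)\<bar> \<le> D (Suc (m + j)) + D m * ((1 - q ^ j) / (1 - q))"
      using Suc refine[OF z, of "m + j"] by simp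
    also have "D (Suc (m + j)) \<le> D m * q ^ j"
    proof -
      have "D (Suc (m + j)) = q * (D m * q ^ j)" by (simp add: D_def power_add)
      also have "\<dots> \<le> 1 * (D m * q ^ j)" using q Dnn by (intro mult_right_mono) auto
      finally show ?thesis by simp
    qed
    also have "D m * q ^ j + D m * ((1 - q ^ j) / (1 - q)) = D m * ((1 - q ^ Suc j) / (1 - q))"
      using q by (simp add: field_simps)
    finally show ?case by simp
  qed simp
  have lim: "\<bar>\<phi> z - \<phi> (\<pi> m z)\<bar> \<le> D m / (1 - q)" if z: "z \<in> {0..1}" for z
  proof -
    have "(\<lambda>j. \<pi> (m + j) z) \<longlonglongrightarrow> z"
    proof (rule tendsto_sandwich[of "\<lambda>j. z - (1/2) ^ (m + j)" _ _ "\<lambda>_. z"])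
      show "(\<lambda>j. z - (1 / 2) ^ (m + j)) \<longlonglongrightarrow> z"
      proof -
        have "(\<lambda>j. (1/2::real) ^ j) \<longlonglongrightarrow> 0" by (intro LIMSEQ_power_zero) auto
        then have "(\<lambda>j. (1/2::real) ^ (j + m)) \<longlonglongrightarrow> 0" by (rule LIMSEQ_ignore_initial_segment)
        from tendsto_diff[OF tendsto_const this] show ?thesis by (simp add: add.commute)
      qed
      show "\<forall>\<^sub>F j in sequentially. z - (1 / 2) ^ (m + j) \<le> \<pi> (m + j) z"
      proof (intro always_eventually allI)
        fix j
        have "(2 ^ (m+j) * z - 1) / 2 ^ (m+j) \<le> real (p (m+j) z) / 2 ^ (m+j)"
          using p_gt[OF z, of "m+j"] by (intro divide_right_mono) auto
        then show "z - (1 / 2) ^ (m + j) \<le> \<pi> (m + j) z"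
          by (simp add: \<pi>_def diff_divide_distrib power_one_over)
      qed
      show "\<forall>\<^sub>F j in sequentially. \<pi> (m + j) z \<le> z"
      proof (intro always_eventually allI)
        fix j
        have "real (p (m+j) z) / 2 ^ (m+j) \<le> 2 ^ (m+j) * z / 2 ^ (m+j)"
          using p_le[OF z, of "m+j"] by (intro divide_right_mono) auto
        then show "\<pi> (m + j) z \<le> z" by (simp add: \<pi>_def)
      qed
    qed simp
    then have "(\<lambda>j. \<phi> (\<pi> (m + j) z)) \<longlonglongrightarrow> \<phi> z"
      using cont z \<pi>01[OF z] by (intro continuous_on_tendsto_compose[of "{0..1}" \<phi>]) auto
    then have "(\<lambda>j. \<bar>\<phi> (\<pi> (m + j) z) - \<phi> (\<pi> m z)\<bar>) \<longlonglongrightarrow> \<bar>\<phi> z - \<phi> (\<pi> m z)\<bar>"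
      by (intro tendsto_intros)
    moreover have "\<bar>\<phi> (\<pi> (m + j) z) - \<phi> (\<pi> m z)\<bar> \<le> D m / (1 - q)" for j
    proof -
      have "D m * ((1 - q ^ j) / (1 - q)) \<le> D m * (1 / (1 - q))"
        using q Dnn by (intro mult_left_mono divide_right_mono) auto
      then show ?thesis using tele[OF z, of j] by simp
    qed
    ultimately show ?thesis by (intro LIMSEQ_le_const2) auto
  qed
  have base: "\<bar>\<phi> (\<pi> m x) - \<phi> (\<pi> m y)\<bar> \<le> D m"
  proof -
    have "\<bar>2 ^ m * x - 2 ^ m * y\<bar> \<le> 1"
    proof -
      have "2 ^ m * \<bar>x - y\<bar> \<le> 2 ^ m * (1 / 2 ^ m)" using xy(3) by (intro mult_left_mono) auto
      then show ?thesis by (simp add: abs_mult flip: right_diff_distrib)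
    qed
    then have "real (p m x) < real (p m y) + 2" "real (p m y) < real (p m x) + 2"
      using p_le[OF xy(1), of m] p_gt[OF xy(1), of m] p_le[OF xy(2), of m] p_gt[OF xy(2), of m] by linarith+
    then show ?thesis unfolding \<pi>_def using p_bound xy by (intro close) auto
  qed
  have "\<bar>\<phi> x - \<phi> y\<bar> \<le> D m / (1 - q) + D m + D m / (1 - q)"
    using lim[OF xy(1)] lim[OF xy(2)] base by linarith
  moreover have "D m \<le> D m / (1 - q)" using q Dnn[of m] by (simp add: field_simps mult_left_le)
  ultimately have "\<bar>\<phi> x - \<phi> y\<bar> \<le> 3 * (D m / (1 - q))" by linarith
  also have "\<dots> = chain_const n * \<beta> powr (1 / n) * (2 powr (- 1 / n)) ^ m"
    by (simp add: chain_const_def D_def q_def)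
  finally show ?thesis .
qed

text \<open>The weighted sum \<open>\<Sum>\<^sub>k 2\<^sup>k \<Sum>\<^sub>i |X((i+1)/2\<^sup>k) - X(i/2\<^sup>k)|\<^sup>n\<close> has expectation at most \<open>\<Sum>\<^sub>k 2\<^sup>k 2\<^sup>k A 2\<^sup>-\<^sup>3\<^sup>k = 2 A\<close>.
Outside the event that it reaches \<open>\<beta>\<close>, whose probability is bounded by Markov's inequality, the
deterministic chaining bound applies to every path.\<close>

lemma kolmogorov_chaining:
  fixes X :: "real \<Rightarrow> 'w \<Rightarrow> real"
  assumes "prob_space M"
    and X: "\<And>u. u \<in> {0..1} \<Longrightarrow> X u \<in> borel_measurable M"
    and cont: "\<And>\<omega>. \<omega> \<in> space M \<Longrightarrow> continuous_on {0..1} (\<lambda>u. X u \<omega>)"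
    and mom: "\<And>u v. u \<in> {0..1} \<Longrightarrow> v \<in> {0..1} \<Longrightarrow> (\<integral>\<^sup>+\<omega>. ennreal (\<bar>X u \<omega> - X v \<omega>\<bar> ^ n) \<partial>M) \<le> ennreal (A * \<bar>u - v\<bar> ^ 3)"
    and A: "A \<ge> 0" and n: "n > 0" and \<beta>: "\<beta> > 0"
  shows "\<exists>E\<in>sets M. measure M E \<le> 2 * A / \<beta> \<and> (\<forall>\<omega>\<in>space M - E. \<forall>m. \<forall>x\<in>{0..1}. \<forall>y\<in>{0..1}. \<bar>x - y\<bar> \<le> 1 / 2 ^ m \<longrightarrow>
     \<bar>X x \<omega> - X y \<omega>\<bar> \<le> chain_const n * \<beta> powr (1 / n) * (2 powr (- 1 / n)) ^ m)"
proof -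
  interpret prob_space M by fact
  define d where "d = (\<lambda>k i \<omega>. ennreal (2 ^ k * \<bar>X (real (Suc i) / 2 ^ k) \<omega> - X (real i / 2 ^ k) \<omega>\<bar> ^ n))"
  define Z where "Z = (\<lambda>\<omega>. \<Sum>k. \<Sum>i<2 ^ k. d k i \<omega>)"
  have in01: "real (Suc i) / 2 ^ k \<in> {0..1}" "real i / 2 ^ k \<in> {0..1}" if "i < 2 ^ k" for i k :: nat
  proof -
    have "real (Suc i) \<le> 2 ^ k" using that by (metis Suc_leI of_nat_le_iff of_nat_numeral of_nat_power)
    moreover have "real i \<le> 2 ^ k" using that by simp
    ultimately show "real (Suc i) / 2 ^ k \<in> {0..1}" "real i / 2 ^ k \<in> {0..1}"
      by (auto simp del: of_nat_Suc)
  qed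
  have dm: "d k i \<in> borel_measurable M" if "i < 2 ^ k" for k i
  proof -
    note X[OF in01(1)[OF that], measurable] X[OF in01(2)[OF that], measurable]
    show ?thesis unfolding d_def by measurable
  qed
  have Zm[measurable]: "Z \<in> borel_measurable M" 
  proof -
    have [measurable]: "(\<lambda>\<omega>. \<Sum>i<2 ^ k. d k i \<omega>) \<in> borel_measurable M" for k
      using dm by (intro borel_measurable_sum) auto
    show ?thesis unfolding Z_def by measurable
  qed
  have "(\<integral>\<^sup>+\<omega>. Z \<omega> \<partial>M) = (\<Sum>k. \<integral>\<^sup>+\<omega>. (\<Sum>i<2 ^ k. d k i \<omega>) \<partial>M)"
    unfolding Z_def using dm by (intro nn_integral_suminf borel_measurable_sum) auto
  also have "\<dots> \<le> (\<Sum>k. ennreal (A * (1/2) ^ k))"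
  proof (intro suminf_le allI)
    fix k
    have "(\<integral>\<^sup>+\<omega>. (\<Sum>i<2 ^ k. d k i \<omega>) \<partial>M) = (\<Sum>i<2 ^ k. \<integral>\<^sup>+\<omega>. d k i \<omega> \<partial>M)"
      using dm by (intro nn_integral_sum) auto
    also have "\<dots> \<le> (\<Sum>i<(2::nat) ^ k. ennreal (2 ^ k * (A * (1 / 2 ^ k) ^ 3)))"
    proof (intro sum_mono)
      fix i :: nat assume "i \<in> {..<2 ^ k}"
      then have i: "i < 2 ^ k" by simp
      note X[OF in01(1)[OF i], measurable] X[OF in01(2)[OF i], measurable]
      have "(\<integral>\<^sup>+\<omega>. d k i \<omega> \<partial>M) = ennreal (2 ^ k) * (\<integral>\<^sup>+\<omega>. ennreal (\<bar>X (real (Suc i) / 2 ^ k) \<omega> - X (real i / 2 ^ k) \<omega>\<bar> ^ n) \<partial>M)"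
        unfolding d_def by (subst nn_integral_cmult[symmetric]) (auto simp: ennreal_mult simp del: of_nat_Suc)
      also have "\<dots> \<le> ennreal (2 ^ k) * ennreal (A * \<bar>real (Suc i) / 2 ^ k - real i / 2 ^ k\<bar> ^ 3)"
        by (intro mult_left_mono mom in01 i) auto
      also have "real (Suc i) / 2 ^ k - real i / 2 ^ k = 1 / 2 ^ k" by (simp flip: diff_divide_distrib)
      also have "ennreal (2 ^ k) * ennreal (A * \<bar>1 / 2 ^ k\<bar> ^ 3) = ennreal (2 ^ k * (A * (1 / 2 ^ k) ^ 3))"
        using A by (subst ennreal_mult[symmetric]) auto
      finally show "(\<integral>\<^sup>+\<omega>. d k i \<omega> \<partial>M) \<le> ennreal (2 ^ k * (A * (1 / 2 ^ k) ^ 3))" .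
    qed
    also have "\<dots> = ennreal (2 ^ k * (2 ^ k * (A * (1 / 2 ^ k) ^ 3)))"
      using A by (simp add: ennreal_mult ennreal_of_nat_eq_real_of_nat)
    also have "2 ^ k * (2 ^ k * (A * (1 / 2 ^ k) ^ 3)) = A * (1/2) ^ k"
      by (simp add: power3_eq_cube power_one_over field_simps)
    finally show "(\<integral>\<^sup>+\<omega>. (\<Sum>i<2 ^ k. d k i \<omega>) \<partial>M) \<le> ennreal (A * (1/2) ^ k)" .
  qed auto
  also have "\<dots> = ennreal (2 * A)"
  proof -
    have "(\<lambda>k. A * (1/2::real) ^ k) sums (A * (1 / (1 - 1/2)))" by (intro sums_mult geometric_sums) auto
    then show ?thesis using A by (intro suminf_ennreal_eq) (auto simp: mult.commute)
  qed
  finally have EZ: "(\<integral>\<^sup>+\<omega>. Z \<omega> \<partial>M) \<le> ennreal (2 * A)" .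
  define E where "E = {\<omega> \<in> space M. ennreal \<beta> \<le> Z \<omega>}"
  have E: "E \<in> sets M" unfolding E_def by measurable
  have "emeasure M E \<le> ennreal (1 / \<beta>) * (\<integral>\<^sup>+\<omega>. Z \<omega> * indicator (space M) \<omega> \<partial>M)"
  proof -
    have "E = {\<omega> \<in> space M. 1 \<le> ennreal (1 / \<beta>) * Z \<omega>}"
    proof -
      have "ennreal \<beta> \<le> Z \<omega> \<longleftrightarrow> 1 \<le> ennreal (1 / \<beta>) * Z \<omega>" for \<omega>
      proof -
        have 1: "ennreal (1 / \<beta>) * ennreal \<beta> = 1" using \<beta> by (simp flip: ennreal_mult)
        show ?thesis
        proof
          assume "ennreal \<beta> \<le> Z \<omega>"
          then have "ennreal (1 / \<beta>) * ennreal \<beta> \<le> ennreal (1 / \<beta>) * Z \<omega>" by (rule mult_left_mono) simp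
          then show "1 \<le> ennreal (1 / \<beta>) * Z \<omega>" using 1 by simp
        next
          assume "1 \<le> ennreal (1 / \<beta>) * Z \<omega>"
          then have "ennreal \<beta> * 1 \<le> ennreal \<beta> * (ennreal (1 / \<beta>) * Z \<omega>)" by (rule mult_left_mono) simp
          moreover have "ennreal \<beta> * (ennreal (1 / \<beta>) * Z \<omega>) = (ennreal (1 / \<beta>) * ennreal \<beta>) * Z \<omega>"
            by (simp only: mult_ac)
          ultimately show "ennreal \<beta> \<le> Z \<omega>" unfolding 1 by simp
        qed
      qed
      then show ?thesis unfolding E_def by auto
    qed
    moreover have "emeasure M ({\<omega> \<in> space M. 1 \<le> ennreal (1 / \<beta>) * Z \<omega>}) \<le> ennreal (1 / \<beta>) * (\<integral>\<^sup>+\<omega>. Z \<omega> * indicator (space M) \<omega> \<partial>M)"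
      by (rule nn_integral_Markov_inequality) auto
    ultimately show ?thesis by simp
  qed
  also have "(\<integral>\<^sup>+\<omega>. Z \<omega> * indicator (space M) \<omega> \<partial>M) = (\<integral>\<^sup>+\<omega>. Z \<omega> \<partial>M)"
    by (intro nn_integral_cong) auto
  also have "ennreal (1 / \<beta>) * \<dots> \<le> ennreal (1 / \<beta>) * ennreal (2 * A)" by (intro mult_left_mono EZ) auto
  also have "\<dots> = ennreal (2 * A / \<beta>)" using A \<beta> by (subst ennreal_mult[symmetric]) auto
  finally have "measure M E \<le> 2 * A / \<beta>" using A \<beta> by (simp add: emeasure_eq_measure)
  moreover have "\<bar>X x \<omega> - X y \<omega>\<bar> \<le> chain_const n * \<beta> powr (1 / n) * (2 powr (- 1 / n)) ^ m"
    if \<omega>: "\<omega> \<in> space M - E" and xy: "x \<in> {0..1}" "y \<in> {0..1}" "\<bar>x - y\<bar> \<le> 1 / 2 ^ m" for \<omega> m x y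
  proof (rule dyadic_chaining[OF cont n \<beta> _ xy])
    show "\<omega> \<in> space M" using \<omega> by simp
    fix k i :: nat assume i: "i < 2 ^ k"
    have "d k i \<omega> \<le> (\<Sum>i<2 ^ k. d k i \<omega>)" using i by (intro member_le_sum) auto
    also have "\<dots> \<le> Z \<omega>" unfolding Z_def using sum_le_suminf[of "\<lambda>k. \<Sum>i<2 ^ k. d k i \<omega>" "{k}"] by simp
    also have "\<dots> \<le> ennreal \<beta>" using \<omega> unfolding E_def by auto
    finally show "2 ^ k * \<bar>X (real (Suc i) / 2 ^ k) \<omega> - X (real i / 2 ^ k) \<omega>\<bar> ^ n \<le> \<beta>"
      unfolding d_def using \<beta> by (subst (asm) ennreal_le_iff) auto
  qed
  ultimately show ?thesis using E by blast
qed

section \<open>Uniform approximation of local times\<close>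

text \<open>Outside a single null set, the local time at every rational time is the limit of mollified occupation
densities, which increase in time. Continuity in time extends this to all times.\<close>

lemma local_time_monotone:
  assumes B: "fractional_brownian_motion H M B" and L: "local_time M B L" and J: "jointly_continuous M L"
  shows "AE \<omega> in M. \<forall>x s t. 0 \<le> s \<and> s \<le> t \<longrightarrow> L x s \<omega> \<le> L x t \<omega>"
proof -
  define e where "e = (\<lambda>k. 1 / real (Suc k))"
  have e: "e k > 0" for k by (simp add: e_def)
  have e0: "e \<longlonglongrightarrow> 0" unfolding e_def using LIMSEQ_inverse_real_of_nat by (simp add: inverse_eq_divide)
  define Qs where "Qs = \<rat> \<inter> {0::real..}"
  have "countable Qs" unfolding Qs_def using countable_rat by (rule countable_Int1)
  then have "AE \<omega> in M. \<forall>p\<in>Qs. \<forall>k x. integral {0..p} (\<lambda>r. tri (e k) (B (max 0 r) \<omega> - x)) = (LBINT z. tri (e k) (z - x) * L z p \<omega>)"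
  proof (rule AE_ball_countable'[rotated])
    fix p assume "p \<in> Qs"
    then have "0 \<le> p" by (simp add: Qs_def)
    then show "AE \<omega> in M. \<forall>k x. integral {0..p} (\<lambda>r. tri (e k) (B (max 0 r) \<omega> - x)) = (LBINT z. tri (e k) (z - x) * L z p \<omega>)"
      unfolding AE_all_countable by (intro allI local_time_mollified[OF B L e])
  qed
  then show ?thesis using AE_space
  proof eventually_elim
    case (elim \<omega>)
    have mono_Q: "L x p \<omega> \<le> L x q \<omega>" if "p \<in> Qs" "q \<in> Qs" "p \<le> q" for x p q
    proof (rule LIMSEQ_le)
      have nn: "0 \<le> p" "0 \<le> q" using that by (auto simp: Qs_def)
      show "(\<lambda>k. LBINT z. tri (e k) (z - x) * L z p \<omega>) \<longlonglongrightarrow> L x p \<omega>" "(\<lambda>k. LBINT z. tri (e k) (z - x) * L z q \<omega>) \<longlonglongrightarrow> L x q \<omega>"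
        using jointly_continuous_section[OF J elim(2)] nn by (auto intro!: mollify_tendsto e e0)
      show "\<exists>N. \<forall>k\<ge>N. (LBINT z. tri (e k) (z - x) * L z p \<omega>) \<le> (LBINT z. tri (e k) (z - x) * L z q \<omega>)"
      proof (intro exI[of _ 0] allI impI)
        fix k
        have io: "(\<lambda>r. tri (e k) (B (max 0 r) \<omega> - x)) integrable_on {0..u}" for u
          by (intro integrable_continuous_interval tri_continuous continuous_intros continuous_on_subset[OF fbm_path_continuous[OF B elim(2)]]) auto
        have "integral {0..p} (\<lambda>r. tri (e k) (B (max 0 r) \<omega> - x)) \<le> integral {0..q} (\<lambda>r. tri (e k) (B (max 0 r) \<omega> - x))"
          using that by (intro integral_subset_le io) (auto simp: tri_nonneg)
        then show "(LBINT z. tri (e k) (z - x) * L z p \<omega>) \<le> (LBINT z. tri (e k) (z - x) * L z q \<omega>)"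
          using elim(1) that by simp
      qed
    qed
    show ?case
    proof (intro allI impI, elim conjE)
      fix x s t :: real assume st: "0 \<le> s" "s \<le> t"
      define a where "a = (\<lambda>u k. real_of_int \<lfloor>real (Suc k) * u\<rfloor> / real (Suc k))"
      have aQ: "a u k \<in> Qs" if "0 \<le> u" for u k
        unfolding a_def Qs_def using that by auto
      have lim: "(\<lambda>k. L x (a u k) \<omega>) \<longlonglongrightarrow> L x u \<omega>" if "0 \<le> u" for u
      proof -
        have c: "continuous_on {0..} (\<lambda>t. L x t \<omega>)"
        proof -
          have "continuous_on (UNIV \<times> {0..}) (\<lambda>(x, t). L x t \<omega>)" using J elim(2) by (simp add: jointly_continuous_def)
          then have "continuous_on {0..} ((\<lambda>(x, t). L x t \<omega>) \<circ> (\<lambda>t. (x, t)))"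
            by (intro continuous_on_compose continuous_intros) (auto elim: continuous_on_subset)
          then show ?thesis by (simp add: comp_def)
        qed
        have "a u \<longlonglongrightarrow> u" unfolding a_def by (rule floor_fraction_tendsto)
        then show ?thesis using aQ[OF that] that
          by (intro continuous_on_tendsto_compose[OF c]) (auto simp: Qs_def)
      qed
      show "L x s \<omega> \<le> L x t \<omega>"
      proof (rule LIMSEQ_le[OF lim lim])
        show "\<exists>N. \<forall>k\<ge>N. L x (a s k) \<omega> \<le> L x (a t k) \<omega>"
        proof (intro exI[of _ 0] allI impI mono_Q aQ)
          fix k show "a s k \<le> a t k" unfolding a_def using st
            by (intro divide_right_mono of_int_le_iff[THEN iffD2] floor_mono mult_left_mono) auto
        qed (use st in auto)
      qed (use st in auto)
    qed
  qed
qed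

lemma local_time_zero:
  assumes B: "fractional_brownian_motion H M B" and L: "local_time M B L" and J: "jointly_continuous M L"
  shows "AE \<omega> in M. \<forall>x. L x 0 \<omega> = 0"
proof -
  define e where "e = (\<lambda>k. 1 / real (Suc k))"
  have e: "e k > 0" for k by (simp add: e_def)
  have e0: "e \<longlonglongrightarrow> 0" unfolding e_def using LIMSEQ_inverse_real_of_nat by (simp add: inverse_eq_divide)
  have "AE \<omega> in M. \<forall>k x. integral {0..0} (\<lambda>r. tri (e k) (B (max 0 r) \<omega> - x)) = (LBINT z. tri (e k) (z - x) * L z 0 \<omega>)"
    unfolding AE_all_countable by (intro allI local_time_mollified[OF B L e]) auto
  then show ?thesis using AE_space
  proof eventually_elim
    case (elim \<omega>)
    show ?case
    proof
      fix x
      have "(\<lambda>k. LBINT z. tri (e k) (z - x) * L z 0 \<omega>) \<longlonglongrightarrow> L x 0 \<omega>"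
        using jointly_continuous_section[OF J elim(2), of 0] by (intro mollify_tendsto e e0) auto
      moreover have "(LBINT z. tri (e k) (z - x) * L z 0 \<omega>) = 0" for k
        using elim(1)[rule_format, of k x] by simp
      ultimately show "L x 0 \<omega> = 0" by (simp add: LIMSEQ_const_iff)
    qed
  qed
qed

lemma local_time_total_mass:
  assumes B: "fractional_brownian_motion H M B" and L: "local_time M B L" and t: "0 \<le> t"
  shows "AE \<omega> in M. integrable lborel (\<lambda>x. L x t \<omega>) \<and> (LBINT x. L x t \<omega>) = t"
proof -
  have "AE \<omega> in M. is_lebesgue_density (occupation_measure (\<lambda>s. B s \<omega>) t) (\<lambda>x. L x t \<omega>)"
    using L t by (simp add: local_time_def)
  then show ?thesis using AE_space
  proof eventually_elim
    case (elim \<omega>)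
    show ?case using occupation_density_bounds[OF elim(1) t fbm_path_continuous[OF B elim(2)]] by auto
  qed
qed

text \<open>Used for the increment of the local time over a short time interval: its total mass is the length of
the interval, so it is small somewhere, and the modulus of continuity then makes it small everywhere.\<close>

lemma exists_le_average:
  fixes f :: "real \<Rightarrow> real"
  assumes "integrable lborel f" "(LBINT x. f x) \<le> c" "\<And>x. 0 \<le> f x" "R > 0"
  shows "\<exists>x\<in>{-R..R}. f x \<le> c / R"
proof (rule ccontr)
  assume "\<not> ?thesis"
  then have gt: "\<And>x. x \<in> {-R..R} \<Longrightarrow> c / R < f x" by force
  have If: "0 \<le> (LBINT x. f x)" using assms(3) by (intro Bochner_Integration.integral_nonneg) auto
  have c0: "0 \<le> c" using assms(2) If by linarith
  have fR: "f R > c / R" using gt[of R] assms(4) by auto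
  have ii: "integrable lborel (\<lambda>x. indicator {-R..R} x * (c / R))"
    by (intro integrable_mult_left integrable_real_indicator) (auto simp: emeasure_lborel_Icc_eq)
  have "(LBINT x. indicator {-R..R} x * (c / R)) \<le> (LBINT x. f x)"
    using gt assms(3) by (intro integral_mono ii assms(1)) (auto simp: indicator_def intro: less_imp_le)
  moreover have "(LBINT x. indicator {-R..R} x * (c / R)) = 2 * c" using assms(4) by simp
  ultimately have "c = 0" using assms(2) c0 by linarith
  then have "(LBINT x. f x) = 0" using assms(2) If by linarith
  then have "AE x in lborel. f x = 0" using integral_nonneg_eq_0_iff_AE[OF assms(1)] assms(3) by auto
  then have "AE x in lborel. x \<notin> {-R..R}" 
  proof eventually_elim
    case (elim x)
    then show ?case using gt[of x] \<open>c = 0\<close> by auto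
  qed
  then have "emeasure lborel {-R..R} = 0"
    using AE_iff_measurable[of "{-R..R}" lborel "\<lambda>x. x \<notin> {-R..R}"] by (simp del: atLeastAtMost_iff)
  then show False using assms(4) by simp
qed

text \<open>Rescaling of \<open>[-R, R]\<close> to the unit interval turns the moment bound into the hypothesis of the chaining
lemma.\<close>

lemma local_time_increment_modulus:
  assumes "prob_space M" and meas: "\<And>x t. 0 \<le> t \<Longrightarrow> L x t \<in> borel_measurable M"
    and J: "jointly_continuous M L" and st: "0 \<le> s" "s \<le> t"
    and mom: "\<And>x y. (\<integral>\<^sup>+\<omega>. ennreal (\<bar>(L x t \<omega> - L x s \<omega>) - (L y t \<omega> - L y s \<omega>)\<bar> ^ n) \<partial>M) \<le> ennreal (C * \<bar>x - y\<bar> ^ 3 * (t - s)\<^sup>2)"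
    and C: "C > 0" and R: "R > 0" and n: "n > 0" and \<beta>: "\<beta> > 0"
  shows "\<exists>E\<in>sets M. measure M E \<le> 2 * C * (2 * R) ^ 3 * (t - s)\<^sup>2 / \<beta> \<and>
    (\<forall>\<omega>\<in>space M - E. \<forall>m. \<forall>x\<in>{-R..R}. \<forall>y\<in>{-R..R}. \<bar>x - y\<bar> \<le> 2 * R / 2 ^ m \<longrightarrow>
     \<bar>(L x t \<omega> - L x s \<omega>) - (L y t \<omega> - L y s \<omega>)\<bar> \<le> chain_const n * \<beta> powr (1 / n) * (2 powr (- 1 / n)) ^ m)"
proof -
  define X where "X = (\<lambda>u \<omega>. L (- R + 2 * R * u) t \<omega> - L (- R + 2 * R * u) s \<omega>)"
  have "\<exists>E\<in>sets M. measure M E \<le> 2 * (C * (2 * R) ^ 3 * (t - s)\<^sup>2) / \<beta> \<and> (\<forall>\<omega>\<in>space M - E. \<forall>m. \<forall>x\<in>{0..1}. \<forall>y\<in>{0..1}. \<bar>x - y\<bar> \<le> 1 / 2 ^ m \<longrightarrow>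
     \<bar>X x \<omega> - X y \<omega>\<bar> \<le> chain_const n * \<beta> powr (1 / n) * (2 powr (- 1 / n)) ^ m)"
  proof (rule kolmogorov_chaining[OF assms(1) _ _ _ _ n \<beta>])
    show "X u \<in> borel_measurable M" for u
    proof -
      have "0 \<le> t" using st by simp
      note meas[OF st(1), measurable] meas[OF this, measurable]
      show ?thesis unfolding X_def by measurable
    qed
    show "continuous_on {0..1} (\<lambda>u. X u \<omega>)" if "\<omega> \<in> space M" for \<omega>
    proof -
      have c: "continuous_on UNIV (\<lambda>x. L x p \<omega>)" if "0 \<le> p" for p
        using jointly_continuous_section[OF J \<open>\<omega> \<in> space M\<close> that] .
      have "continuous_on {0..1} (\<lambda>u. L (- R + 2 * R * u) p \<omega>)" if "0 \<le> p" for p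
        by (rule continuous_on_compose2[OF c[OF that], where f = "\<lambda>u. - R + 2 * R * u"]) (auto intro!: continuous_intros)
      then show ?thesis unfolding X_def using st by (simp add: continuous_on_diff)
    qed
    show "(\<integral>\<^sup>+\<omega>. ennreal (\<bar>X u \<omega> - X v \<omega>\<bar> ^ n) \<partial>M) \<le> ennreal (C * (2 * R) ^ 3 * (t - s)\<^sup>2 * \<bar>u - v\<bar> ^ 3)" for u v
    proof -
      have "(- R + 2 * R * u) - (- R + 2 * R * v) = (2 * R) * (u - v)" by (simp add: algebra_simps)
      then have "\<bar>(- R + 2 * R * u) - (- R + 2 * R * v)\<bar> ^ 3 = (2 * R) ^ 3 * \<bar>u - v\<bar> ^ 3"
        using R by (simp only: abs_mult power_mult_distrib)
      then show ?thesis using mom[of "- R + 2 * R * u" "- R + 2 * R * v"] unfolding X_def by (simp add: mult_ac)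
    qed
    show "0 \<le> C * (2 * R) ^ 3 * (t - s)\<^sup>2" using C R by simp
  qed
  then obtain E where E: "E \<in> sets M" "measure M E \<le> 2 * (C * (2 * R) ^ 3 * (t - s)\<^sup>2) / \<beta>"
    and mod: "\<And>\<omega> m x y. \<omega> \<in> space M - E \<Longrightarrow> x \<in> {0..1} \<Longrightarrow> y \<in> {0..1} \<Longrightarrow> \<bar>x - y\<bar> \<le> 1 / 2 ^ m \<Longrightarrow>
      \<bar>X x \<omega> - X y \<omega>\<bar> \<le> chain_const n * \<beta> powr (1 / n) * (2 powr (- 1 / n)) ^ m" by blast
  show ?thesis
  proof (intro bexI[OF _ E(1)] conjI ballI allI impI)
    show "measure M E \<le> 2 * C * (2 * R) ^ 3 * (t - s)\<^sup>2 / \<beta>" using E(2) by (simp add: mult.assoc)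
    fix \<omega> m x y assume \<omega>: "\<omega> \<in> space M - E" and xy: "x \<in> {-R..R}" "y \<in> {-R..R}" "\<bar>x - y\<bar> \<le> 2 * R / 2 ^ m"
    define u where "u = (\<lambda>z. (z + R) / (2 * R))"
    have inv: "- R + 2 * R * u z = z" for z using R by (simp add: u_def)
    have "\<bar>u x - u y\<bar> = \<bar>x - y\<bar> / (2 * R)" using R by (simp add: u_def abs_divide flip: diff_divide_distrib)
    also have "\<dots> \<le> (2 * R / 2 ^ m) / (2 * R)" using R xy by (intro divide_right_mono) auto
    also have "\<dots> = 1 / 2 ^ m" using R by simp
    finally have "\<bar>X (u x) \<omega> - X (u y) \<omega>\<bar> \<le> chain_const n * \<beta> powr (1 / n) * (2 powr (- 1 / n)) ^ m"
      using xy R by (intro mod[OF \<omega>]) (auto simp: u_def divide_simps)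
    then show "\<bar>(L x t \<omega> - L x s \<omega>) - (L y t \<omega> - L y s \<omega>)\<bar> \<le> chain_const n * \<beta> powr (1 / n) * (2 powr (- 1 / n)) ^ m"
      unfolding X_def inv .
  qed
qed

lemma grid_cell_exists:
  fixes t T :: real
  assumes "0 \<le> t" "t \<le> T" "0 < T" "N > (0::nat)"
  shows "\<exists>i<N. real i * T / N \<le> t \<and> t \<le> real (Suc i) * T / N"
proof -
  define i where "i = nat (\<lceil>t * N / T\<rceil> - 1)"
  have x: "0 \<le> t * N / T" "t * N / T \<le> N" using assms by (auto simp: field_simps)
  have "i < N" unfolding i_def using x assms(4) by linarith
  moreover have "real i \<le> t * N / T" unfolding i_def using x by linarith
  then have "real i * T / N \<le> t" using assms by (simp add: field_simps)
  moreover have "t * N / T \<le> real (Suc i)" unfolding i_def using x by linarith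
  then have "t \<le> real (Suc i) * T / N" using assms by (simp add: field_simps)
  ultimately show ?thesis by blast
qed

text \<open>Between two grid times both the local time and its mollification are monotone, so their difference is
at most the difference at a grid time plus the increment of the local time over the cell. The \<open>N\<close> cell
increments are small together, because each exceptional event has probability of order \<open>N\<^sup>-\<^sup>2\<close>. With
\<open>N\<close> fixed, the modulus of continuity at the \<open>N + 1\<close> grid times determines \<open>\<epsilon>\<close>.\<close>

lemma local_time_uniform_approximation:
  fixes a b D T \<eta> :: real
  assumes ab: "0 < a" "a \<le> b" "b < 1" and D: "D > 0" and T: "T > 0" and \<eta>: "\<eta> > 0"
  obtains \<epsilon> where "\<epsilon> > 0"
    and "\<And>H (M :: 'w measure) B L. a \<le> H \<Longrightarrow> H \<le> b \<Longrightarrow> fractional_brownian_motion H M B \<Longrightarrow>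
       local_time M B L \<Longrightarrow> jointly_continuous M L \<Longrightarrow>
       \<exists>E\<in>sets M. measure M E \<le> \<eta> \<and> (\<forall>\<omega>\<in>space M - E. \<forall>x\<in>{-D..D}. \<forall>t\<in>{0..T}.
         \<bar>integral {0..t} (\<lambda>r. tri \<epsilon> (B (max 0 r) \<omega> - x)) - L x t \<omega>\<bar> \<le> \<eta>)"
proof -
  \<comment> \<open>even, and large enough for \<open>n (1 - b) \<ge> 8 \<ge> 2 + 6 b\<close>\<close>
  define n where "n = 2 * nat \<lceil>8 / (1 - b)\<rceil> + 4"
  have n3: "n \<ge> 3" and n_even: "even n" and n0: "n > 0" by (auto simp: n_def)
  have n_large: "2 + 6 * b \<le> n * (1 - b)"
  proof -
    have "8 / (1 - b) \<le> real n" unfolding n_def by linarith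
    then have "8 \<le> real n * (1 - b)" using ab by (simp add: field_simps)
    then show ?thesis using ab by linarith
  qed
  define T1 where "T1 = max 1 T"
  have T1: "1 \<le> T1" "T \<le> T1" by (auto simp: T1_def)
  show thesis
  proof (rule local_time_increment_moment[OF ab T1(1) n3 n_even n_large, where 'w = 'w])
    fix C :: real
    assume C: "C > 0" and mom: "\<And>H (M :: 'w measure) B L s t x y. a \<le> H \<Longrightarrow> H \<le> b \<Longrightarrow> fractional_brownian_motion H M B \<Longrightarrow>
       local_time M B L \<Longrightarrow> jointly_continuous M L \<Longrightarrow> 0 \<le> s \<Longrightarrow> s \<le> t \<Longrightarrow> t \<le> T1 \<Longrightarrow>
      (\<integral>\<^sup>+\<omega>. ennreal (\<bar>(L x t \<omega> - L x s \<omega>) - (L y t \<omega> - L y s \<omega>)\<bar> ^ n) \<partial>M) \<le> ennreal (C * \<bar>x - y\<bar> ^ 3 * (t - s)\<^sup>2)"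
    define R where "R = D + 1"
    have R: "R > 0" using D by (simp add: R_def)
    define K where "K = chain_const n"
    have K: "K > 0" unfolding K_def using n0 by (rule chain_const_pos)
    define q :: real where "q = 2 powr (- 1 / n)"
    have q: "0 < q" "q < 1" unfolding q_def using chain_ratio[OF n0] by auto
    \<comment> \<open>the chaining level at which cell increments oscillate by at most \<open>\<eta> / 8\<close> over \<open>[-R, R]\<close>\<close>
    define \<beta>1 where "\<beta>1 = (\<eta> / (8 * K)) ^ n"
    have \<beta>1: "\<beta>1 > 0" unfolding \<beta>1_def using \<eta> K by simp
    have K\<beta>1: "K * \<beta>1 powr (1 / n) = \<eta> / 8"
    proof -
      have "\<beta>1 powr (1 / n) = \<eta> / (8 * K)" unfolding \<beta>1_def using \<eta> K n0
        by (simp add: powr_powr flip: powr_realpow)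
      then show ?thesis using K by simp
    qed
    define c1 where "c1 = 2 * C * (2 * R) ^ 3 * T\<^sup>2"
    have c1: "c1 > 0" unfolding c1_def using C R T by simp
    obtain N :: nat where N: "real N > max (2 * c1 / (\<eta> * \<beta>1)) (8 * T / (\<eta> * R))" using reals_Archimedean2 by blast
    have N1: "c1 / (N * \<beta>1) \<le> \<eta> / 2" and N2: "T / (N * R) \<le> \<eta> / 8" and N0: "N > 0"
    proof -
      have "0 < 2 * c1 / (\<eta> * \<beta>1)" using c1 \<eta> \<beta>1 by simp
      then have "0 < real N" using N by linarith
      then show "N > 0" by simp
      show "c1 / (N * \<beta>1) \<le> \<eta> / 2" "T / (N * R) \<le> \<eta> / 8"
        using N \<open>0 < real N\<close> \<eta> \<beta>1 R by (simp_all add: field_simps)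
    qed
    \<comment> \<open>the chaining level that the \<open>N + 1\<close> grid times exceed with total probability at most \<open>\<eta> / 2\<close>\<close>
    define \<beta>2 where "\<beta>2 = 2 * (real N + 1) * c1 / \<eta>"
    have \<beta>2: "\<beta>2 > 0" unfolding \<beta>2_def using c1 \<eta> by simp
    obtain m where m: "K * \<beta>2 powr (1 / n) * q ^ m \<le> \<eta> / 4"
    proof -
      have pos: "0 < \<eta> / 4 / (K * \<beta>2 powr (1 / n))" using \<eta> K \<beta>2 by simp
      obtain m where "q ^ m < \<eta> / 4 / (K * \<beta>2 powr (1 / n))" using real_arch_pow_inv[OF pos q(2)] by blast
      then have "K * \<beta>2 powr (1 / n) * q ^ m \<le> \<eta> / 4"
        using K \<beta>2 by (simp add: field_simps)
      then show ?thesis by (rule that)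
    qed
    define \<epsilon> where "\<epsilon> = min 1 (2 * R / 2 ^ m)"
    have \<epsilon>: "\<epsilon> > 0" "\<epsilon> \<le> 1" "\<epsilon> \<le> 2 * R / 2 ^ m" unfolding \<epsilon>_def using R by auto
    define tt where "tt = (\<lambda>i::nat. real i * T / N)"
    have tt0: "0 \<le> tt i" for i unfolding tt_def using T by simp
    have tt_le: "tt i \<le> T" if "i \<le> N" for i unfolding tt_def using that T N0 by (simp add: field_simps)
    have tt_mono: "tt i \<le> tt (Suc i)" for i unfolding tt_def using T by (intro divide_right_mono mult_right_mono) auto
    have tt_diff: "tt (Suc i) - tt i = T / N" for i unfolding tt_def by (simp add: algebra_simps add_divide_distrib)
    show thesis
    proof (rule that[OF \<epsilon>(1)])
      fix H :: real and M :: "'w measure" and B L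
      assume H: "a \<le> H" "H \<le> b" and B: "fractional_brownian_motion H M B" and L: "local_time M B L" and J: "jointly_continuous M L"
      interpret prob_space M by (rule fbm_prob_space[OF B])
      have meas: "L x t \<in> borel_measurable M" if "0 \<le> t" for x t using L that by (simp add: local_time_def)
      have "\<exists>E\<in>sets M. measure M E \<le> 2 * C * (2 * R) ^ 3 * (tt (Suc i) - tt i)\<^sup>2 / \<beta>1 \<and>
        (\<forall>\<omega>\<in>space M - E. \<forall>m. \<forall>x\<in>{-R..R}. \<forall>y\<in>{-R..R}. \<bar>x - y\<bar> \<le> 2 * R / 2 ^ m \<longrightarrow>
         \<bar>(L x (tt (Suc i)) \<omega> - L x (tt i) \<omega>) - (L y (tt (Suc i)) \<omega> - L y (tt i) \<omega>)\<bar> \<le> K * \<beta>1 powr (1 / n) * q ^ m)" if "i < N" for i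
        unfolding K_def q_def using that tt_le[of "Suc i"] T1
        by (intro local_time_increment_modulus[OF prob_space_axioms meas J tt0 tt_mono _ C R n0 \<beta>1] mom[OF H B L J tt0 tt_mono]) auto
      then obtain E1 where E1: "\<And>i. i < N \<Longrightarrow> E1 i \<in> sets M" "\<And>i. i < N \<Longrightarrow> measure M (E1 i) \<le> 2 * C * (2 * R) ^ 3 * (tt (Suc i) - tt i)\<^sup>2 / \<beta>1"
        "\<And>i \<omega> m x y. i < N \<Longrightarrow> \<omega> \<in> space M - E1 i \<Longrightarrow> x \<in> {-R..R} \<Longrightarrow> y \<in> {-R..R} \<Longrightarrow> \<bar>x - y\<bar> \<le> 2 * R / 2 ^ m \<Longrightarrow>
         \<bar>(L x (tt (Suc i)) \<omega> - L x (tt i) \<omega>) - (L y (tt (Suc i)) \<omega> - L y (tt i) \<omega>)\<bar> \<le> K * \<beta>1 powr (1 / n) * q ^ m"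
        by metis
      have "\<exists>E\<in>sets M. measure M E \<le> 2 * C * (2 * R) ^ 3 * (tt i - 0)\<^sup>2 / \<beta>2 \<and>
        (\<forall>\<omega>\<in>space M - E. \<forall>m. \<forall>x\<in>{-R..R}. \<forall>y\<in>{-R..R}. \<bar>x - y\<bar> \<le> 2 * R / 2 ^ m \<longrightarrow>
         \<bar>(L x (tt i) \<omega> - L x 0 \<omega>) - (L y (tt i) \<omega> - L y 0 \<omega>)\<bar> \<le> K * \<beta>2 powr (1 / n) * q ^ m)" if "i \<le> N" for i
        unfolding K_def q_def using that tt_le[of i] T1
        by (intro local_time_increment_modulus[OF prob_space_axioms meas J _ tt0 _ C R n0 \<beta>2] mom[OF H B L J _ tt0]) auto
      then obtain E2 where E2: "\<And>i. i \<le> N \<Longrightarrow> E2 i \<in> sets M" "\<And>i. i \<le> N \<Longrightarrow> measure M (E2 i) \<le> 2 * C * (2 * R) ^ 3 * (tt i - 0)\<^sup>2 / \<beta>2"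
        "\<And>i \<omega> m x y. i \<le> N \<Longrightarrow> \<omega> \<in> space M - E2 i \<Longrightarrow> x \<in> {-R..R} \<Longrightarrow> y \<in> {-R..R} \<Longrightarrow> \<bar>x - y\<bar> \<le> 2 * R / 2 ^ m \<Longrightarrow>
         \<bar>(L x (tt i) \<omega> - L x 0 \<omega>) - (L y (tt i) \<omega> - L y 0 \<omega>)\<bar> \<le> K * \<beta>2 powr (1 / n) * q ^ m"
        by metis
      define regular where "regular = (\<lambda>\<omega>. (\<forall>x s t. 0 \<le> s \<and> s \<le> t \<longrightarrow> L x s \<omega> \<le> L x t \<omega>) \<and> (\<forall>x. L x 0 \<omega> = 0) \<and>
        (\<forall>i. integrable lborel (\<lambda>x. L x (tt i) \<omega>) \<and> (LBINT x. L x (tt i) \<omega>) = tt i) \<and>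
        (\<forall>i x. integral {0..tt i} (\<lambda>r. tri \<epsilon> (B (max 0 r) \<omega> - x)) = (LBINT z. tri \<epsilon> (z - x) * L z (tt i) \<omega>)))"
      have "AE \<omega> in M. regular \<omega>" unfolding regular_def
        by (intro AE_conjI AE_all_countable[THEN iffD2] allI local_time_monotone[OF B L J] local_time_zero[OF B L J]
            local_time_total_mass[OF B L tt0] local_time_mollified[OF B L \<epsilon>(1) tt0])
      then obtain N0 where N0': "{\<omega> \<in> space M. \<not> regular \<omega>} \<subseteq> N0"
        "emeasure M N0 = 0" "N0 \<in> sets M" by (rule AE_E)
      define E where "E = N0 \<union> (\<Union>i\<in>{..<N}. E1 i) \<union> (\<Union>i\<in>{..N}. E2 i)"
      show "\<exists>E\<in>sets M. measure M E \<le> \<eta> \<and> (\<forall>\<omega>\<in>space M - E. \<forall>x\<in>{-D..D}. \<forall>t\<in>{0..T}.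
         \<bar>integral {0..t} (\<lambda>r. tri \<epsilon> (B (max 0 r) \<omega> - x)) - L x t \<omega>\<bar> \<le> \<eta>)"
      proof (intro bexI conjI ballI)
        show Es: "E \<in> sets M" unfolding E_def using N0'(3) E1(1) E2(1) by auto
        have U1: "measure M (\<Union>i\<in>{..<N}. E1 i) \<le> \<eta> / 2"
        proof -
          have "measure M (\<Union>i\<in>{..<N}. E1 i) \<le> (\<Sum>i\<in>{..<N}. measure M (E1 i))"
            using E1(1) by (intro measure_UNION_le) auto
          also have "\<dots> \<le> (\<Sum>i\<in>{..<N}. c1 / (real N)\<^sup>2 / \<beta>1)"
            using E1(2) unfolding tt_diff c1_def by (intro sum_mono) (simp add: power_divide)
          also have "\<dots> = c1 / (N * \<beta>1)" using N0 by (simp add: power2_eq_square)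
          also have "\<dots> \<le> \<eta> / 2" by (rule N1)
          finally show ?thesis .
        qed
        have U2: "measure M (\<Union>i\<in>{..N}. E2 i) \<le> \<eta> / 2"
        proof -
          have "measure M (\<Union>i\<in>{..N}. E2 i) \<le> (\<Sum>i\<in>{..N}. measure M (E2 i))"
            using E2(1) by (intro measure_UNION_le) auto
          also have "\<dots> \<le> (\<Sum>i\<in>{..N}. c1 / \<beta>2)"
          proof (intro sum_mono)
            fix i assume i: "i \<in> {..N}"
            have "measure M (E2 i) \<le> 2 * C * (2 * R) ^ 3 * (tt i)\<^sup>2 / \<beta>2" using E2(2)[of i] i by simp
            also have "\<dots> \<le> c1 / \<beta>2" unfolding c1_def using C R \<beta>2 tt0[of i] tt_le[of i] i
              by (intro divide_right_mono mult_left_mono power_mono) auto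
            finally show "measure M (E2 i) \<le> c1 / \<beta>2" .
          qed
          also have "\<dots> = \<eta> / 2"
          proof -
            have "real N + 1 \<noteq> 0" by linarith
            then show ?thesis unfolding \<beta>2_def using c1 \<eta> by (simp add: divide_simps)
          qed
          finally show ?thesis .
        qed
        have "measure M E \<le> measure M N0 + measure M (\<Union>i\<in>{..<N}. E1 i) + measure M (\<Union>i\<in>{..N}. E2 i)"
          unfolding E_def using N0'(3) E1(1) E2(1)
          by (intro order_trans[OF measure_Un_le] add_mono measure_Un_le) auto
        also have "measure M N0 = 0" using N0'(2) by (simp add: measure_def)
        finally show "measure M E \<le> \<eta>" using U1 U2 by linarith
        fix \<omega> x t assume \<omega>: "\<omega> \<in> space M - E" and x: "x \<in> {-D..D}" and t: "t \<in> {0..T}"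
        have reg: "regular \<omega>" using N0'(1) \<omega> unfolding E_def by blast
        note good = reg[unfolded regular_def, THEN conjunct1] reg[unfolded regular_def, THEN conjunct2, THEN conjunct1]
          reg[unfolded regular_def, THEN conjunct2, THEN conjunct2, THEN conjunct1]
          reg[unfolded regular_def, THEN conjunct2, THEN conjunct2, THEN conjunct2]
        have \<omega>s: "\<omega> \<in> space M" using \<omega> by simp
        have xR: "x \<in> {-R..R}" using x by (auto simp: R_def)
        \<comment> \<open>small at some level, by the total mass \<open>T / N\<close>, and oscillating little\<close>
        have inc: "L x (tt (Suc i)) \<omega> - L x (tt i) \<omega> \<le> \<eta> / 4" if i: "i < N" for i
        proof -
          have "\<exists>x0\<in>{-R..R}. L x0 (tt (Suc i)) \<omega> - L x0 (tt i) \<omega> \<le> (T / N) / R"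
          proof (rule exists_le_average[OF _ _ _ R])
            show "integrable lborel (\<lambda>x. L x (tt (Suc i)) \<omega> - L x (tt i) \<omega>)" using good(3) by auto
            show "(LBINT x. L x (tt (Suc i)) \<omega> - L x (tt i) \<omega>) \<le> T / N" using good(3) tt_diff[of i] by simp
            show "0 \<le> L x (tt (Suc i)) \<omega> - L x (tt i) \<omega>" for x using good(1) tt0[of i] tt_mono[of i] by simp
          qed
          then obtain x0 where x0: "x0 \<in> {-R..R}" "L x0 (tt (Suc i)) \<omega> - L x0 (tt i) \<omega> \<le> T / (N * R)" by auto
          have "\<omega> \<in> space M - E1 i" using \<omega> i by (auto simp: E_def)
          from E1(3)[OF i this xR x0(1), of 0]
          have "\<bar>(L x (tt (Suc i)) \<omega> - L x (tt i) \<omega>) - (L x0 (tt (Suc i)) \<omega> - L x0 (tt i) \<omega>)\<bar> \<le> \<eta> / 8"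
            using xR x0(1) K\<beta>1 by auto
          then show ?thesis using x0(2) N2 by linarith
        qed
        have moll: "\<bar>integral {0..tt i} (\<lambda>r. tri \<epsilon> (B (max 0 r) \<omega> - x)) - L x (tt i) \<omega>\<bar> \<le> \<eta> / 4" if i: "i \<le> N" for i
        proof -
          have "\<bar>L z (tt i) \<omega> - L x (tt i) \<omega>\<bar> \<le> \<eta> / 4" if z: "\<bar>z - x\<bar> \<le> \<epsilon>" for z
          proof -
            have zR: "z \<in> {-R..R}" using z x \<epsilon>(2) by (auto simp: R_def)
            have "\<omega> \<in> space M - E2 i" using \<omega> i by (auto simp: E_def)
            from E2(3)[OF i this zR xR, of m] z \<epsilon>(3)
            have "\<bar>L z (tt i) \<omega> - L x (tt i) \<omega>\<bar> \<le> K * \<beta>2 powr (1 / n) * q ^ m" using good(2) by simp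
            then show ?thesis using m by linarith
          qed
          then have "\<bar>(LBINT z. tri \<epsilon> (z - x) * L z (tt i) \<omega>) - L x (tt i) \<omega>\<bar> \<le> \<eta> / 4"
            by (rule mollify_close[OF \<epsilon>(1) jointly_continuous_section[OF J \<omega>s tt0]])
          then show ?thesis using good(4) by simp
        qed
        obtain i where i: "i < N" "tt i \<le> t" "t \<le> tt (Suc i)"
          using grid_cell_exists[of t T N] t T N0 unfolding tt_def by auto
        have io: "(\<lambda>r. tri \<epsilon> (B (max 0 r) \<omega> - x)) integrable_on {0..u}" for u
          by (intro integrable_continuous_interval tri_continuous continuous_intros continuous_on_subset[OF fbm_path_continuous[OF B \<omega>s]]) auto
        have Amono: "integral {0..u} (\<lambda>r. tri \<epsilon> (B (max 0 r) \<omega> - x)) \<le> integral {0..v} (\<lambda>r. tri \<epsilon> (B (max 0 r) \<omega> - x))" if "u \<le> v" for u v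
          using that by (intro integral_subset_le io) (auto simp: tri_nonneg)
        have "L x (tt i) \<omega> \<le> L x t \<omega>" "L x t \<omega> \<le> L x (tt (Suc i)) \<omega>" using good(1) tt0 i t by auto
        then show "\<bar>integral {0..t} (\<lambda>r. tri \<epsilon> (B (max 0 r) \<omega> - x)) - L x t \<omega>\<bar> \<le> \<eta>"
          using inc[OF i(1)] moll[of i] moll[of "Suc i"] i Amono[OF i(2)] Amono[OF i(3)] \<eta> by linarith
      qed
    qed
  qed
qed

section \<open>Laws on a space of continuous functions\<close>

text \<open>Such a function is continuous for the product topology on sequences, whose Borel sets are the product
\<open>\<sigma>\<close>-algebra. Coordinates of index at least \<open>N\<close> do not influence the value and can be set to \<open>0\<close>.\<close>

lemma lipschitz_coordinates_measurable:
  fixes G :: "(nat \<Rightarrow> real) \<Rightarrow> real"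
  assumes G: "\<And>v v'. \<bar>G v - G v'\<bar> \<le> C * (\<Sum>i<N. \<bar>v i - v' i\<bar>)"
    and Y: "\<And>i. i < N \<Longrightarrow> Y i \<in> borel_measurable M"
  shows "(\<lambda>\<omega>. G (\<lambda>i. Y i \<omega>)) \<in> borel_measurable M"
proof -
  have "isCont G a" for a
  proof -
    have coord: "((\<lambda>v :: nat \<Rightarrow> real. v i) \<longlongrightarrow> a i) (at a)" for i
    proof -
      have "continuous_on UNIV (\<lambda>v :: nat \<Rightarrow> real. v i)" by (rule continuous_on_product_coordinates)
      then have "isCont (\<lambda>v :: nat \<Rightarrow> real. v i) a"
        unfolding continuous_on_eq_continuous_at[OF open_UNIV] by simp
      then show ?thesis by (simp add: isCont_def)
    qed
    have "((\<lambda>v. C * (\<Sum>i<N. \<bar>v i - a i\<bar>)) \<longlongrightarrow> C * (\<Sum>i<N. \<bar>a i - a i\<bar>)) (at a)"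
      by (intro tendsto_intros coord)
    then have "((\<lambda>v. C * (\<Sum>i<N. \<bar>v i - a i\<bar>)) \<longlongrightarrow> 0) (at a)" by simp
    then have "((\<lambda>v. G v - G a) \<longlongrightarrow> 0) (at a)"
      by (rule Lim_null_comparison[rotated]) (auto intro!: always_eventually G)
    then show ?thesis unfolding isCont_def by (simp add: LIM_zero_iff)
  qed
  then have Gm: "G \<in> borel_measurable borel"
    by (intro borel_measurable_continuous_onI) (simp add: continuous_at_imp_continuous_on)
  define Y' where "Y' = (\<lambda>\<omega> i. if i < N then Y i \<omega> else 0)"
  have "Y' \<in> measurable M (Pi\<^sub>M UNIV (\<lambda>_::nat. borel :: real measure))"
  proof (rule measurable_PiM_single')
    fix i show "(\<lambda>\<omega>. Y' \<omega> i) \<in> borel_measurable M" unfolding Y'_def using Y by (cases "i < N") auto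
  qed (auto simp: Y'_def)
  then have "Y' \<in> borel_measurable M"
    using measurable_cong_sets[OF refl sets_PiM_equal_borel] by blast
  then have "(\<lambda>\<omega>. G (Y' \<omega>)) \<in> borel_measurable M" by (rule measurable_compose[OF _ Gm])
  moreover have "G (Y' \<omega>) = G (\<lambda>i. Y i \<omega>)" for \<omega>
  proof -
    have "(\<Sum>i<N. \<bar>Y' \<omega> i - Y i \<omega>\<bar>) = 0" by (intro sum.neutral) (auto simp: Y'_def)
    then show ?thesis using G[of "Y' \<omega>" "\<lambda>i. Y i \<omega>"] by simp
  qed
  ultimately show ?thesis by simp
qed

definition C_space :: "'a::topological_space set \<Rightarrow> ('a \<Rightarrow> real) set" where
  "C_space K = {f. f \<in> extensional K \<and> continuous_on K f}"

definition C_dist :: "'a::topological_space set \<Rightarrow> ('a \<Rightarrow> real) \<Rightarrow> ('a \<Rightarrow> real) \<Rightarrow> real" where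
  "C_dist K = mdist (cfunspace (top_of_set K) euclidean_metric)"

lemma mspace_C: "compact K \<Longrightarrow> mspace (cfunspace (top_of_set K) euclidean_metric) = C_space K"
  by (subst compactin_mspace_cfunspace) (auto simp: C_space_def compactin_subtopology)

lemma Metric_space_C: "compact K \<Longrightarrow> Metric_space (C_space K) (C_dist K)"
  unfolding C_dist_def mspace_C[symmetric] by (rule Metric_space_mspace_mdist)

lemma C_topology_eq: "compact K \<Longrightarrow> C_topology K = Metric_space.mtopology (C_space K) (C_dist K)"
  unfolding C_topology_def mtopology_of_def C_dist_def by (simp only: mspace_C)

lemma topspace_C_topology: "compact K \<Longrightarrow> topspace (C_topology K) = C_space K"
  unfolding C_topology_def topspace_mtopology_of by (rule mspace_C)

lemma restrict_in_C_space: "continuous_on K f \<Longrightarrow> restrict f K \<in> C_space K"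
  by (simp add: C_space_def)

lemma C_dist_le:
  assumes "0 \<le> c" "\<And>x. x \<in> K \<Longrightarrow> \<bar>f x - g x\<bar> \<le> c"
  shows "C_dist K f g \<le> c"
  unfolding C_dist_def using assms by (intro mdist_cfunspace_le) (auto simp: dist_real_def)

text \<open>The Lipschitz regularization of \<open>F\<close>: the largest \<open>k\<close>-Lipschitz function below \<open>F\<close>.\<close>

definition inf_conv :: "'a set \<Rightarrow> ('a \<Rightarrow> 'a \<Rightarrow> real) \<Rightarrow> ('a \<Rightarrow> real) \<Rightarrow> nat \<Rightarrow> 'a \<Rightarrow> real" where
  "inf_conv S d F k \<phi> = (INF \<psi>\<in>S. F \<psi> + real k * d \<phi> \<psi>)"

context Metric_space
begin

lemma inf_conv_bdd:
  assumes "\<And>\<psi>. \<psi> \<in> M \<Longrightarrow> \<bar>F \<psi>\<bar> \<le> c"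
  shows "bdd_below ((\<lambda>\<psi>. F \<psi> + real k * d \<phi> \<psi>) ` M)"
proof (rule bdd_belowI2)
  fix \<psi> assume "\<psi> \<in> M"
  then have "\<bar>F \<psi>\<bar> \<le> c" by (rule assms)
  moreover have "0 \<le> real k * d \<phi> \<psi>" by simp
  ultimately show "- c \<le> F \<psi> + real k * d \<phi> \<psi>" by linarith
qed

lemma inf_conv_le:
  assumes "\<And>\<psi>. \<psi> \<in> M \<Longrightarrow> \<bar>F \<psi>\<bar> \<le> c" "\<phi> \<in> M"
  shows "inf_conv M d F k \<phi> \<le> F \<phi>"
proof -
  have "inf_conv M d F k \<phi> \<le> F \<phi> + real k * d \<phi> \<phi>"
    unfolding inf_conv_def by (rule cINF_lower[OF inf_conv_bdd[OF assms(1)] assms(2)])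
  then show ?thesis using assms(2) by simp
qed

lemma inf_conv_ge:
  assumes "\<And>\<psi>. \<psi> \<in> M \<Longrightarrow> c \<le> F \<psi> + real k * d \<phi> \<psi>" "M \<noteq> {}"
  shows "c \<le> inf_conv M d F k \<phi>"
  unfolding inf_conv_def using assms by (intro cINF_greatest) auto

lemma inf_conv_abs_le:
  assumes "\<And>\<psi>. \<psi> \<in> M \<Longrightarrow> \<bar>F \<psi>\<bar> \<le> c" "\<phi> \<in> M"
  shows "\<bar>inf_conv M d F k \<phi>\<bar> \<le> c"
proof -
  have "- c \<le> inf_conv M d F k \<phi>"
  proof (rule inf_conv_ge)
    fix \<psi> assume "\<psi> \<in> M"
    then have "\<bar>F \<psi>\<bar> \<le> c" by (rule assms)
    moreover have "0 \<le> real k * d \<phi> \<psi>" by simp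
    ultimately show "- c \<le> F \<psi> + real k * d \<phi> \<psi>" by linarith
  qed (use assms in auto)
  moreover have "inf_conv M d F k \<phi> \<le> F \<phi>" by (rule inf_conv_le[OF assms])
  ultimately show ?thesis using assms(1)[OF assms(2)] by linarith
qed

lemma inf_conv_lipschitz:
  assumes F: "\<And>\<psi>. \<psi> \<in> M \<Longrightarrow> \<bar>F \<psi>\<bar> \<le> c" and \<phi>: "\<phi> \<in> M" "\<phi>' \<in> M"
  shows "\<bar>inf_conv M d F k \<phi> - inf_conv M d F k \<phi>'\<bar> \<le> real k * d \<phi> \<phi>'"
proof -
  have *: "inf_conv M d F k \<phi> - real k * d \<phi> \<phi>' \<le> inf_conv M d F k \<phi>'" if "\<phi> \<in> M" "\<phi>' \<in> M" for \<phi> \<phi>'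
  proof (rule inf_conv_ge)
    fix \<psi> assume \<psi>: "\<psi> \<in> M"
    have "inf_conv M d F k \<phi> \<le> F \<psi> + real k * d \<phi> \<psi>"
      unfolding inf_conv_def by (rule cINF_lower[OF inf_conv_bdd[OF F] \<psi>])
    also have "real k * d \<phi> \<psi> \<le> real k * (d \<phi> \<phi>' + d \<phi>' \<psi>)" using triangle[OF that \<psi>] by (intro mult_left_mono) auto
    finally show "inf_conv M d F k \<phi> - real k * d \<phi> \<phi>' \<le> F \<psi> + real k * d \<phi>' \<psi>" by (simp add: algebra_simps)
  qed (use that in auto)
  show ?thesis using *[OF \<phi>] *[OF \<phi>(2,1)] commute[of \<phi> \<phi>'] by simp
qed

lemma inf_conv_tendsto:
  assumes F: "\<And>\<psi>. \<psi> \<in> M \<Longrightarrow> \<bar>F \<psi>\<bar> \<le> c" and \<phi>: "\<phi> \<in> M"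
    and lsc: "\<And>e. e > 0 \<Longrightarrow> \<exists>r>0. \<forall>\<psi>\<in>M. d \<phi> \<psi> < r \<longrightarrow> F \<phi> - e < F \<psi>"
  shows "(\<lambda>k. inf_conv M d F k \<phi>) \<longlonglongrightarrow> F \<phi>"
proof (rule LIMSEQ_I)
  fix e :: real assume e: "e > 0"
  obtain r where r: "r > 0" "\<And>\<psi>. \<psi> \<in> M \<Longrightarrow> d \<phi> \<psi> < r \<Longrightarrow> F \<phi> - e / 2 < F \<psi>" using lsc[of "e/2"] e by auto
  obtain k0 :: nat where k0: "real k0 > 2 * c / r" using reals_Archimedean2 by blast
  show "\<exists>no. \<forall>k\<ge>no. norm (inf_conv M d F k \<phi> - F \<phi>) < e"
  proof (intro exI[of _ k0] allI impI)
    fix k assume k: "k0 \<le> k"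
    have "F \<phi> - e / 2 \<le> inf_conv M d F k \<phi>"
    proof (rule inf_conv_ge)
      fix \<psi> assume \<psi>: "\<psi> \<in> M"
      show "F \<phi> - e / 2 \<le> F \<psi> + real k * d \<phi> \<psi>"
      proof (cases "d \<phi> \<psi> < r")
        case True
        have "0 \<le> real k * d \<phi> \<psi>" by simp
        then show ?thesis using r(2)[OF \<psi> True] by linarith
      next
        case False
        have "2 * c \<le> real k0 * r" using k0 r(1) by (simp add: field_simps)
        also have "\<dots> \<le> real k * d \<phi> \<psi>" using k False r(1) by (intro mult_mono) auto
        finally show ?thesis using F[OF \<phi>] F[OF \<psi>] e by linarith
      qed
    qed (use \<phi> in auto)
    moreover have "inf_conv M d F k \<phi> \<le> F \<phi>" by (rule inf_conv_le[OF F \<phi>])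
    ultimately show "norm (inf_conv M d F k \<phi> - F \<phi>) < e" using e by simp
  qed
qed

end

text \<open>Interpolate the random function between its values at the points of a finite \<open>1/(k+1)\<close>-net, with a
Lipschitz partition of unity. The functional then becomes a Lipschitz function of finitely many random
variables, and by uniform continuity the interpolations converge uniformly.\<close>

lemma lipschitz_functional_measurable:
  fixes X :: "'a::metric_space \<Rightarrow> 'w \<Rightarrow> real"
  assumes K: "compact K" and X: "\<And>p. p \<in> K \<Longrightarrow> X p \<in> borel_measurable M"
    and cont: "\<And>\<omega>. \<omega> \<in> space M \<Longrightarrow> continuous_on K (\<lambda>p. X p \<omega>)"
    and G: "\<And>f g. f \<in> C_space K \<Longrightarrow> g \<in> C_space K \<Longrightarrow> \<bar>G f - G g\<bar> \<le> c * C_dist K f g" and c: "c \<ge> 0"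
  shows "(\<lambda>\<omega>. G (restrict (\<lambda>p. X p \<omega>) K)) \<in> borel_measurable M"
proof -
  have "\<exists>P. finite P \<and> P \<subseteq> K \<and> K \<subseteq> (\<Union>p\<in>P. ball p (1 / real (Suc k)))" for k
  proof -
    have "K \<subseteq> (\<Union>p\<in>K. ball p (1 / real (Suc k)))" by (force simp del: of_nat_Suc)
    from compactE_image[OF K _ this] obtain P where "P \<subseteq> K" "finite P" "K \<subseteq> (\<Union>p\<in>P. ball p (1 / real (Suc k)))"
      by auto
    then show ?thesis by blast
  qed
  then obtain P where P: "\<And>k. finite (P k)" "\<And>k. P k \<subseteq> K" "\<And>k. K \<subseteq> (\<Union>p\<in>P k. ball p (1 / real (Suc k)))" by metis
  define w where "w = (\<lambda>k (p :: 'a) (z :: 'a). max 0 (1 / real (Suc k) - dist p z))"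
  define W where "W = (\<lambda>k z. \<Sum>p\<in>P k. w k p z)"
  have wnn: "0 \<le> w k p z" for k p z by (simp add: w_def)
  have Wpos: "W k z > 0" if z: "z \<in> K" for k z
  proof -
    obtain p where p: "p \<in> P k" "z \<in> ball p (1 / real (Suc k))" using P(3)[of k] z by auto
    have "0 < w k p z" using p(2) by (simp add: w_def)
    also have "\<dots> \<le> W k z" unfolding W_def using p(1) P(1) wnn by (intro member_le_sum) auto
    finally show ?thesis .
  qed
  define A where "A = (\<lambda>k (v :: 'a \<Rightarrow> real). restrict (\<lambda>z. (\<Sum>p\<in>P k. w k p z * v p) / W k z) K)"
  have AC: "A k v \<in> C_space K" for k v
  proof -
    have "continuous_on K (\<lambda>z. (\<Sum>p\<in>P k. w k p z * v p) / W k z)"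
      using Wpos unfolding W_def w_def by (intro continuous_intros) (auto simp: less_imp_neq[symmetric])
    then show ?thesis unfolding A_def by (rule restrict_in_C_space)
  qed
  \<comment> \<open>a weighted mean is as close to \<open>y\<close> as the values that it averages\<close>
  have avg: "\<bar>(\<Sum>p\<in>P k. w k p z * v p) / W k z - y\<bar> \<le> b"
    if z: "z \<in> K" and b: "\<And>p. p \<in> P k \<Longrightarrow> w k p z \<noteq> 0 \<Longrightarrow> \<bar>v p - y\<bar> \<le> b" for k z v y b
  proof -
    have "(\<Sum>p\<in>P k. w k p z * v p) / W k z - y = (\<Sum>p\<in>P k. w k p z * (v p - y)) / W k z"
    proof -
      have "(\<Sum>p\<in>P k. w k p z * (v p - y)) = (\<Sum>p\<in>P k. w k p z * v p) - W k z * y"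
        by (simp add: W_def right_diff_distrib sum_subtractf sum_distrib_right)
      then show ?thesis using Wpos[OF z, of k] by (simp add: field_simps)
    qed
    also have "\<bar>\<dots>\<bar> \<le> (\<Sum>p\<in>P k. w k p z * b) / W k z"
    proof -
      have "\<bar>\<Sum>p\<in>P k. w k p z * (v p - y)\<bar> \<le> (\<Sum>p\<in>P k. w k p z * b)"
      proof (rule order_trans[OF sum_abs sum_mono])
        fix p assume "p \<in> P k"
        then show "\<bar>w k p z * (v p - y)\<bar> \<le> w k p z * b"
          using b[of p] wnn[of k p z] by (cases "w k p z = 0") (auto simp: abs_mult intro!: mult_left_mono)
      qed
      then show ?thesis using Wpos[OF z, of k] by (simp add: abs_divide divide_right_mono)
    qed
    also have "\<dots> = b" using Wpos[OF z, of k] by (simp add: W_def flip: sum_distrib_right)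
    finally show ?thesis .
  qed
  show ?thesis
  proof (rule borel_measurable_LIMSEQ_real)
    fix k
    show "(\<lambda>\<omega>. G (A k (\<lambda>p. X p \<omega>))) \<in> borel_measurable M"
    proof -
      obtain h :: "nat \<Rightarrow> 'a" where h: "bij_betw h {0..<card (P k)} (P k)" using ex_bij_betw_nat_finite[OF P(1)] by blast
      define N where "N = card (P k)"
      define g where "g = inv_into {0..<N} h"
      have hg: "h (g p) = p" "g p < N" if "p \<in> P k" for p
        using h that unfolding g_def N_def bij_betw_def by (auto simp: f_inv_into_f) (metis atLeastLessThan_iff inv_into_into)
      have hP: "h i \<in> P k" if "i < N" for i using h that unfolding N_def bij_betw_def by auto
      have "(\<lambda>\<omega>. G (A k ((\<lambda>i. X (h i) \<omega>) \<circ> g))) \<in> borel_measurable M"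
      proof (rule lipschitz_coordinates_measurable[where G = "\<lambda>v. G (A k (v \<circ> g))" and C = c and N = N])
        show "X (h i) \<in> borel_measurable M" if "i < N" for i using hP[OF that] P(2) by (intro X) auto
        fix v v' :: "nat \<Rightarrow> real"
        let ?S = "\<Sum>i<N. \<bar>v i - v' i\<bar>"
        have "C_dist K (A k (v \<circ> g)) (A k (v' \<circ> g)) \<le> ?S"
        proof (rule C_dist_le)
          fix z assume z: "z \<in> K"
          have "(\<Sum>p\<in>P k. w k p z * (v \<circ> g) p) / W k z - (\<Sum>p\<in>P k. w k p z * (v' \<circ> g) p) / W k z
             = (\<Sum>p\<in>P k. w k p z * (v (g p) - v' (g p))) / W k z"
            by (simp add: sum_subtractf right_diff_distrib diff_divide_distrib)
          moreover have "\<bar>(\<Sum>p\<in>P k. w k p z * (v (g p) - v' (g p))) / W k z - 0\<bar> \<le> ?S"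
          proof (rule avg[OF z])
            fix p assume p: "p \<in> P k"
            have "\<bar>v (g p) - v' (g p)\<bar> \<le> ?S" using hg(2)[OF p] by (intro member_le_sum) auto
            then show "\<bar>v (g p) - v' (g p) - 0\<bar> \<le> ?S" by simp
          qed
          ultimately show "\<bar>A k (v \<circ> g) z - A k (v' \<circ> g) z\<bar> \<le> ?S" using z by (simp add: A_def)
        qed (auto intro: sum_nonneg)
        then have "c * C_dist K (A k (v \<circ> g)) (A k (v' \<circ> g)) \<le> c * ?S" using c by (rule mult_left_mono)
        then show "\<bar>G (A k (v \<circ> g)) - G (A k (v' \<circ> g))\<bar> \<le> c * ?S"
          using G[OF AC AC, of k "v \<circ> g" k "v' \<circ> g"] by linarith
      qed
      moreover have "A k ((\<lambda>i. X (h i) \<omega>) \<circ> g) = A k (\<lambda>p. X p \<omega>)" for \<omega>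
        unfolding A_def comp_def using hg(1) by (intro restrict_ext arg_cong2[where f = "(/)"] sum.cong) auto
      ultimately show ?thesis by simp
    qed
  next
    fix \<omega> assume \<omega>: "\<omega> \<in> space M"
    let ?f = "\<lambda>p. X p \<omega>"
    have fC: "restrict ?f K \<in> C_space K" by (rule restrict_in_C_space[OF cont[OF \<omega>]])
    have uc: "uniformly_continuous_on K ?f" using cont[OF \<omega>] K by (rule compact_uniformly_continuous)
    show "(\<lambda>k. G (A k ?f)) \<longlonglongrightarrow> G (restrict ?f K)"
    proof (rule LIMSEQ_I)
      fix e :: real assume e: "e > 0"
      define e' where "e' = e / (2 * (c + 1))"
      have e': "e' > 0" using e c by (simp add: e'_def)
      obtain d where d: "d > 0" "\<And>x y. x \<in> K \<Longrightarrow> y \<in> K \<Longrightarrow> dist y x < d \<Longrightarrow> dist (?f y) (?f x) < e'"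
        using uc e' unfolding uniformly_continuous_on_def by metis
      obtain k0 where k0: "1 / real (Suc k0) < d" using d(1) nat_approx_posE by blast
      show "\<exists>no. \<forall>k\<ge>no. norm (G (A k ?f) - G (restrict ?f K)) < e"
      proof (intro exI[of _ k0] allI impI)
        fix k assume k: "k0 \<le> k"
        have kd: "1 / real (Suc k) < d"
        proof -
          have "1 / real (Suc k) \<le> 1 / real (Suc k0)" using k by (intro divide_left_mono) auto
          then show ?thesis using k0 by simp
        qed
        have "C_dist K (A k ?f) (restrict ?f K) \<le> e'"
        proof (rule C_dist_le)
          fix z assume z: "z \<in> K"
          have "\<bar>(\<Sum>p\<in>P k. w k p z * X p \<omega>) / W k z - X z \<omega>\<bar> \<le> e'"
          proof (rule avg[OF z])
            fix p assume p: "p \<in> P k" "w k p z \<noteq> 0"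
            then have "dist p z < d" using kd by (auto simp: w_def max_def split: if_splits)
            then show "\<bar>X p \<omega> - X z \<omega>\<bar> \<le> e'" using d(2)[of z p] z p P(2)[of k] by (auto simp: dist_real_def)
          qed
          then show "\<bar>A k ?f z - restrict ?f K z\<bar> \<le> e'" using z by (simp add: A_def)
        qed (use e' in simp)
        then have "c * C_dist K (A k ?f) (restrict ?f K) \<le> c * e'" using c by (rule mult_left_mono)
        then have "\<bar>G (A k ?f) - G (restrict ?f K)\<bar> \<le> c * e'" using G[OF AC fC, of k ?f] by linarith
        also have "\<dots> < (c + 1) * (2 * e')"
        proof -
          have "0 \<le> c * e'" using e' c by simp
          then show ?thesis using e' by (simp add: algebra_simps)
        qed
        also have "\<dots> = e"
        proof -
          have "c + 1 \<noteq> 0" using c by linarith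
          then show ?thesis unfolding e'_def by (simp add: divide_simps)
        qed
        finally show "norm (G (A k ?f) - G (restrict ?f K)) < e" by simp
      qed
    qed
  qed
qed

text \<open>For an open set \<open>U\<close>, the indicator of \<open>U\<close> is lower semicontinuous, hence the pointwise limit of its
Lipschitz regularizations, along which measurability is already known.\<close>

lemma C_valued_measurable:
  fixes X :: "'a::metric_space \<Rightarrow> 'w \<Rightarrow> real"
  assumes K: "compact K" and X: "\<And>p. p \<in> K \<Longrightarrow> X p \<in> borel_measurable M"
    and cont: "\<And>\<omega>. \<omega> \<in> space M \<Longrightarrow> continuous_on K (\<lambda>p. X p \<omega>)"
  shows "(\<lambda>\<omega>. restrict (\<lambda>p. X p \<omega>) K) \<in> measurable M (borel_of (C_topology K))"
proof -
  interpret C: Metric_space "C_space K" "C_dist K" by (rule Metric_space_C[OF K])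
  let ?X = "\<lambda>\<omega>. restrict (\<lambda>p. X p \<omega>) K"
  have XC: "?X \<omega> \<in> C_space K" if "\<omega> \<in> space M" for \<omega> by (rule restrict_in_C_space[OF cont[OF that]])
  show ?thesis
    unfolding borel_of_def
  proof (rule measurable_measure_of)
    show "{U. openin (C_topology K) U} \<subseteq> Pow (topspace (C_topology K))" using openin_subset by blast
    show "?X \<in> space M \<rightarrow> topspace (C_topology K)" using XC by (simp add: topspace_C_topology[OF K])
    fix U assume "U \<in> {U. openin (C_topology K) U}"
    then have U: "openin C.mtopology U" by (simp add: C_topology_eq[OF K])
    define F where "F = (indicator U :: ('a \<Rightarrow> real) \<Rightarrow> real)"
    have Fb: "\<bar>F \<psi>\<bar> \<le> 1" for \<psi> by (simp add: F_def indicator_def)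
    have "(\<lambda>\<omega>. F (?X \<omega>)) \<in> borel_measurable M"
    proof (rule borel_measurable_LIMSEQ_real)
      show "(\<lambda>\<omega>. inf_conv (C_space K) (C_dist K) F k (?X \<omega>)) \<in> borel_measurable M" for k
        by (rule lipschitz_functional_measurable[OF K X cont C.inf_conv_lipschitz[OF Fb]]) auto
      fix \<omega> assume \<omega>: "\<omega> \<in> space M"
      show "(\<lambda>k. inf_conv (C_space K) (C_dist K) F k (?X \<omega>)) \<longlonglongrightarrow> F (?X \<omega>)"
      proof (rule C.inf_conv_tendsto[OF Fb XC[OF \<omega>]])
        fix e :: real assume e: "e > 0"
        show "\<exists>r>0. \<forall>\<psi>\<in>C_space K. C_dist K (?X \<omega>) \<psi> < r \<longrightarrow> F (?X \<omega>) - e < F \<psi>"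
        proof (cases "?X \<omega> \<in> U")
          case True
          then obtain r where r: "r > 0" "C.mball (?X \<omega>) r \<subseteq> U" using U unfolding C.openin_mtopology by blast
          have "\<psi> \<in> U" if "\<psi> \<in> C_space K" "C_dist K (?X \<omega>) \<psi> < r" for \<psi>
            using r(2) that XC[OF \<omega>] by (auto simp: C.in_mball)
          then show ?thesis using r(1) e True by (intro exI[of _ r]) (auto simp: F_def)
        next
          case False
          then have "F (?X \<omega>) - e < F \<psi>" for \<psi> using e by (simp add: F_def indicator_def)
          then show ?thesis by (intro exI[of _ 1]) auto
        qed
      qed
    qed
    then have "{\<omega> \<in> space M. F (?X \<omega>) = 1} \<in> sets M" by measurable
    moreover have "{\<omega> \<in> space M. F (?X \<omega>) = 1} = ?X -` U \<inter> space M"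
      by (auto simp: F_def indicator_def split: if_splits)
    ultimately show "?X -` U \<inter> space M \<in> sets M" by simp
  qed
qed

lemma continuous_functional_measurable:
  assumes F: "continuous_map X euclideanreal F"
  shows "F \<in> borel_measurable (borel_of X)"
proof (rule borel_measurableI)
  fix S :: "real set" assume "open S"
  have sp: "space (borel_of X) = topspace X"
    unfolding borel_of_def by (intro space_measure_of) (auto dest: openin_subset)
  have "openin X {x \<in> topspace X. F x \<in> S}"
    using F \<open>open S\<close> by (simp add: openin_continuous_map_preimage)
  then have "{x \<in> topspace X. F x \<in> S} \<in> sets (borel_of X)"
    unfolding borel_of_def by (intro in_measure_of) (auto dest: openin_subset)
  moreover have "F -` S \<inter> space (borel_of X) = {x \<in> topspace X. F x \<in> S}" unfolding sp by auto
  ultimately show "F -` S \<inter> space (borel_of X) \<in> sets (borel_of X)" by simp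
qed

text \<open>A Lipschitz regularization lies below \<open>F\<close>. Replacing \<open>F\<close> by a good one costs less than \<open>e\<close> in the limit
expectation, by dominated convergence, and only decreases the other expectations.\<close>

lemma expectation_liminf_from_lipschitz:
  fixes X :: "nat \<Rightarrow> 'a::metric_space \<Rightarrow> 'w \<Rightarrow> real"
  assumes K: "compact K"
    and p: "\<And>n. prob_space (M n)" and X: "\<And>n p. p \<in> K \<Longrightarrow> X n p \<in> borel_measurable (M n)"
    and cont: "\<And>n \<omega>. \<omega> \<in> space (M n) \<Longrightarrow> continuous_on K (\<lambda>p. X n p \<omega>)"
    and p0: "prob_space M0" and X0: "\<And>p. p \<in> K \<Longrightarrow> X0 p \<in> borel_measurable M0"
    and cont0: "\<And>\<omega>. \<omega> \<in> space M0 \<Longrightarrow> continuous_on K (\<lambda>p. X0 p \<omega>)"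
    and lip: "\<And>G c l. (\<And>f. f \<in> C_space K \<Longrightarrow> \<bar>G f\<bar> \<le> c) \<Longrightarrow> 0 \<le> l \<Longrightarrow>
       (\<And>f g. f \<in> C_space K \<Longrightarrow> g \<in> C_space K \<Longrightarrow> \<bar>G f - G g\<bar> \<le> l * C_dist K f g) \<Longrightarrow>
       (\<lambda>n. \<integral>\<omega>. G (restrict (\<lambda>p. X n p \<omega>) K) \<partial>M n) \<longlonglongrightarrow> (\<integral>\<omega>. G (restrict (\<lambda>p. X0 p \<omega>) K) \<partial>M0)"
    and F: "continuous_map (C_topology K) euclideanreal F" and Fb: "\<And>f. f \<in> C_space K \<Longrightarrow> \<bar>F f\<bar> \<le> c" and e: "e > 0"
  shows "\<forall>\<^sub>F n in sequentially. (\<integral>\<omega>. F (restrict (\<lambda>p. X0 p \<omega>) K) \<partial>M0) - e < (\<integral>\<omega>. F (restrict (\<lambda>p. X n p \<omega>) K) \<partial>M n)"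
proof -
  interpret C: Metric_space "C_space K" "C_dist K" by (rule Metric_space_C[OF K])
  interpret M0: prob_space M0 by (rule p0)
  let ?Xlim = "\<lambda>\<omega>. restrict (\<lambda>p. X0 p \<omega>) K" and ?X = "\<lambda>n \<omega>. restrict (\<lambda>p. X n p \<omega>) K"
  let ?F = "inf_conv (C_space K) (C_dist K) F"
  have X0C: "?Xlim \<omega> \<in> C_space K" if "\<omega> \<in> space M0" for \<omega> by (rule restrict_in_C_space[OF cont0[OF that]])
  have XC: "?X n \<omega> \<in> C_space K" if "\<omega> \<in> space (M n)" for n \<omega> by (rule restrict_in_C_space[OF cont[OF that]])
  have Fm: "F \<in> borel_measurable (borel_of (C_topology K))" by (rule continuous_functional_measurable[OF F])
  have FX0m: "(\<lambda>\<omega>. F (?Xlim \<omega>)) \<in> borel_measurable M0"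
    by (rule measurable_compose[OF C_valued_measurable[OF K X0 cont0] Fm])
  have FXm: "(\<lambda>\<omega>. F (?X n \<omega>)) \<in> borel_measurable (M n)" for n
    by (rule measurable_compose[OF C_valued_measurable[OF K X cont] Fm])
  have lsc: "\<exists>r>0. \<forall>\<psi>\<in>C_space K. C_dist K \<phi> \<psi> < r \<longrightarrow> F \<phi> - d < F \<psi>" if \<phi>: "\<phi> \<in> C_space K" and d: "d > 0" for \<phi> d
  proof -
    have "openin (C_topology K) {f \<in> topspace (C_topology K). F f \<in> {F \<phi> - d<..}}"
      using F by (rule openin_continuous_map_preimage) (simp flip: open_openin)
    then have "openin C.mtopology {f \<in> C_space K. F \<phi> - d < F f}" by (simp add: C_topology_eq[OF K])
    moreover have "\<phi> \<in> {f \<in> C_space K. F \<phi> - d < F f}" using \<phi> d by simp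
    ultimately obtain r where "r > 0" "C.mball \<phi> r \<subseteq> {f \<in> C_space K. F \<phi> - d < F f}"
      unfolding C.openin_mtopology by blast
    then show ?thesis using \<phi> by (intro exI[of _ r]) (auto simp: C.in_mball subset_iff)
  qed
  have conv_m: "(\<lambda>\<omega>. ?F k (?Xlim \<omega>)) \<in> borel_measurable M0" for k
    by (rule lipschitz_functional_measurable[OF K X0 cont0 C.inf_conv_lipschitz[OF Fb]]) auto
  have conv_mn: "(\<lambda>\<omega>. ?F k (?X n \<omega>)) \<in> borel_measurable (M n)" for k n
    by (rule lipschitz_functional_measurable[OF K X cont C.inf_conv_lipschitz[OF Fb]]) auto
  have "(\<lambda>k. \<integral>\<omega>. ?F k (?Xlim \<omega>) \<partial>M0) \<longlonglongrightarrow> (\<integral>\<omega>. F (?Xlim \<omega>) \<partial>M0)"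
  proof (rule integral_dominated_convergence[where w = "\<lambda>_. c"])
    show "AE \<omega> in M0. (\<lambda>k. ?F k (?Xlim \<omega>)) \<longlonglongrightarrow> F (?Xlim \<omega>)"
    proof (rule AE_I2)
      fix \<omega> assume \<omega>: "\<omega> \<in> space M0"
      show "(\<lambda>k. ?F k (?Xlim \<omega>)) \<longlonglongrightarrow> F (?Xlim \<omega>)"
        by (rule C.inf_conv_tendsto[OF Fb X0C[OF \<omega>] lsc[OF X0C[OF \<omega>]]])
    qed
    show "AE \<omega> in M0. norm (?F k (?Xlim \<omega>)) \<le> c" for k
      unfolding real_norm_def by (intro AE_I2 C.inf_conv_abs_le Fb X0C)
  qed (use FX0m conv_m in auto)
  then have "\<forall>\<^sub>F k in sequentially. (\<integral>\<omega>. F (?Xlim \<omega>) \<partial>M0) - e < (\<integral>\<omega>. ?F k (?Xlim \<omega>) \<partial>M0)"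
    using e by (intro order_tendstoD) auto
  then obtain k where k: "(\<integral>\<omega>. F (?Xlim \<omega>) \<partial>M0) - e < (\<integral>\<omega>. ?F k (?Xlim \<omega>) \<partial>M0)"
    by (meson eventually_happens sequentially_bot)
  have "(\<lambda>n. \<integral>\<omega>. ?F k (?X n \<omega>) \<partial>M n) \<longlonglongrightarrow> (\<integral>\<omega>. ?F k (?Xlim \<omega>) \<partial>M0)"
    by (rule lip[of _ c "real k"]) (auto intro: C.inf_conv_abs_le[OF Fb] C.inf_conv_lipschitz[OF Fb])
  then have "\<forall>\<^sub>F n in sequentially. (\<integral>\<omega>. F (?Xlim \<omega>) \<partial>M0) - e < (\<integral>\<omega>. ?F k (?X n \<omega>) \<partial>M n)"
    using k by (rule order_tendstoD(1))
  then show ?thesis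
  proof eventually_elim
    case (elim n)
    interpret Mn: prob_space "M n" by (rule p)
    have "(\<integral>\<omega>. ?F k (?X n \<omega>) \<partial>M n) \<le> (\<integral>\<omega>. F (?X n \<omega>) \<partial>M n)"
    proof (rule integral_mono)
      show "integrable (M n) (\<lambda>\<omega>. ?F k (?X n \<omega>))"
        by (rule Mn.integrable_const_bound[of _ c]) (use conv_mn C.inf_conv_abs_le[OF Fb] XC in \<open>auto intro!: AE_I2\<close>)
      show "integrable (M n) (\<lambda>\<omega>. F (?X n \<omega>))"
        by (rule Mn.integrable_const_bound[of _ c]) (use FXm Fb XC in \<open>auto intro!: AE_I2\<close>)
      show "?F k (?X n \<omega>) \<le> F (?X n \<omega>)" if "\<omega> \<in> space (M n)" for \<omega>
        by (rule C.inf_conv_le[OF Fb XC[OF that]])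
    qed
    then show ?case using elim by linarith
  qed
qed

lemma expectation_tendsto_from_lipschitz:
  fixes X :: "nat \<Rightarrow> 'a::metric_space \<Rightarrow> 'w \<Rightarrow> real"
  assumes K: "compact K"
    and p: "\<And>n. prob_space (M n)" and X: "\<And>n p. p \<in> K \<Longrightarrow> X n p \<in> borel_measurable (M n)"
    and cont: "\<And>n \<omega>. \<omega> \<in> space (M n) \<Longrightarrow> continuous_on K (\<lambda>p. X n p \<omega>)"
    and p0: "prob_space M0" and X0: "\<And>p. p \<in> K \<Longrightarrow> X0 p \<in> borel_measurable M0"
    and cont0: "\<And>\<omega>. \<omega> \<in> space M0 \<Longrightarrow> continuous_on K (\<lambda>p. X0 p \<omega>)"
    and lip: "\<And>G c l. (\<And>f. f \<in> C_space K \<Longrightarrow> \<bar>G f\<bar> \<le> c) \<Longrightarrow> 0 \<le> l \<Longrightarrow>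
       (\<And>f g. f \<in> C_space K \<Longrightarrow> g \<in> C_space K \<Longrightarrow> \<bar>G f - G g\<bar> \<le> l * C_dist K f g) \<Longrightarrow>
       (\<lambda>n. \<integral>\<omega>. G (restrict (\<lambda>p. X n p \<omega>) K) \<partial>M n) \<longlonglongrightarrow> (\<integral>\<omega>. G (restrict (\<lambda>p. X0 p \<omega>) K) \<partial>M0)"
    and F: "continuous_map (C_topology K) euclideanreal F" and Fb: "\<And>f. f \<in> C_space K \<Longrightarrow> \<bar>F f\<bar> \<le> c"
  shows "(\<lambda>n. \<integral>\<omega>. F (restrict (\<lambda>p. X n p \<omega>) K) \<partial>M n) \<longlonglongrightarrow> (\<integral>\<omega>. F (restrict (\<lambda>p. X0 p \<omega>) K) \<partial>M0)"
proof (rule tendstoI)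
  fix e :: real assume e: "e > 0"
  have F': "continuous_map (C_topology K) euclideanreal (\<lambda>f. - F f)"
    using F by (rule continuous_map_minus)
  \<comment> \<open>the upper half is the lower half for \<open>- F\<close>\<close>
  have Fb': "\<bar>- F f\<bar> \<le> c" if "f \<in> C_space K" for f using Fb[OF that] by simp
  have 1: "\<forall>\<^sub>F n in sequentially. (\<integral>\<omega>. F (restrict (\<lambda>p. X0 p \<omega>) K) \<partial>M0) - e < (\<integral>\<omega>. F (restrict (\<lambda>p. X n p \<omega>) K) \<partial>M n)"
    by (rule expectation_liminf_from_lipschitz[where M = M and X = X and ?M0.0 = M0 and ?X0.0 = X0, OF K p X cont p0 X0 cont0 lip F Fb e])
  have 2: "\<forall>\<^sub>F n in sequentially. (\<integral>\<omega>. - F (restrict (\<lambda>p. X0 p \<omega>) K) \<partial>M0) - e < (\<integral>\<omega>. - F (restrict (\<lambda>p. X n p \<omega>) K) \<partial>M n)"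
    by (rule expectation_liminf_from_lipschitz[where M = M and X = X and ?M0.0 = M0 and ?X0.0 = X0, OF K p X cont p0 X0 cont0 lip F' Fb' e])
  show "\<forall>\<^sub>F n in sequentially. dist (\<integral>\<omega>. F (restrict (\<lambda>p. X n p \<omega>) K) \<partial>M n) (\<integral>\<omega>. F (restrict (\<lambda>p. X0 p \<omega>) K) \<partial>M0) < e"
    using 1 2
  proof eventually_elim
    case (elim n)
    then show ?case by (simp add: dist_real_def abs_less_iff)
  qed
qed

section \<open>Convergence of finite-dimensional distributions\<close>

lemma fbm_cov_tendsto:
  assumes "h \<longlonglongrightarrow> H" "0 \<le> s" "0 \<le> t"
  shows "(\<lambda>n. fbm_cov (h n) s t) \<longlonglongrightarrow> fbm_cov H s t"
proof -
  have p: "(\<lambda>n. x powr (2 * h n)) \<longlonglongrightarrow> x powr (2 * H)" if "0 \<le> x" for x :: real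
  proof (cases "x = 0")
    case False
    then show ?thesis using assms(1) by (intro tendsto_intros) auto
  qed simp
  show ?thesis unfolding fbm_cov_def using assms(2,3) by (intro tendsto_intros p) auto
qed

lemma tri_product_integral:
  assumes e: "e > 0"
  shows "integrable (lborel_power {..<N}) (\<lambda>y. \<Prod>j<N. tri e (x j - y j))"
    "(\<integral>y. (\<Prod>j<N. tri e (x j - y j)) \<partial>lborel_power {..<N}) = 1"
proof -
  have sym: "tri e (a - z) = tri e (z - a)" for a z by (simp add: tri_def abs_minus_commute)
  have i: "integrable lborel (\<lambda>z. tri e (a - z))" and v: "(LBINT z. tri e (a - z)) = 1" for a
    unfolding sym using tri_translate_integral_one[OF e, of a] by auto
  show "integrable (lborel_power {..<N}) (\<lambda>y. \<Prod>j<N. tri e (x j - y j))"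
    using i by (intro lborel_product.product_integrable_prod) auto
  have "(\<integral>y. (\<Prod>j<N. tri e (x j - y j)) \<partial>lborel_power {..<N}) = (\<Prod>j<N. LBINT z. tri e (x j - z))"
    using i by (intro lborel_product.product_integral_prod) auto
  then show "(\<integral>y. (\<Prod>j<N. tri e (x j - y j)) \<partial>lborel_power {..<N}) = 1" by (simp add: v)
qed

text \<open>The Lebesgue density of the random vector after independent triangular noise of width \<open>e\<close> is added to
each of its first \<open>N\<close> coordinates.\<close>

definition smoothed_density :: "'w measure \<Rightarrow> (nat \<Rightarrow> 'w \<Rightarrow> real) \<Rightarrow> real \<Rightarrow> nat \<Rightarrow> (nat \<Rightarrow> real) \<Rightarrow> real" where
  "smoothed_density M X e N y = (\<integral>\<omega>. (\<Prod>j<N. tri e (X j \<omega> - y j)) \<partial>M)"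

lemma smoothed_density_integral:
  fixes G :: "(nat \<Rightarrow> real) \<Rightarrow> real"
  assumes "prob_space M" and X: "\<And>j. j < N \<Longrightarrow> X j \<in> borel_measurable M" and e: "e > 0"
    and Gb: "\<And>v. \<bar>G v\<bar> \<le> c" and Gm: "G \<in> borel_measurable (lborel_power {..<N})"
  shows "integrable (lborel_power {..<N}) (\<lambda>y. G y * smoothed_density M X e N y)"
    "(\<integral>y. G y * smoothed_density M X e N y \<partial>lborel_power {..<N})
     = (\<integral>\<omega>. (\<integral>y. G y * (\<Prod>j<N. tri e (X j \<omega> - y j)) \<partial>lborel_power {..<N}) \<partial>M)"
    "integrable M (\<lambda>\<omega>. \<integral>y. G y * (\<Prod>j<N. tri e (X j \<omega> - y j)) \<partial>lborel_power {..<N})"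
proof -
  interpret M: prob_space M by fact
  interpret P: sigma_finite_measure "lborel_power {..<N}" by (rule lborel_product.sigma_finite) simp
  interpret MP: pair_sigma_finite M "lborel_power {..<N}" ..
  define f where "f = (\<lambda>\<omega> y. G y * (\<Prod>j<N. tri e (X j \<omega> - y j)))"
  have fm: "case_prod f \<in> borel_measurable (M \<Otimes>\<^sub>M lborel_power {..<N})"
  proof -
    note X[measurable] Gm[measurable]
    have "(\<lambda>p. G (snd p)) \<in> borel_measurable (M \<Otimes>\<^sub>M lborel_power {..<N})" by measurable
    moreover have "(\<lambda>p. \<Prod>j<N. tri e (X j (fst p) - snd p j)) \<in> borel_measurable (M \<Otimes>\<^sub>M lborel_power {..<N})" by measurable
    ultimately show ?thesis unfolding f_def case_prod_beta by (rule borel_measurable_times)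
  qed
  have fb: "norm (f \<omega> y) \<le> c * (\<Prod>j<N. tri e (X j \<omega> - y j))" for \<omega> y
    unfolding f_def using Gb by (simp add: abs_mult abs_of_nonneg prod_nonneg tri_nonneg mult_right_mono)
  have c0: "0 \<le> c" using Gb[of undefined] by linarith
  have fi1: "integrable (lborel_power {..<N}) (f \<omega>)" if "\<omega> \<in> space M" for \<omega>
  proof (rule Bochner_Integration.integrable_bound)
    show "integrable (lborel_power {..<N}) (\<lambda>y. c * (\<Prod>j<N. tri e (X j \<omega> - y j)))"
      using tri_product_integral(1)[OF e] by (rule integrable_mult_right)
    show "f \<omega> \<in> borel_measurable (lborel_power {..<N})" unfolding f_def using Gm by measurable
    show "AE y in lborel_power {..<N}. norm (f \<omega> y) \<le> norm (c * (\<Prod>j<N. tri e (X j \<omega> - y j)))"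
      unfolding real_norm_def by (intro AE_I2 order_trans[OF fb[unfolded real_norm_def] abs_ge_self])
  qed
  have nb: "(\<integral>y. norm (f \<omega> y) \<partial>lborel_power {..<N}) \<le> c" if "\<omega> \<in> space M" for \<omega>
  proof -
    have "(\<integral>y. norm (f \<omega> y) \<partial>lborel_power {..<N}) \<le> (\<integral>y. c * (\<Prod>j<N. tri e (X j \<omega> - y j)) \<partial>lborel_power {..<N})"
      using fi1[OF that] tri_product_integral(1)[OF e] fb by (intro integral_mono integrable_norm integrable_mult_right) auto
    also have "\<dots> = c" using tri_product_integral(2)[OF e] by simp
    finally show ?thesis .
  qed
  have fi: "integrable (M \<Otimes>\<^sub>M lborel_power {..<N}) (case_prod f)"
  proof (rule MP.Fubini_integrable[OF fm])
    have m: "(\<lambda>\<omega>. \<integral>y. norm (case_prod f (\<omega>, y)) \<partial>lborel_power {..<N}) \<in> borel_measurable M"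
      using fm by (intro P.borel_measurable_lebesgue_integral) (simp add: case_prod_beta)
    show "integrable M (\<lambda>\<omega>. \<integral>y. norm (case_prod f (\<omega>, y)) \<partial>lborel_power {..<N})"
    proof (rule M.integrable_const_bound[OF _ m])
      show "AE \<omega> in M. norm (\<integral>y. norm (case_prod f (\<omega>, y)) \<partial>lborel_power {..<N}) \<le> c"
        using nb by (intro AE_I2) (simp add: abs_of_nonneg Bochner_Integration.integral_nonneg)
    qed
    show "AE \<omega> in M. integrable (lborel_power {..<N}) (\<lambda>y. case_prod f (\<omega>, y))"
      using fi1 by (intro AE_I2) simp
  qed
  have in_y: "(\<integral>\<omega>. f \<omega> y \<partial>M) = G y * smoothed_density M X e N y" for y
    by (simp add: f_def smoothed_density_def)
  show "integrable (lborel_power {..<N}) (\<lambda>y. G y * smoothed_density M X e N y)"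
    using MP.integrable_snd[OF fi] unfolding in_y .
  show "(\<integral>y. G y * smoothed_density M X e N y \<partial>lborel_power {..<N})
     = (\<integral>\<omega>. (\<integral>y. G y * (\<Prod>j<N. tri e (X j \<omega> - y j)) \<partial>lborel_power {..<N}) \<partial>M)"
    using MP.Fubini_integral[OF fi] unfolding in_y unfolding f_def .
  show "integrable M (\<lambda>\<omega>. \<integral>y. G y * (\<Prod>j<N. tri e (X j \<omega> - y j)) \<partial>lborel_power {..<N})"
    using MP.integrable_fst[OF fi] unfolding f_def .
qed

text \<open>The smoothing moves each coordinate by less than \<open>e\<close>.\<close>

lemma smoothed_expectation_close:
  fixes G :: "(nat \<Rightarrow> real) \<Rightarrow> real"
  assumes "prob_space M" and X: "\<And>j. j < N \<Longrightarrow> X j \<in> borel_measurable M" and e: "e > 0"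
    and Gb: "\<And>v. \<bar>G v\<bar> \<le> c" and G: "\<And>v v'. \<bar>G v - G v'\<bar> \<le> C * (\<Sum>i<N. \<bar>v i - v' i\<bar>)" and C: "0 \<le> C"
  shows "\<bar>(\<integral>y. G y * smoothed_density M X e N y \<partial>lborel_power {..<N}) - (\<integral>\<omega>. G (\<lambda>i. X i \<omega>) \<partial>M)\<bar> \<le> C * N * e"
proof -
  interpret M: prob_space M by fact
  have Gm: "G \<in> borel_measurable (lborel_power {..<N})"
    using lipschitz_coordinates_measurable[OF G, of "\<lambda>i y. y i" "lborel_power {..<N}"] by simp
  have GXm: "(\<lambda>\<omega>. G (\<lambda>i. X i \<omega>)) \<in> borel_measurable M" using lipschitz_coordinates_measurable[OF G X] .
  note sd = smoothed_density_integral[where X = X, OF assms(1) X e Gb Gm]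
  have GXi: "integrable M (\<lambda>\<omega>. G (\<lambda>i. X i \<omega>))"
    by (rule M.integrable_const_bound[OF _ GXm, of c]) (simp add: Gb)
  have pw: "\<bar>(\<integral>y. G y * (\<Prod>j<N. tri e (X j \<omega> - y j)) \<partial>lborel_power {..<N}) - G (\<lambda>i. X i \<omega>)\<bar> \<le> C * N * e" for \<omega>
  proof -
    let ?T = "\<lambda>y. \<Prod>j<N. tri e (X j \<omega> - y j)"
    let ?x = "\<lambda>i. X i \<omega>"
    have Ti: "integrable (lborel_power {..<N}) ?T" "(\<integral>y. ?T y \<partial>lborel_power {..<N}) = 1"
      using tri_product_integral[OF e] by auto
    have Tnn: "0 \<le> ?T y" for y by (intro prod_nonneg) (simp add: tri_nonneg)
    have b: "\<bar>(G y - G ?x) * ?T y\<bar> \<le> (C * N * e) * ?T y" for y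
    proof (cases "\<forall>j<N. \<bar>X j \<omega> - y j\<bar> < e")
      case True
      have "\<bar>G y - G ?x\<bar> \<le> C * (\<Sum>i<N. \<bar>y i - X i \<omega>\<bar>)" by (rule G)
      also have "\<dots> \<le> C * (\<Sum>i<N. e)" using True C
        by (intro mult_left_mono sum_mono) (auto simp: abs_minus_commute intro: less_imp_le)
      finally have le: "\<bar>G y - G ?x\<bar> \<le> C * N * e" by simp
      show ?thesis unfolding abs_mult abs_of_nonneg[OF Tnn] by (rule mult_right_mono[OF le Tnn])
    next
      case False
      then obtain j where j: "j < N" "e \<le> \<bar>X j \<omega> - y j\<bar>" by (auto simp: not_less)
      then have T0: "?T y = 0" using tri_eq_0[OF j(2)] by (intro prod_zero) auto
      show ?thesis unfolding T0 by simp
    qed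
    have Gi: "integrable (lborel_power {..<N}) (\<lambda>y. (G y - G ?x) * ?T y)"
    proof (rule Bochner_Integration.integrable_bound[OF integrable_mult_right[OF Ti(1), of "C * N * e"]])
      show "(\<lambda>y. (G y - G ?x) * ?T y) \<in> borel_measurable (lborel_power {..<N})" using Gm by measurable
      show "AE y in lborel_power {..<N}. norm ((G y - G ?x) * ?T y) \<le> norm (C * N * e * ?T y)"
        unfolding real_norm_def by (intro AE_I2 order_trans[OF b abs_ge_self])
    qed
    have "(\<integral>y. G y * ?T y \<partial>lborel_power {..<N}) = (\<integral>y. (G y - G ?x) * ?T y + G ?x * ?T y \<partial>lborel_power {..<N})"
      by (simp add: algebra_simps)
    also have "\<dots> = (\<integral>y. (G y - G ?x) * ?T y \<partial>lborel_power {..<N}) + G ?x"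
      using Gi Ti by (subst Bochner_Integration.integral_add) auto
    finally have "(\<integral>y. G y * ?T y \<partial>lborel_power {..<N}) - G ?x = (\<integral>y. (G y - G ?x) * ?T y \<partial>lborel_power {..<N})" by simp
    also have "\<bar>\<dots>\<bar> \<le> (\<integral>y. \<bar>(G y - G ?x) * ?T y\<bar> \<partial>lborel_power {..<N})" by (rule integral_abs_bound)
    also have "\<dots> \<le> (\<integral>y. (C * N * e) * ?T y \<partial>lborel_power {..<N})"
      using Gi Ti(1) b by (intro integral_mono integrable_abs integrable_mult_right) auto
    also have "\<dots> = C * N * e" using Ti(2) by simp
    finally show ?thesis .
  qed
  have "(\<integral>y. G y * smoothed_density M X e N y \<partial>lborel_power {..<N}) - (\<integral>\<omega>. G (\<lambda>i. X i \<omega>) \<partial>M)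
     = (\<integral>\<omega>. (\<integral>y. G y * (\<Prod>j<N. tri e (X j \<omega> - y j)) \<partial>lborel_power {..<N}) - G (\<lambda>i. X i \<omega>) \<partial>M)"
  proof -
    have "(\<integral>y. G y * smoothed_density M X e N y \<partial>lborel_power {..<N})
       = (\<integral>\<omega>. (\<integral>y. G y * (\<Prod>j<N. tri e (X j \<omega> - y j)) \<partial>lborel_power {..<N}) \<partial>M)"
      by (rule smoothed_density_integral(2)[OF assms(1) X e Gb Gm])
    then show ?thesis using Bochner_Integration.integral_diff[OF sd(3) GXi] by simp
  qed
  also have "\<bar>\<dots>\<bar> \<le> (\<integral>\<omega>. \<bar>(\<integral>y. G y * (\<Prod>j<N. tri e (X j \<omega> - y j)) \<partial>lborel_power {..<N}) - G (\<lambda>i. X i \<omega>)\<bar> \<partial>M)"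
    by (rule integral_abs_bound)
  also have "\<dots> \<le> (\<integral>\<omega>. C * N * e \<partial>M)"
    using sd(3) GXi pw by (intro integral_mono) auto
  also have "\<dots> = C * N * e" by (simp add: M.prob_space)
  finally show ?thesis .
qed

text \<open>By Fourier inversion the density is an integral of \<open>exp (- Q(u)/2)\<close> against fixed integrable functions,
and the quadratic form \<open>Q\<close> depends continuously on the Hurst parameter.\<close>

lemma fbm_smoothed_density_tendsto:
  fixes h :: "nat \<Rightarrow> real"
  assumes B: "\<And>n. fractional_brownian_motion (h n) (M n) (B n)" and B0: "fractional_brownian_motion H M0 B0"
    and h: "h \<longlonglongrightarrow> H" and t: "\<And>j. j < N \<Longrightarrow> 0 \<le> t j" and e: "e > 0"
  shows "(\<lambda>n. smoothed_density (M n) (\<lambda>j. B n (t j)) e N y) \<longlonglongrightarrow> smoothed_density M0 (\<lambda>j. B0 (t j)) e N y"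
proof -
  define g where "g = (\<lambda>j l. complex_of_real (tri_hat e l) * cis (- (l * y j)))"
  define Q where "Q = (\<lambda>H (u :: nat \<Rightarrow> real). \<Sum>i<N. \<Sum>j<N. fbm_cov H (t i) (t j) * u i * u j)"
  have gm[measurable]: "g j \<in> borel_measurable borel" for j unfolding g_def by measurable
  have ng: "norm (g j l) = tri_hat e l" for j l by (simp add: g_def norm_mult tri_hat_nonneg)
  have gi: "integrable lborel (g j)" for j
    by (rule Bochner_Integration.integrable_bound[OF integrable_tri_hat[OF e]]) (auto simp: ng tri_hat_nonneg)
  have rep: "complex_of_real (smoothed_density M (\<lambda>j. B (t j)) e N y)
     = (\<integral>u. (\<Prod>j<N. g j (u j)) * complex_of_real (exp (- Q H u / 2)) \<partial>lborel_power {..<N})"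
    if B: "fractional_brownian_motion H M B" for H M B
  proof -
    have four: "complex_of_real (tri e (z - y j)) = (CLBINT l. g j l * cis (l * z))" for z j
    proof -
      have "cis (l * (z - y j)) = cis (- (l * y j)) * cis (l * z)" for l by (simp add: cis_mult right_diff_distrib)
      then show ?thesis unfolding tri_fourier[OF e] g_def by (simp add: mult.assoc)
    qed
    have "complex_of_real (smoothed_density M (\<lambda>j. B (t j)) e N y)
       = (\<integral>\<omega>. (\<Prod>j<N. CLBINT l. g j l * cis (l * B (t j) \<omega>)) \<partial>M)"
      unfolding smoothed_density_def four[symmetric] by (simp flip: of_real_prod)
    also have "\<dots> = (\<integral>u. (\<Prod>j<N. g j (u j)) * complex_of_real (exp (- Q H u / 2)) \<partial>lborel_power {..<N})"
    proof (rule gaussian_fourier_product[OF fbm_prob_space[OF B]])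
      show "B (t j) \<in> borel_measurable M" if "j < N" for j by (rule fbm_borel_measurable[OF B t[OF that]])
      show "(\<integral>\<omega>. cis (\<Sum>j<N. u j * B (t j) \<omega>) \<partial>M) = complex_of_real (exp (- Q H u / 2))" for u
        unfolding Q_def using t by (intro fbm_char[OF B]) auto
    qed (rule gi)
    finally show ?thesis .
  qed
  have Qnn: "0 \<le> Q H u" if "fractional_brownian_motion H M B" for H u and M :: "'c measure" and B
  proof -
    have "Q H u = (\<integral>\<omega>. (\<Sum>j<N. u j * B (t j) \<omega>)\<^sup>2 \<partial>M)"
      unfolding Q_def using t by (intro fbm_linear_combination_variance[OF that, symmetric]) auto
    then show ?thesis by (simp add: Bochner_Integration.integral_nonneg)
  qed
  have Qm: "Q H \<in> borel_measurable (lborel_power {..<N})" for H unfolding Q_def by measurable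
  have "(\<lambda>n. \<integral>u. (\<Prod>j<N. g j (u j)) * complex_of_real (exp (- Q (h n) u / 2)) \<partial>lborel_power {..<N})
     \<longlonglongrightarrow> (\<integral>u. (\<Prod>j<N. g j (u j)) * complex_of_real (exp (- Q H u / 2)) \<partial>lborel_power {..<N})"
  proof (rule integral_dominated_convergence[where w = "\<lambda>u. \<Prod>j<N. tri_hat e (u j)"])
    show "integrable (lborel_power {..<N}) (\<lambda>u. \<Prod>j<N. tri_hat e (u j))"
      using integrable_tri_hat[OF e] by (intro lborel_product.product_integrable_prod) auto
    show "AE u in lborel_power {..<N}. (\<lambda>n. (\<Prod>j<N. g j (u j)) * complex_of_real (exp (- Q (h n) u / 2))) \<longlonglongrightarrow> (\<Prod>j<N. g j (u j)) * complex_of_real (exp (- Q H u / 2))"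
    proof (rule AE_I2)
      fix u
      have "(\<lambda>n. Q (h n) u) \<longlonglongrightarrow> Q H u" unfolding Q_def using t by (intro tendsto_intros fbm_cov_tendsto h) auto
      then show "(\<lambda>n. (\<Prod>j<N. g j (u j)) * complex_of_real (exp (- Q (h n) u / 2))) \<longlonglongrightarrow> (\<Prod>j<N. g j (u j)) * complex_of_real (exp (- Q H u / 2))"
        by (intro tendsto_intros) auto
    qed
    show "AE u in lborel_power {..<N}. norm ((\<Prod>j<N. g j (u j)) * complex_of_real (exp (- Q (h n) u / 2))) \<le> (\<Prod>j<N. tri_hat e (u j))" for n
    proof (rule AE_I2)
      fix u
      have "norm ((\<Prod>j<N. g j (u j)) * complex_of_real (exp (- Q (h n) u / 2))) = (\<Prod>j<N. tri_hat e (u j)) * exp (- Q (h n) u / 2)"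
        unfolding norm_mult prod_norm[symmetric] ng by simp
      also have "\<dots> \<le> (\<Prod>j<N. tri_hat e (u j)) * 1"
        using Qnn[OF B, of n u] by (intro mult_left_mono prod_nonneg) (auto simp: tri_hat_nonneg)
      finally show "norm ((\<Prod>j<N. g j (u j)) * complex_of_real (exp (- Q (h n) u / 2))) \<le> (\<Prod>j<N. tri_hat e (u j))" by simp
    qed
  qed (use Qm in measurable)
  then have "(\<lambda>n. complex_of_real (smoothed_density (M n) (\<lambda>j. B n (t j)) e N y)) \<longlonglongrightarrow> complex_of_real (smoothed_density M0 (\<lambda>j. B0 (t j)) e N y)"
    unfolding rep[OF B] rep[OF B0] .
  then show ?thesis by (simp only: tendsto_of_real_iff)
qed

lemma fbm_finite_dimensional_convergence:
  fixes h :: "nat \<Rightarrow> real" and G :: "(nat \<Rightarrow> real) \<Rightarrow> real"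
  assumes B: "\<And>n. fractional_brownian_motion (h n) (M n) (B n)" and B0: "fractional_brownian_motion H M0 B0"
    and h: "h \<longlonglongrightarrow> H" and t: "\<And>j. j < N \<Longrightarrow> 0 \<le> t j"
    and Gb: "\<And>v. \<bar>G v\<bar> \<le> c" and G: "\<And>v v'. \<bar>G v - G v'\<bar> \<le> C * (\<Sum>i<N. \<bar>v i - v' i\<bar>)" and C: "0 \<le> C"
  shows "(\<lambda>n. \<integral>\<omega>. G (\<lambda>i. B n (t i) \<omega>) \<partial>M n) \<longlonglongrightarrow> (\<integral>\<omega>. G (\<lambda>i. B0 (t i) \<omega>) \<partial>M0)"
proof (rule LIMSEQ_I)
  fix r :: real assume r: "r > 0"
  define e where "e = r / (4 * (C * N + 1))"
  have CN: "C * N + 1 > 0" using C by (intro add_nonneg_pos) auto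
  have e: "e > 0" unfolding e_def using r CN by simp
  have eb: "C * N * e \<le> r / 4"
  proof -
    have "C * N * e \<le> (C * N + 1) * e" using e by (intro mult_right_mono) auto
    also have "\<dots> = r / 4"
    proof -
      have "C * N + 1 \<noteq> 0" using CN by linarith
      then show ?thesis unfolding e_def by (simp add: divide_simps)
    qed
    finally show ?thesis .
  qed
  let ?\<rho> = "\<lambda>n. smoothed_density (M n) (\<lambda>j. B n (t j)) e N" and ?\<rho>lim = "smoothed_density M0 (\<lambda>j. B0 (t j)) e N"
  let ?P = "lborel_power {..<N}"
  have Gm: "G \<in> borel_measurable ?P"
    using lipschitz_coordinates_measurable[OF G, of "\<lambda>i y. y i" "lborel_power {..<N}"] by simp
  note p = fbm_prob_space[OF B] and p0 = fbm_prob_space[OF B0]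
  note m = fbm_borel_measurable[OF B t] and m0 = fbm_borel_measurable[OF B0 t]
  have one_i: "integrable ?P (?\<rho> n)" and one_v: "(\<integral>y. ?\<rho> n y \<partial>?P) = 1" for n
  proof -
    interpret prob_space "M n" by (rule p)
    show "integrable ?P (?\<rho> n)" using smoothed_density_integral(1)[where X = "\<lambda>j. B n (t j)" and M = "M n" and G = "\<lambda>_. 1" and c = 1, OF p m e] by simp
    show "(\<integral>y. ?\<rho> n y \<partial>?P) = 1"
      using smoothed_density_integral(2)[where X = "\<lambda>j. B n (t j)" and M = "M n" and G = "\<lambda>_. 1" and c = 1, OF p m e] by (simp add: tri_product_integral[OF e] prob_space)
  qed
  have one_i0: "integrable ?P ?\<rho>lim" and one_v0: "(\<integral>y. ?\<rho>lim y \<partial>?P) = 1"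
  proof -
    interpret prob_space M0 by (rule p0)
    show "integrable ?P ?\<rho>lim" using smoothed_density_integral(1)[where X = "\<lambda>j. B0 (t j)" and M = M0 and G = "\<lambda>_. 1" and c = 1, OF p0 m0 e] by simp
    show "(\<integral>y. ?\<rho>lim y \<partial>?P) = 1"
      using smoothed_density_integral(2)[where X = "\<lambda>j. B0 (t j)" and M = M0 and G = "\<lambda>_. 1" and c = 1, OF p0 m0 e] by (simp add: tri_product_integral[OF e] prob_space)
  qed
  have nn: "0 \<le> smoothed_density M' X e N y" for M' :: "'x measure" and X y
    unfolding smoothed_density_def by (intro Bochner_Integration.integral_nonneg prod_nonneg) (auto simp: tri_nonneg)
  have "(\<lambda>n. \<integral>\<^sup>+y. norm (?\<rho> n y - ?\<rho>lim y) \<partial>?P) \<longlonglongrightarrow> 0"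
  proof (rule Scheffe_lemma2)
    show "?\<rho> n \<in> borel_measurable ?P" for n using one_i[of n] by simp
    show "integrable ?P ?\<rho>lim" by (rule one_i0)
    show "AE y in ?P. (\<lambda>n. ?\<rho> n y) \<longlonglongrightarrow> ?\<rho>lim y"
      by (intro AE_I2 fbm_smoothed_density_tendsto[OF B B0 h t e])
    fix n
    have "(\<integral>\<^sup>+y. ennreal (norm (?\<rho> n y)) \<partial>?P) = ennreal (\<integral>y. ?\<rho> n y \<partial>?P)"
      using one_i[of n] by (simp add: nn nn_integral_eq_integral)
    moreover have "(\<integral>\<^sup>+y. ennreal (norm (?\<rho>lim y)) \<partial>?P) = ennreal (\<integral>y. ?\<rho>lim y \<partial>?P)"
      using one_i0 by (simp add: nn nn_integral_eq_integral)
    ultimately show "(\<integral>\<^sup>+y. ennreal (norm (?\<rho> n y)) \<partial>?P) \<le> (\<integral>\<^sup>+y. ennreal (norm (?\<rho>lim y)) \<partial>?P)"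
      by (simp add: one_v one_v0)
  qed
  moreover have "(\<integral>\<^sup>+y. norm (?\<rho> n y - ?\<rho>lim y) \<partial>?P) = ennreal (\<integral>y. \<bar>?\<rho> n y - ?\<rho>lim y\<bar> \<partial>?P)" for n
    using one_i[of n] one_i0 by (simp add: nn_integral_eq_integral)
  ultimately have L1: "(\<lambda>n. \<integral>y. \<bar>?\<rho> n y - ?\<rho>lim y\<bar> \<partial>?P) \<longlonglongrightarrow> 0"
    by (simp add: ennreal_0[symmetric] tendsto_ennreal_iff Bochner_Integration.integral_nonneg del: ennreal_0)
  have c0: "0 \<le> c" using Gb[of undefined] by linarith
  have "0 < r / (4 * (c + 1))" using r c0 by simp
  from LIMSEQ_D[OF L1 this] obtain n0 where n0: "\<And>n. n \<ge> n0 \<Longrightarrow> (\<integral>y. \<bar>?\<rho> n y - ?\<rho>lim y\<bar> \<partial>?P) < r / (4 * (c + 1))"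
    by (auto simp: abs_of_nonneg Bochner_Integration.integral_nonneg)
  show "\<exists>no. \<forall>n\<ge>no. norm ((\<integral>\<omega>. G (\<lambda>i. B n (t i) \<omega>) \<partial>M n) - (\<integral>\<omega>. G (\<lambda>i. B0 (t i) \<omega>) \<partial>M0)) < r"
  proof (intro exI[of _ n0] allI impI)
    fix n assume n: "n0 \<le> n"
    have a: "\<bar>(\<integral>y. G y * ?\<rho> n y \<partial>?P) - (\<integral>\<omega>. G (\<lambda>i. B n (t i) \<omega>) \<partial>M n)\<bar> \<le> r / 4"
      using smoothed_expectation_close[where X = "\<lambda>j. B n (t j)" and M = "M n", OF p m e Gb G C] eb by linarith
    have b: "\<bar>(\<integral>y. G y * ?\<rho>lim y \<partial>?P) - (\<integral>\<omega>. G (\<lambda>i. B0 (t i) \<omega>) \<partial>M0)\<bar> \<le> r / 4"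
      using smoothed_expectation_close[where X = "\<lambda>j. B0 (t j)" and M = M0, OF p0 m0 e Gb G C] eb by linarith
    have i1: "integrable ?P (\<lambda>y. G y * ?\<rho> n y)" by (rule smoothed_density_integral(1)[where X = "\<lambda>j. B n (t j)" and M = "M n", OF p m e Gb Gm])
    have i2: "integrable ?P (\<lambda>y. G y * ?\<rho>lim y)" by (rule smoothed_density_integral(1)[where X = "\<lambda>j. B0 (t j)" and M = M0, OF p0 m0 e Gb Gm])
    have "\<bar>(\<integral>y. G y * ?\<rho> n y \<partial>?P) - (\<integral>y. G y * ?\<rho>lim y \<partial>?P)\<bar> = \<bar>\<integral>y. G y * ?\<rho> n y - G y * ?\<rho>lim y \<partial>?P\<bar>"
      using i1 i2 by simp
    also have "\<dots> \<le> (\<integral>y. \<bar>G y * ?\<rho> n y - G y * ?\<rho>lim y\<bar> \<partial>?P)" by (rule integral_abs_bound)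
    also have "\<dots> \<le> (\<integral>y. c * \<bar>?\<rho> n y - ?\<rho>lim y\<bar> \<partial>?P)"
    proof (rule integral_mono)
      show "integrable ?P (\<lambda>y. \<bar>G y * ?\<rho> n y - G y * ?\<rho>lim y\<bar>)" using i1 i2 by auto
      show "integrable ?P (\<lambda>y. c * \<bar>?\<rho> n y - ?\<rho>lim y\<bar>)" using one_i one_i0 by auto
      show "\<bar>G y * ?\<rho> n y - G y * ?\<rho>lim y\<bar> \<le> c * \<bar>?\<rho> n y - ?\<rho>lim y\<bar>" for y
        using Gb[of y] by (simp add: abs_mult mult_right_mono flip: right_diff_distrib)
    qed
    also have "\<dots> = c * (\<integral>y. \<bar>?\<rho> n y - ?\<rho>lim y\<bar> \<partial>?P)" by simp
    also have "\<dots> \<le> (c + 1) * (r / (4 * (c + 1)))"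
      using n0[OF n] c0 by (intro mult_mono) (auto intro: less_imp_le simp: Bochner_Integration.integral_nonneg)
    also have "\<dots> = r / 4"
    proof -
      have "c + 1 \<noteq> 0" using c0 by linarith
      then show ?thesis by (simp add: divide_simps)
    qed
    finally show "norm ((\<integral>\<omega>. G (\<lambda>i. B n (t i) \<omega>) \<partial>M n) - (\<integral>\<omega>. G (\<lambda>i. B0 (t i) \<omega>) \<partial>M0)) < r"
      using a b r unfolding real_norm_def by linarith
  qed
qed

section \<open>Discretization in time and weak convergence\<close>

definition grid :: "real \<Rightarrow> nat \<Rightarrow> nat \<Rightarrow> real" where
  "grid T N j = real j * T / real N"

text \<open>The Riemann sum for \<open>\<integral>\<^sub>0\<^sup>t tri e (b\<^sub>r - x) dr\<close> from the values \<open>v j\<close> of \<open>b\<close> at the grid times. The weights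
are the lengths of the grid cells cut off at \<open>t\<close>, so that the sum is continuous in \<open>t\<close>.\<close>

definition riemann_occupation :: "real \<Rightarrow> nat \<Rightarrow> real \<Rightarrow> (nat \<Rightarrow> real) \<Rightarrow> real \<times> real \<Rightarrow> real" where
  "riemann_occupation T N e v = (\<lambda>(x, t). \<Sum>j<N. (min t (grid T N (Suc j)) - min t (grid T N j)) * tri e (v j - x))"

lemma grid_nonneg: "0 < T \<Longrightarrow> 0 \<le> grid T N j" by (simp add: grid_def)

lemma grid_Suc: "N > 0 \<Longrightarrow> grid T N (Suc j) = grid T N j + T / N"
  by (simp add: grid_def field_simps)

lemma grid_end: "N > 0 \<Longrightarrow> grid T N N = T" by (simp add: grid_def)

lemma grid_step_bounds:
  assumes "0 < T" "N > 0"
  shows "grid T N j \<le> grid T N (Suc j)"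
    "0 \<le> min t (grid T N (Suc j)) - min t (grid T N j)" "min t (grid T N (Suc j)) - min t (grid T N j) \<le> T / N"
proof -
  have "0 \<le> T / real N" using assms by simp
  then show "grid T N j \<le> grid T N (Suc j)"
    "0 \<le> min t (grid T N (Suc j)) - min t (grid T N j)" "min t (grid T N (Suc j)) - min t (grid T N j) \<le> T / N"
    using grid_Suc[OF assms(2), of T j] by linarith+
qed

lemma riemann_occupation_continuous: "continuous_on S (riemann_occupation T N e v)"
  unfolding riemann_occupation_def case_prod_beta' by (intro continuous_intros)

lemma riemann_occupation_lipschitz:
  assumes "0 < T" "N > 0" "e > 0"
  shows "\<bar>riemann_occupation T N e v p - riemann_occupation T N e v' p\<bar> \<le> T / N / e\<^sup>2 * (\<Sum>j<N. \<bar>v j - v' j\<bar>)"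
proof -
  obtain x t where p: "p = (x, t)" by (cases p)
  have "riemann_occupation T N e v p - riemann_occupation T N e v' p
     = (\<Sum>j<N. (min t (grid T N (Suc j)) - min t (grid T N j)) * (tri e (v j - x) - tri e (v' j - x)))"
    by (simp add: riemann_occupation_def p right_diff_distrib sum_subtractf)
  also have "\<bar>\<dots>\<bar> \<le> (\<Sum>j<N. T / N * (\<bar>v j - v' j\<bar> / e\<^sup>2))"
  proof (rule order_trans[OF sum_abs sum_mono])
    fix j
    have "\<bar>tri e (v j - x) - tri e (v' j - x)\<bar> \<le> \<bar>v j - v' j\<bar> / e\<^sup>2"
      using tri_lipschitz[of e "v j - x" "v' j - x"] by simp
    then show "\<bar>(min t (grid T N (Suc j)) - min t (grid T N j)) * (tri e (v j - x) - tri e (v' j - x))\<bar> \<le> T / N * (\<bar>v j - v' j\<bar> / e\<^sup>2)"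
      unfolding abs_mult using grid_step_bounds[OF assms(1,2)] assms by (intro mult_mono) auto
  qed
  finally show ?thesis by (simp add: sum_distrib_left)
qed

lemma riemann_occupation_close:
  assumes T: "0 < T" and N: "N > 0" and e: "e > 0" and b: "continuous_on UNIV b" and t: "0 \<le> t" "t \<le> T"
  shows "\<bar>integral {0..t} (\<lambda>r. tri e (b r - x)) - riemann_occupation T N e (\<lambda>j. b (grid T N j)) (x, t)\<bar>
    \<le> (\<Sum>j<N. integral {grid T N j..grid T N (Suc j)} (\<lambda>r. \<bar>b r - b (grid T N j)\<bar>)) / e\<^sup>2"
proof -
  let ?g = "\<lambda>r. tri e (b r - x)"
  let ?s = "\<lambda>j. min t (grid T N j)"
  have gi: "?g integrable_on {p..q}" for p q
    by (intro integrable_continuous_interval tri_continuous continuous_intros continuous_on_subset[OF b]) auto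
  have bi: "(\<lambda>r. \<bar>b r - c\<bar>) integrable_on {p..q}" for p q c
    by (intro integrable_continuous_interval continuous_intros continuous_on_subset[OF b]) auto
  have split: "integral {0..?s k} ?g = (\<Sum>j<k. integral {?s j..?s (Suc j)} ?g)" for k
  proof (induction k)
    case 0
    have "?s 0 = 0" using t by (simp add: grid_def)
    then show ?case by simp
  next
    case (Suc k)
    have "0 \<le> ?s k" "?s k \<le> ?s (Suc k)" using t grid_nonneg[OF T] grid_step_bounds(2)[OF T N, of t k] by auto
    then show ?case using Henstock_Kurzweil_Integration.integral_combine[OF _ _ gi, of 0 "?s k" "?s (Suc k)"] Suc by simp
  qed
  have "?s N = t" using t grid_end[OF N] by simp
  then have sum_eq: "integral {0..t} ?g - riemann_occupation T N e (\<lambda>j. b (grid T N j)) (x, t)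
     = (\<Sum>j<N. integral {?s j..?s (Suc j)} ?g - (?s (Suc j) - ?s j) * ?g (grid T N j))"
    using split[of N] by (simp add: riemann_occupation_def sum_subtractf)
  have "\<bar>\<Sum>j<N. integral {?s j..?s (Suc j)} ?g - (?s (Suc j) - ?s j) * ?g (grid T N j)\<bar>
      \<le> (\<Sum>j<N. integral {grid T N j..grid T N (Suc j)} (\<lambda>r. \<bar>b r - b (grid T N j)\<bar>) / e\<^sup>2)"
  proof (rule order_trans[OF sum_abs sum_mono])
    fix j
    let ?G = "grid T N j" and ?G' = "grid T N (Suc j)"
    have nn: "0 \<le> integral {?G..?G'} (\<lambda>r. \<bar>b r - b ?G\<bar>)" by (intro Henstock_Kurzweil_Integration.integral_nonneg bi) auto
    show "\<bar>integral {?s j..?s (Suc j)} ?g - (?s (Suc j) - ?s j) * ?g ?G\<bar> \<le> integral {?G..?G'} (\<lambda>r. \<bar>b r - b ?G\<bar>) / e\<^sup>2"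
    proof (cases "?s j < ?s (Suc j)")
      case False
      then have eq: "?s j = ?s (Suc j)" using grid_step_bounds(2)[OF T N, of t j] by linarith
      have "\<bar>integral {c..c} ?g - (c - c) * ?g ?G\<bar> \<le> integral {?G..?G'} (\<lambda>r. \<bar>b r - b ?G\<bar>) / e\<^sup>2" for c
        using nn by simp
      then show ?thesis unfolding eq .
    next
      case True
      then have sj: "?s j = ?G" by (auto simp: min_def split: if_splits)
      have "integral {?s j..?s (Suc j)} ?g - (?s (Suc j) - ?s j) * ?g ?G = integral {?s j..?s (Suc j)} (\<lambda>r. ?g r - ?g ?G)"
        using True gi by (subst Henstock_Kurzweil_Integration.integral_diff) auto
      also have "\<bar>\<dots>\<bar> \<le> integral {?s j..?s (Suc j)} (\<lambda>r. \<bar>b r - b ?G\<bar> / e\<^sup>2)"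
        unfolding real_norm_def[symmetric]
      proof (rule integral_norm_bound_integral)
        show "(\<lambda>r. ?g r - ?g ?G) integrable_on {?s j..?s (Suc j)}" by (intro Henstock_Kurzweil_Integration.integrable_diff gi) auto
        show "(\<lambda>r. norm (b r - b ?G) / e\<^sup>2) integrable_on {?s j..?s (Suc j)}"
          unfolding real_norm_def by (intro integrable_on_divide bi)
        show "norm (?g r - ?g ?G) \<le> norm (b r - b ?G) / e\<^sup>2" for r
          using tri_lipschitz[of e "b r - x" "b ?G - x"] by simp
      qed
      also have "\<dots> = integral {?G..?s (Suc j)} (\<lambda>r. \<bar>b r - b ?G\<bar>) / e\<^sup>2" unfolding sj by simp
      also have "\<dots> \<le> integral {?G..?G'} (\<lambda>r. \<bar>b r - b ?G\<bar>) / e\<^sup>2"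
        by (intro divide_right_mono integral_subset_le bi) auto
      finally show ?thesis .
    qed
  qed
  then show ?thesis unfolding sum_eq sum_divide_distrib .
qed

text \<open>By Fubini the mean is the time integral of \<open>E |B\<^sub>r - B\<^sub>g|\<close> for the grid time \<open>g\<close> before \<open>r\<close>, and this is at
most \<open>(T/N)\<^sup>H \<le> (T/N)\<^sup>a\<close> as \<open>T \<le> N\<close>.\<close>

lemma fbm_path_oscillation_mean:
  assumes B: "fractional_brownian_motion H M B" and H: "0 \<le> a" "a \<le> H" and T: "0 < T" and N: "N > 0" "T \<le> N"
  shows "integrable M (\<lambda>\<omega>. \<Sum>j<N. integral {grid T N j..grid T N (Suc j)} (\<lambda>r. \<bar>B (max 0 r) \<omega> - B (grid T N j) \<omega>\<bar>))" (is "integrable M ?Z")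
    "(\<integral>\<omega>. (\<Sum>j<N. integral {grid T N j..grid T N (Suc j)} (\<lambda>r. \<bar>B (max 0 r) \<omega> - B (grid T N j) \<omega>\<bar>)) \<partial>M) \<le> T * (T / N) powr a"
proof -
  interpret prob_space M by (rule fbm_prob_space[OF B])
  interpret MP: pair_sigma_finite M "lborel :: real measure" ..
  define z where "z = (\<lambda>j \<omega> r. indicator {grid T N j..grid T N (Suc j)} r * \<bar>B (max 0 r) \<omega> - B (grid T N j) \<omega>\<bar>)"
  define Z where "Z = (\<lambda>j \<omega>. integral {grid T N j..grid T N (Suc j)} (\<lambda>r. \<bar>B (max 0 r) \<omega> - B (grid T N j) \<omega>\<bar>))"
  note jm = fbm_jointly_measurable[OF B, measurable]
  have zm: "(\<lambda>p. z j (fst p) (snd p)) \<in> borel_measurable (M \<Otimes>\<^sub>M lborel)" for j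
  proof -
    note fbm_borel_measurable[OF B grid_nonneg[OF T], measurable]
    have "(\<lambda>p. indicator {grid T N j..grid T N (Suc j)} (snd p) * \<bar>(case p of (\<omega>, r) \<Rightarrow> B (max 0 r) \<omega>) - B (grid T N j) (fst p)\<bar>) \<in> borel_measurable (M \<Otimes>\<^sub>M lborel)"
      by measurable
    then show ?thesis by (simp add: z_def case_prod_beta')
  qed
  have znn: "0 \<le> z j \<omega> r" for j \<omega> r by (simp add: z_def)
  have Zz: "ennreal (Z j \<omega>) = (\<integral>\<^sup>+r. ennreal (z j \<omega> r) \<partial>lborel)" if \<omega>: "\<omega> \<in> space M" for j \<omega>
  proof -
    have "((\<lambda>r. \<bar>B (max 0 r) \<omega> - B (grid T N j) \<omega>\<bar>) has_integral Z j \<omega>) {grid T N j..grid T N (Suc j)}"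
      unfolding Z_def by (intro integrable_integral integrable_continuous_interval continuous_intros continuous_on_subset[OF fbm_path_continuous[OF B \<omega>]]) auto
    then show ?thesis unfolding z_def by (subst nn_integral_has_integral_lebesgue) auto
  qed
  have Znn: "0 \<le> Z j \<omega>" if "\<omega> \<in> space M" for j \<omega>
    unfolding Z_def by (intro Henstock_Kurzweil_Integration.integral_nonneg integrable_continuous_interval continuous_intros continuous_on_subset[OF fbm_path_continuous[OF B that]]) auto
  have Zm: "Z j \<in> borel_measurable M" for j
  proof -
    have "(\<lambda>\<omega>. enn2real (\<integral>\<^sup>+r. ennreal (z j \<omega> r) \<partial>lborel)) \<in> borel_measurable M"
    proof -
      have "(\<lambda>\<omega>. \<integral>\<^sup>+r. ennreal (z j \<omega> r) \<partial>lborel) \<in> borel_measurable M"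
        using zm[of j] by (intro lborel.borel_measurable_nn_integral) (simp add: case_prod_beta')
      then show ?thesis by measurable
    qed
    then show ?thesis
      by (rule measurable_cong[THEN iffD1, rotated]) (simp add: Zz[symmetric] Znn)
  qed
  have bound: "(\<integral>\<^sup>+\<omega>. ennreal (Z j \<omega>) \<partial>M) \<le> ennreal (T / N * (T / N) powr a)" for j
  proof -
    have "(\<integral>\<^sup>+\<omega>. ennreal (Z j \<omega>) \<partial>M) = (\<integral>\<^sup>+\<omega>. (\<integral>\<^sup>+r. ennreal (z j \<omega> r) \<partial>lborel) \<partial>M)"
      using Zz by (intro nn_integral_cong) auto
    also have "\<dots> = (\<integral>\<^sup>+r. (\<integral>\<^sup>+\<omega>. ennreal (z j \<omega> r) \<partial>M) \<partial>lborel)"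
      using MP.Fubini'[of "\<lambda>\<omega> r. ennreal (z j \<omega> r)"] zm[of j] by (simp add: case_prod_beta')
    also have "\<dots> \<le> (\<integral>\<^sup>+r. ennreal ((T / N) powr a) * indicator {grid T N j..grid T N (Suc j)} r \<partial>lborel)"
    proof (rule nn_integral_mono)
      fix r
      show "(\<integral>\<^sup>+\<omega>. ennreal (z j \<omega> r) \<partial>M) \<le> ennreal ((T / N) powr a) * indicator {grid T N j..grid T N (Suc j)} r"
      proof (cases "r \<in> {grid T N j..grid T N (Suc j)}")
        case True
        then have r: "0 \<le> r" "\<bar>r - grid T N j\<bar> \<le> T / N" using grid_nonneg[OF T, of N j] by (auto simp: grid_Suc[OF N(1)])
        have "(\<integral>\<^sup>+\<omega>. ennreal (z j \<omega> r) \<partial>M) = (\<integral>\<^sup>+\<omega>. ennreal \<bar>B r \<omega> - B (grid T N j) \<omega>\<bar> \<partial>M)"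
          using True r by (simp add: z_def max_absorb2)
        also have "\<dots> = ennreal (\<integral>\<omega>. \<bar>B r \<omega> - B (grid T N j) \<omega>\<bar> \<partial>M)"
          by (intro nn_integral_eq_integral fbm_increment_mean_abs(1)[OF B r(1) grid_nonneg[OF T]]) auto
        also have "\<dots> \<le> ennreal ((T / N) powr a)"
        proof (rule ennreal_leI)
          have "(\<integral>\<omega>. \<bar>B r \<omega> - B (grid T N j) \<omega>\<bar> \<partial>M) \<le> \<bar>r - grid T N j\<bar> powr H"
            by (rule fbm_increment_mean_abs(2)[OF B r(1) grid_nonneg[OF T]])
          also have "\<dots> \<le> (T / N) powr H" using r(2) H by (intro powr_mono2) auto
          also have "\<dots> \<le> (T / N) powr a" using H T N by (intro powr_mono') auto
          finally show "(\<integral>\<omega>. \<bar>B r \<omega> - B (grid T N j) \<omega>\<bar> \<partial>M) \<le> (T / N) powr a" .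
        qed
        finally show ?thesis using True by simp
      qed (simp add: z_def)
    qed
    also have "\<dots> = ennreal ((T / N) powr a) * ennreal (T / N)"
      using T by (simp add: nn_integral_cmult_indicator emeasure_lborel_Icc_eq grid_Suc[OF N(1)])
    also have "\<dots> = ennreal (T / N * (T / N) powr a)" using T by (simp add: ennreal_mult[symmetric] mult.commute)
    finally show ?thesis .
  qed
  have Zi: "integrable M (Z j)" for j
  proof (rule integrableI_nonneg[OF Zm])
    show "AE \<omega> in M. 0 \<le> Z j \<omega>" using Znn by (intro AE_I2)
    show "(\<integral>\<^sup>+\<omega>. ennreal (Z j \<omega>) \<partial>M) < \<infinity>" using bound[of j] by (simp add: le_less_trans)
  qed
  have Zv: "(\<integral>\<omega>. Z j \<omega> \<partial>M) \<le> T / N * (T / N) powr a" for j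
  proof -
    have "ennreal (\<integral>\<omega>. Z j \<omega> \<partial>M) = (\<integral>\<^sup>+\<omega>. ennreal (Z j \<omega>) \<partial>M)"
      using Znn by (intro nn_integral_eq_integral[symmetric] Zi AE_I2)
    also have "\<dots> \<le> ennreal (T / N * (T / N) powr a)" by (rule bound)
    finally show ?thesis using T by (subst (asm) ennreal_le_iff) auto
  qed
  show "integrable M ?Z" using Zi unfolding Z_def by (intro Bochner_Integration.integrable_sum)
  have "(\<integral>\<omega>. (\<Sum>j<N. Z j \<omega>) \<partial>M) = (\<Sum>j<N. \<integral>\<omega>. Z j \<omega> \<partial>M)" using Zi by (intro Bochner_Integration.integral_sum)
  also have "\<dots> \<le> (\<Sum>j<N. T / N * (T / N) powr a)" by (intro sum_mono Zv)
  also have "\<dots> = T * (T / N) powr a" using N by simp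
  finally show "(\<integral>\<omega>. (\<Sum>j<N. integral {grid T N j..grid T N (Suc j)} (\<lambda>r. \<bar>B (max 0 r) \<omega> - B (grid T N j) \<omega>\<bar>)) \<partial>M) \<le> T * (T / N) powr a"
    unfolding Z_def .
qed

text \<open>On the exceptional event \<open>E\<close> the two values of \<open>F\<close> differ by at most \<open>2 c\<close>. Elsewhere the distance of
the two functions is at most \<open>\<eta>\<close>, the error of mollification, plus \<open>\<epsilon>\<^sup>-\<^sup>2\<close> times the mean oscillation of
the path over the grid cells.\<close>

lemma local_time_functional_approximation:
  fixes F :: "(real \<times> real \<Rightarrow> real) \<Rightarrow> real" and \<eta> T D :: real
  defines "K \<equiv> {-D..D} \<times> {0..T}"
  assumes B: "fractional_brownian_motion H M B" and L: "local_time M B L" and J: "jointly_continuous M L"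
    and H: "0 \<le> a" "a \<le> H" and D: "0 < D" and T: "0 < T" and N: "N > 0" "T \<le> N" and e: "\<epsilon> > 0"
    and Fb: "\<And>f. f \<in> C_space K \<Longrightarrow> \<bar>F f\<bar> \<le> c"
    and Fl: "\<And>f g. f \<in> C_space K \<Longrightarrow> g \<in> C_space K \<Longrightarrow> \<bar>F f - F g\<bar> \<le> l * C_dist K f g" and l: "0 \<le> l"
    and \<eta>: "0 \<le> \<eta>"
    and E: "E \<in> sets M" "measure M E \<le> \<eta>"
      "\<And>\<omega> x t. \<omega> \<in> space M - E \<Longrightarrow> x \<in> {-D..D} \<Longrightarrow> t \<in> {0..T} \<Longrightarrow> \<bar>integral {0..t} (\<lambda>r. tri \<epsilon> (B (max 0 r) \<omega> - x)) - L x t \<omega>\<bar> \<le> \<eta>"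
  shows "\<bar>(\<integral>\<omega>. F (restrict (\<lambda>(x, t). L x t \<omega>) K) \<partial>M)
      - (\<integral>\<omega>. F (restrict (riemann_occupation T N \<epsilon> (\<lambda>j. B (grid T N j) \<omega>)) K) \<partial>M)\<bar>
    \<le> 2 * c * \<eta> + l * \<eta> + l / \<epsilon>\<^sup>2 * (T * (T / N) powr a)"
proof -
  interpret prob_space M by (rule fbm_prob_space[OF B])
  have Kc: "compact K" unfolding K_def by (intro compact_Times) auto
  define Z where "Z = (\<lambda>\<omega>. \<Sum>j<N. integral {grid T N j..grid T N (Suc j)} (\<lambda>r. \<bar>B (max 0 r) \<omega> - B (grid T N j) \<omega>\<bar>))"
  have Zi: "integrable M Z" and Zv: "(\<integral>\<omega>. Z \<omega> \<partial>M) \<le> T * (T / N) powr a"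
    unfolding Z_def using fbm_path_oscillation_mean[OF B H T N] by auto
  let ?L = "\<lambda>\<omega>. restrict (\<lambda>(x, t). L x t \<omega>) K"
  let ?R = "\<lambda>\<omega>. restrict (riemann_occupation T N \<epsilon> (\<lambda>j. B (grid T N j) \<omega>)) K"
  have Lcont: "continuous_on K (\<lambda>(x, t). L x t \<omega>)" if "\<omega> \<in> space M" for \<omega>
    using J that unfolding jointly_continuous_def K_def by (auto elim!: continuous_on_subset)
  have LC: "?L \<omega> \<in> C_space K" if "\<omega> \<in> space M" for \<omega> by (rule restrict_in_C_space[OF Lcont[OF that]])
  have RC: "restrict (riemann_occupation T N \<epsilon> v) K \<in> C_space K" for v
    by (rule restrict_in_C_space[OF riemann_occupation_continuous])
  have c0: "0 \<le> c" using Fb[OF RC[of "\<lambda>_. 0"]] by linarith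
  have FLm: "(\<lambda>\<omega>. F (?L \<omega>)) \<in> borel_measurable M"
  proof -
    have "(\<lambda>\<omega>. F (restrict (\<lambda>p. (\<lambda>p \<omega>. L (fst p) (snd p) \<omega>) p \<omega>) K)) \<in> borel_measurable M"
    proof (rule lipschitz_functional_measurable[OF Kc _ _ Fl l])
      show "(\<lambda>\<omega>. L (fst p) (snd p) \<omega>) \<in> borel_measurable M" if "p \<in> K" for p
        using L that by (auto simp: local_time_def K_def)
      show "continuous_on K (\<lambda>p. L (fst p) (snd p) \<omega>)" if "\<omega> \<in> space M" for \<omega>
        using Lcont[OF that] by (simp add: case_prod_beta')
    qed
    then show ?thesis by (simp add: case_prod_beta')
  qed
  have Rlip: "\<bar>F (restrict (riemann_occupation T N \<epsilon> v) K) - F (restrict (riemann_occupation T N \<epsilon> v') K)\<bar>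
     \<le> l * (T / N / \<epsilon>\<^sup>2) * (\<Sum>j<N. \<bar>v j - v' j\<bar>)" for v v'
  proof -
    have "C_dist K (restrict (riemann_occupation T N \<epsilon> v) K) (restrict (riemann_occupation T N \<epsilon> v') K) \<le> T / N / \<epsilon>\<^sup>2 * (\<Sum>j<N. \<bar>v j - v' j\<bar>)"
      using riemann_occupation_lipschitz[OF T N(1) e] T by (intro C_dist_le mult_nonneg_nonneg sum_nonneg) auto
    then have "l * C_dist K (restrict (riemann_occupation T N \<epsilon> v) K) (restrict (riemann_occupation T N \<epsilon> v') K) \<le> l * (T / N / \<epsilon>\<^sup>2 * (\<Sum>j<N. \<bar>v j - v' j\<bar>))"
      using l by (rule mult_left_mono)
    then show ?thesis using Fl[OF RC RC, of v v'] by (simp add: mult.assoc)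
  qed
  have FRm: "(\<lambda>\<omega>. F (?R \<omega>)) \<in> borel_measurable M"
    by (rule lipschitz_coordinates_measurable[where G = "\<lambda>v. F (restrict (riemann_occupation T N \<epsilon> v) K)", OF Rlip])
       (rule fbm_borel_measurable[OF B grid_nonneg[OF T]])
  have FLi: "integrable M (\<lambda>\<omega>. F (?L \<omega>))"
    by (rule integrable_const_bound[OF _ FLm, of c]) (use Fb LC in \<open>auto intro!: AE_I2\<close>)
  have FRi: "integrable M (\<lambda>\<omega>. F (?R \<omega>))"
    by (rule integrable_const_bound[OF _ FRm, of c]) (use Fb RC in \<open>auto intro!: AE_I2\<close>)
  have pw: "\<bar>F (?L \<omega>) - F (?R \<omega>)\<bar> \<le> 2 * c * indicator E \<omega> + (l * \<eta> + l / \<epsilon>\<^sup>2 * Z \<omega>)" if \<omega>: "\<omega> \<in> space M" for \<omega>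
  proof -
    have Znn: "0 \<le> Z \<omega>"
      unfolding Z_def by (intro sum_nonneg Henstock_Kurzweil_Integration.integral_nonneg integrable_continuous_interval continuous_intros
        continuous_on_subset[OF fbm_path_continuous[OF B \<omega>]]) auto
    show ?thesis
    proof (cases "\<omega> \<in> E")
      case True
      have "\<bar>F (?L \<omega>) - F (?R \<omega>)\<bar> \<le> 2 * c" using Fb[OF LC[OF \<omega>]] Fb[OF RC[of "\<lambda>j. B (grid T N j) \<omega>"]] by linarith
      moreover have "0 \<le> l * \<eta> + l / \<epsilon>\<^sup>2 * Z \<omega>" using l \<eta> Znn by simp
      ultimately show ?thesis using True by simp
    next
      case False
      have "C_dist K (?L \<omega>) (?R \<omega>) \<le> \<eta> + Z \<omega> / \<epsilon>\<^sup>2"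
      proof (rule C_dist_le)
        show "0 \<le> \<eta> + Z \<omega> / \<epsilon>\<^sup>2" using \<eta> Znn by simp
        fix p assume p: "p \<in> K"
        obtain x t where xt: "p = (x, t)" by (cases p)
        have x: "x \<in> {-D..D}" and t: "t \<in> {0..T}" using p by (auto simp: xt K_def)
        have mg: "max 0 (grid T N j) = grid T N j" for j using grid_nonneg[OF T, of N j] by simp
        have "\<bar>integral {0..t} (\<lambda>r. tri \<epsilon> (B (max 0 r) \<omega> - x)) - L x t \<omega>\<bar> \<le> \<eta>" using \<omega> False x t by (intro E(3)) auto
        moreover have "\<bar>integral {0..t} (\<lambda>r. tri \<epsilon> (B (max 0 r) \<omega> - x)) - riemann_occupation T N \<epsilon> (\<lambda>j. B (grid T N j) \<omega>) (x, t)\<bar> \<le> Z \<omega> / \<epsilon>\<^sup>2"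
          unfolding Z_def using riemann_occupation_close[OF T N(1) e fbm_path_continuous[OF B \<omega>], of t x] t by (simp add: mg)
        ultimately show "\<bar>?L \<omega> p - ?R \<omega> p\<bar> \<le> \<eta> + Z \<omega> / \<epsilon>\<^sup>2" using p by (simp add: xt)
      qed
      then have "l * C_dist K (?L \<omega>) (?R \<omega>) \<le> l * (\<eta> + Z \<omega> / \<epsilon>\<^sup>2)" using l by (rule mult_left_mono)
      then show ?thesis using Fl[OF LC[OF \<omega>] RC, of "\<lambda>j. B (grid T N j) \<omega>"] False by (simp add: distrib_left)
    qed
  qed
  have "(\<integral>\<omega>. F (?L \<omega>) \<partial>M) - (\<integral>\<omega>. F (?R \<omega>) \<partial>M) = (\<integral>\<omega>. F (?L \<omega>) - F (?R \<omega>) \<partial>M)" using FLi FRi by simp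
  also have "\<bar>\<dots>\<bar> \<le> (\<integral>\<omega>. \<bar>F (?L \<omega>) - F (?R \<omega>)\<bar> \<partial>M)" by (rule integral_abs_bound)
  also have "\<dots> \<le> (\<integral>\<omega>. 2 * c * indicator E \<omega> + (l * \<eta> + l / \<epsilon>\<^sup>2 * Z \<omega>) \<partial>M)"
  proof (rule integral_mono)
    show "integrable M (\<lambda>\<omega>. \<bar>F (?L \<omega>) - F (?R \<omega>)\<bar>)" using FLi FRi by auto
    show "integrable M (\<lambda>\<omega>. 2 * c * indicator E \<omega> + (l * \<eta> + l / \<epsilon>\<^sup>2 * Z \<omega>))"
      using Zi E(1) by (intro Bochner_Integration.integrable_add integrable_mult_right) (auto simp: less_top[symmetric])
  qed (rule pw)
  also have "\<dots> = 2 * c * measure M E + (l * \<eta> + l / \<epsilon>\<^sup>2 * (\<integral>\<omega>. Z \<omega> \<partial>M))"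
  proof -
    have i1: "integrable M (\<lambda>\<omega>. 2 * c * indicator E \<omega>)" using E(1) by (intro integrable_mult_right) (auto simp: less_top[symmetric])
    have i2: "integrable M (\<lambda>\<omega>. l / \<epsilon>\<^sup>2 * Z \<omega>)" using Zi by (rule integrable_mult_right)
    have "(\<integral>\<omega>. 2 * c * indicator E \<omega> + (l * \<eta> + l / \<epsilon>\<^sup>2 * Z \<omega>) \<partial>M) = (\<integral>\<omega>. 2 * c * indicator E \<omega> \<partial>M) + (\<integral>\<omega>. l * \<eta> + l / \<epsilon>\<^sup>2 * Z \<omega> \<partial>M)"
      using i1 i2 by (intro Bochner_Integration.integral_add) auto
    also have "(\<integral>\<omega>. l * \<eta> + l / \<epsilon>\<^sup>2 * Z \<omega> \<partial>M) = l * \<eta> + l / \<epsilon>\<^sup>2 * (\<integral>\<omega>. Z \<omega> \<partial>M)"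
      using i2 by (subst Bochner_Integration.integral_add) (auto simp: prob_space)
    also have "(\<integral>\<omega>. 2 * c * indicator E \<omega> \<partial>M) = 2 * c * measure M E" using E(1) by simp
    finally show ?thesis .
  qed
  also have "\<dots> \<le> 2 * c * \<eta> + (l * \<eta> + l / \<epsilon>\<^sup>2 * (T * (T / N) powr a))"
    using E(2) Zv c0 l by (intro add_mono mult_left_mono order_refl) auto
  finally show ?thesis by (simp only: add.assoc)
qed

text \<open>First \<open>\<eta>\<close>, then \<open>\<epsilon>\<close> and then \<open>N\<close> are chosen so that the discretization error is below \<open>r/3\<close>
simultaneously for \<open>H\<close> and for all Hurst parameters near it. The discretized expectations converge.\<close>

lemma local_time_lipschitz_convergence:
  fixes F :: "(real \<times> real \<Rightarrow> real) \<Rightarrow> real" and T D :: real and h :: "nat \<Rightarrow> real"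
    and M :: "nat \<Rightarrow> 'w measure" and M0 :: "'w measure"
  defines "K \<equiv> {-D..D} \<times> {0..T}"
  assumes B: "\<And>n. fractional_brownian_motion (h n) (M n) (B n)" and L: "\<And>n. local_time (M n) (B n) (L n)" and J: "\<And>n. jointly_continuous (M n) (L n)"
    and B0: "fractional_brownian_motion H M0 B0" and L0: "local_time M0 B0 L0" and J0: "jointly_continuous M0 L0"
    and h: "h \<longlonglongrightarrow> H" and H: "0 < H" "H < 1" and D: "0 < D" and T: "0 < T"
    and Fb: "\<And>f. f \<in> C_space K \<Longrightarrow> \<bar>F f\<bar> \<le> c"
    and Fl: "\<And>f g. f \<in> C_space K \<Longrightarrow> g \<in> C_space K \<Longrightarrow> \<bar>F f - F g\<bar> \<le> l * C_dist K f g" and l: "0 \<le> l"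
  shows "(\<lambda>n. \<integral>\<omega>. F (restrict (\<lambda>(x, t). L n x t \<omega>) K) \<partial>M n) \<longlonglongrightarrow> (\<integral>\<omega>. F (restrict (\<lambda>(x, t). L0 x t \<omega>) K) \<partial>M0)"
proof (rule tendstoI)
  fix r :: real assume r: "r > 0"
  define a where "a = H / 2"
  define b where "b = (1 + H) / 2"
  have ab: "0 < a" "a < H" "H < b" "b < 1" using H by (auto simp: a_def b_def)
  have RC: "restrict (riemann_occupation T N \<epsilon> v) K \<in> C_space K" for N \<epsilon> v
    by (rule restrict_in_C_space[OF riemann_occupation_continuous])
  have c0: "0 \<le> c" using Fb[OF RC[of 1 1 "\<lambda>_. 0"]] by linarith
  define \<eta> where "\<eta> = r / (8 * (2 * c + l + 1))"
  have pos: "2 * c + l + 1 > 0" using c0 l by linarith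
  have \<eta>: "\<eta> > 0" unfolding \<eta>_def using r pos by simp
  have \<eta>b: "2 * c * \<eta> + l * \<eta> \<le> r / 8"
  proof -
    have "2 * c * \<eta> + l * \<eta> \<le> (2 * c + l + 1) * \<eta>" using \<eta> by (simp add: distrib_right)
    also have "\<dots> = r / 8" unfolding \<eta>_def using pos by (simp add: divide_simps)
    finally show ?thesis .
  qed
  show "\<forall>\<^sub>F n in sequentially. dist (\<integral>\<omega>. F (restrict (\<lambda>(x, t). L n x t \<omega>) K) \<partial>M n) (\<integral>\<omega>. F (restrict (\<lambda>(x, t). L0 x t \<omega>) K) \<partial>M0) < r"
  proof (rule local_time_uniform_approximation[OF ab(1) less_imp_le[OF order_less_trans[OF ab(2,3)]] ab(4) D T \<eta>, where 'w = 'w])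
    fix \<epsilon> :: real
    assume \<epsilon>: "\<epsilon> > 0" and approx: "\<And>H (M :: 'w measure) B L. a \<le> H \<Longrightarrow> H \<le> b \<Longrightarrow> fractional_brownian_motion H M B \<Longrightarrow>
       local_time M B L \<Longrightarrow> jointly_continuous M L \<Longrightarrow>
       \<exists>E\<in>sets M. measure M E \<le> \<eta> \<and> (\<forall>\<omega>\<in>space M - E. \<forall>x\<in>{-D..D}. \<forall>t\<in>{0..T}.
         \<bar>integral {0..t} (\<lambda>r. tri \<epsilon> (B (max 0 r) \<omega> - x)) - L x t \<omega>\<bar> \<le> \<eta>)"
    have "(\<lambda>N. l / \<epsilon>\<^sup>2 * (T * (T / real N) powr a)) \<longlonglongrightarrow> l / \<epsilon>\<^sup>2 * (T * 0)"
    proof (intro tendsto_mult tendsto_const)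
      have "(\<lambda>N. T / real N) \<longlonglongrightarrow> 0" by (rule lim_const_over_n)
      then show "(\<lambda>N. (T / real N) powr a) \<longlonglongrightarrow> 0"
        using ab(1) T by (intro tendsto_powr'[where b = a and a = 0, simplified]) (auto intro!: always_eventually)
    qed
    then have "\<forall>\<^sub>F N in sequentially. l / \<epsilon>\<^sup>2 * (T * (T / real N) powr a) < r / 8"
      using r by (intro order_tendstoD) auto
    moreover have "\<forall>\<^sub>F N in sequentially. T \<le> real N"
      using eventually_ge_at_top[of "nat \<lceil>T\<rceil>"] by eventually_elim linarith
    moreover have "\<forall>\<^sub>F N :: nat in sequentially. N > 0" by (rule eventually_gt_at_top)
    ultimately have "\<forall>\<^sub>F N in sequentially. l / \<epsilon>\<^sup>2 * (T * (T / real N) powr a) < r / 8 \<and> T \<le> real N \<and> N > 0"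
      by eventually_elim auto
    from eventually_happens'[OF sequentially_bot this]
    obtain N where N: "l / \<epsilon>\<^sup>2 * (T * (T / real N) powr a) < r / 8" "T \<le> real N" "N > 0" by auto
    have close: "\<bar>(\<integral>\<omega>. F (restrict (\<lambda>(x, t). L x t \<omega>) K) \<partial>M)
      - (\<integral>\<omega>. F (restrict (riemann_occupation T N \<epsilon> (\<lambda>j. B (grid T N j) \<omega>)) K) \<partial>M)\<bar> < r / 3"
      if H': "a \<le> H'" "H' \<le> b" and B: "fractional_brownian_motion H' M B" and L: "local_time M B L" and J: "jointly_continuous M L"
      for H' and M :: "'w measure" and B L
    proof -
      obtain E where E: "E \<in> sets M" "measure M E \<le> \<eta>" and Eb: "\<forall>\<omega>\<in>space M - E. \<forall>x\<in>{-D..D}. \<forall>t\<in>{0..T}.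
         \<bar>integral {0..t} (\<lambda>r. tri \<epsilon> (B (max 0 r) \<omega> - x)) - L x t \<omega>\<bar> \<le> \<eta>" using approx[OF H' B L J] by blast
      have "\<bar>(\<integral>\<omega>. F (restrict (\<lambda>(x, t). L x t \<omega>) K) \<partial>M)
        - (\<integral>\<omega>. F (restrict (riemann_occupation T N \<epsilon> (\<lambda>j. B (grid T N j) \<omega>)) K) \<partial>M)\<bar>
        \<le> 2 * c * \<eta> + l * \<eta> + l / \<epsilon>\<^sup>2 * (T * (T / N) powr a)"
        unfolding K_def
        using ab(1) \<eta> by (intro local_time_functional_approximation[OF B L J less_imp_le[OF ab(1)] H'(1) D T N(3,2) \<epsilon>
            Fb[unfolded K_def] Fl[unfolded K_def] l less_imp_le[OF \<eta>] E Eb[rule_format]])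
      then show ?thesis using \<eta>b N(1) r by linarith
    qed
    define l' where "l' = l * (T / N / \<epsilon>\<^sup>2)"
    have "(\<lambda>n. \<integral>\<omega>. F (restrict (riemann_occupation T N \<epsilon> (\<lambda>j. B n (grid T N j) \<omega>)) K) \<partial>M n)
       \<longlonglongrightarrow> (\<integral>\<omega>. F (restrict (riemann_occupation T N \<epsilon> (\<lambda>j. B0 (grid T N j) \<omega>)) K) \<partial>M0)"
    proof (rule fbm_finite_dimensional_convergence[where G = "\<lambda>v. F (restrict (riemann_occupation T N \<epsilon> v) K)" and N = N, OF B B0 h grid_nonneg[OF T] Fb[OF RC]])
      show "0 \<le> l'" unfolding l'_def using l T by simp
      fix v v' :: "nat \<Rightarrow> real"
      have "C_dist K (restrict (riemann_occupation T N \<epsilon> v) K) (restrict (riemann_occupation T N \<epsilon> v') K) \<le> T / N / \<epsilon>\<^sup>2 * (\<Sum>j<N. \<bar>v j - v' j\<bar>)"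
        using riemann_occupation_lipschitz[OF T N(3) \<epsilon>] T by (intro C_dist_le mult_nonneg_nonneg sum_nonneg) auto
      then have "l * C_dist K (restrict (riemann_occupation T N \<epsilon> v) K) (restrict (riemann_occupation T N \<epsilon> v') K) \<le> l * (T / N / \<epsilon>\<^sup>2 * (\<Sum>j<N. \<bar>v j - v' j\<bar>))"
        using l by (rule mult_left_mono)
      then show "\<bar>F (restrict (riemann_occupation T N \<epsilon> v) K) - F (restrict (riemann_occupation T N \<epsilon> v') K)\<bar> \<le> l' * (\<Sum>j<N. \<bar>v j - v' j\<bar>)"
        using Fl[OF RC RC, of N \<epsilon> v N \<epsilon> v'] by (simp add: l'_def mult.assoc)
    qed
    then have "\<forall>\<^sub>F n in sequentially. dist (\<integral>\<omega>. F (restrict (riemann_occupation T N \<epsilon> (\<lambda>j. B n (grid T N j) \<omega>)) K) \<partial>M n)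
       (\<integral>\<omega>. F (restrict (riemann_occupation T N \<epsilon> (\<lambda>j. B0 (grid T N j) \<omega>)) K) \<partial>M0) < r / 3"
      using r by (intro tendstoD) auto
    moreover have "\<forall>\<^sub>F n in sequentially. a < h n" "\<forall>\<^sub>F n in sequentially. h n < b"
      using h ab by (auto intro: order_tendstoD)
    ultimately show ?thesis
    proof eventually_elim
      case (elim n)
      have "\<bar>(\<integral>\<omega>. F (restrict (\<lambda>(x, t). L n x t \<omega>) K) \<partial>M n)
        - (\<integral>\<omega>. F (restrict (riemann_occupation T N \<epsilon> (\<lambda>j. B n (grid T N j) \<omega>)) K) \<partial>M n)\<bar> < r / 3"
        using elim by (intro close[OF _ _ B L J]) auto
      moreover have "\<bar>(\<integral>\<omega>. F (restrict (\<lambda>(x, t). L0 x t \<omega>) K) \<partial>M0)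
        - (\<integral>\<omega>. F (restrict (riemann_occupation T N \<epsilon> (\<lambda>j. B0 (grid T N j) \<omega>)) K) \<partial>M0)\<bar> < r / 3"
        using ab by (intro close[OF _ _ B0 L0 J0]) auto
      ultimately show ?case using elim(1) unfolding dist_real_def by linarith
    qed
  qed
qed

theorem corollary4p1:
  fixes M :: "real \<Rightarrow> 'w measure"
    and B :: "real \<Rightarrow> real \<Rightarrow> 'w \<Rightarrow> real"
    and L :: "real \<Rightarrow> real \<Rightarrow> real \<Rightarrow> 'w \<Rightarrow> real"
    and H\<^sub>0 D T :: real
  assumes "\<And>H. H \<in> {0<..<1} \<Longrightarrow> fractional_brownian_motion H (M H) (B H)"
    and "\<And>H. H \<in> {0<..<1} \<Longrightarrow> local_time (M H) (B H) (L H)"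
    and "\<And>H. H \<in> {0<..<1} \<Longrightarrow> jointly_continuous (M H) (L H)"
    and "H\<^sub>0 \<in> {0<..<1}" and "D > 0" and "T > 0"
  shows "weakly_converges (C_topology ({-D..D} \<times> {0..T}))
           (\<lambda>H. law_on ({-D..D} \<times> {0..T}) (M H) (L H))
           (law_on ({-D..D} \<times> {0..T}) (M H\<^sub>0) (L H\<^sub>0))
           (at H\<^sub>0 within {0<..<1})"
proof -
  define K :: "(real \<times> real) set" where "K = {-D..D} \<times> {0..T}"
  have Kc: "compact K" unfolding K_def by (intro compact_Times) auto
  define X where "X = (\<lambda>H p \<omega>. L H (fst p) (snd p) \<omega>)"
  have Xeq: "(\<lambda>(x, t). L H x t \<omega>) = (\<lambda>p. X H p \<omega>)" for H \<omega> by (simp add: X_def case_prod_beta')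
  have p: "prob_space (M H)" if "H \<in> {0<..<1}" for H by (rule fbm_prob_space[OF assms(1)[OF that]])
  have Xm: "X H p \<in> borel_measurable (M H)" if "H \<in> {0<..<1}" "p \<in> K" for H p
    using assms(2)[OF that(1)] that(2) by (auto simp: X_def local_time_def K_def)
  have Xc: "continuous_on K (\<lambda>p. X H p \<omega>)" if "H \<in> {0<..<1}" "\<omega> \<in> space (M H)" for H \<omega>
  proof -
    have "continuous_on (UNIV \<times> {0..}) (\<lambda>p. X H p \<omega>)"
      using assms(3)[OF that(1)] that(2) unfolding jointly_continuous_def Xeq by blast
    then show ?thesis by (rule continuous_on_subset) (auto simp: K_def)
  qed
  have meas: "(\<lambda>\<omega>. restrict (\<lambda>p. X H p \<omega>) K) \<in> measurable (M H) (borel_of (C_topology K))" if "H \<in> {0<..<1}" for H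
    by (rule C_valued_measurable[OF Kc Xm[OF that] Xc[OF that]])
  have law: "borel_prob_on (C_topology K) (law_on K (M H) (L H))" if "H \<in> {0<..<1}" for H
    using prob_space.prob_space_distr[OF p[OF that] meas[OF that]] by (simp add: borel_prob_on_def law_on_def Xeq)
  have int_law: "integral\<^sup>L (law_on K (M H) (L H)) f = (\<integral>\<omega>. f (restrict (\<lambda>p. X H p \<omega>) K) \<partial>M H)"
    if "H \<in> {0<..<1}" "continuous_map (C_topology K) euclideanreal f" for H f
    unfolding law_on_def Xeq by (rule integral_distr[OF meas[OF that(1)] continuous_functional_measurable[OF that(2)]])
  have "weakly_converges (C_topology K) (\<lambda>H. law_on K (M H) (L H)) (law_on K (M H\<^sub>0) (L H\<^sub>0)) (at H\<^sub>0 within {0<..<1})"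
    unfolding weakly_converges_def
  proof (intro conjI allI impI)
    show "borel_prob_on (C_topology K) (law_on K (M H\<^sub>0) (L H\<^sub>0))" by (rule law[OF assms(4)])
    show "\<forall>\<^sub>F H in at H\<^sub>0 within {0<..<1}. borel_prob_on (C_topology K) (law_on K (M H) (L H))"
      unfolding eventually_at_filter using law by (intro always_eventually) auto
    fix f assume f: "continuous_map (C_topology K) euclideanreal f \<and> bounded (f ` topspace (C_topology K))"
    then obtain c where c: "\<And>g. g \<in> C_space K \<Longrightarrow> \<bar>f g\<bar> \<le> c"
      unfolding topspace_C_topology[OF Kc] bounded_iff by auto
    show "((\<lambda>H. integral\<^sup>L (law_on K (M H) (L H)) f) \<longlongrightarrow> integral\<^sup>L (law_on K (M H\<^sub>0) (L H\<^sub>0)) f) (at H\<^sub>0 within {0<..<1})"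
      unfolding tendsto_at_iff_sequentially
    proof (intro allI impI)
      fix h :: "nat \<Rightarrow> real" assume h: "\<forall>i. h i \<in> {0<..<1} - {H\<^sub>0}" "h \<longlonglongrightarrow> H\<^sub>0"
      have h01: "h n \<in> {0<..<1}" for n using h(1) by blast
      have "(\<lambda>n. \<integral>\<omega>. f (restrict (\<lambda>p. X (h n) p \<omega>) K) \<partial>M (h n)) \<longlonglongrightarrow> (\<integral>\<omega>. f (restrict (\<lambda>p. X H\<^sub>0 p \<omega>) K) \<partial>M H\<^sub>0)"
      proof (rule expectation_tendsto_from_lipschitz[where M = "\<lambda>n. M (h n)" and X = "\<lambda>n. X (h n)",
            OF Kc p[OF h01] Xm[OF h01] Xc[OF h01] p[OF assms(4)] Xm[OF assms(4)] Xc[OF assms(4)]])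
        show "continuous_map (C_topology K) euclideanreal f" using f by blast
        show "\<bar>f g\<bar> \<le> c" if "g \<in> C_space K" for g by (rule c[OF that])
        fix G :: "(real \<times> real \<Rightarrow> real) \<Rightarrow> real" and c l :: real
        assume G: "\<And>f. f \<in> C_space K \<Longrightarrow> \<bar>G f\<bar> \<le> c" "0 \<le> l" "\<And>f g. f \<in> C_space K \<Longrightarrow> g \<in> C_space K \<Longrightarrow> \<bar>G f - G g\<bar> \<le> l * C_dist K f g"
        have H0: "0 < H\<^sub>0" "H\<^sub>0 < 1" using assms(4) by auto
        show "(\<lambda>n. \<integral>\<omega>. G (restrict (\<lambda>p. X (h n) p \<omega>) K) \<partial>M (h n)) \<longlonglongrightarrow> (\<integral>\<omega>. G (restrict (\<lambda>p. X H\<^sub>0 p \<omega>) K) \<partial>M H\<^sub>0)"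
          unfolding Xeq[symmetric] K_def
          by (rule local_time_lipschitz_convergence[OF assms(1)[OF h01] assms(2)[OF h01] assms(3)[OF h01]
                assms(1)[OF assms(4)] assms(2)[OF assms(4)] assms(3)[OF assms(4)] h(2) H0 assms(5,6)
                G(1)[unfolded K_def] G(3)[unfolded K_def] G(2)])
      qed
      moreover have "continuous_map (C_topology K) euclideanreal f" using f by blast
      ultimately show "((\<lambda>H. integral\<^sup>L (law_on K (M H) (L H)) f) \<circ> h) \<longlonglongrightarrow> integral\<^sup>L (law_on K (M H\<^sub>0) (L H\<^sub>0)) f"
        unfolding comp_def by (simp only: int_law[OF h01] int_law[OF assms(4)])
    qed
  qed
  then show ?thesis unfolding K_def .
qed

end
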